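(* Let $X$ be a finite nonempty poset, let $f:X\to\mathbb{R}$ be a Morse function and let $M$ be an admissible Morse matching for $f$. Then the order complex $\mathcal{K}(X)$ is homotopy equivalent to a CW-complex constructed by inductively gluing cones over the order complexes of the descending links of the critical points. Concretely, if $t_0<t_1<\ldots<t_r$ are the values of $f$ and $C_i$ denotes the set of critical points $x\in X$ (with respect to $M$) with $f(x)=t_i$, then there is a filtration of $X$ by subposets $$\emptyset=\tilde X_{-1}\subseteq X_0\subseteq \tilde X_0\subseteq X_1\subseteq \tilde X_1\subseteq\ldots\subseteq X_i\subseteq\tilde X_i\subseteq\ldots\subseteq X_r=X$$ such that, for all $0\le i\le r$, $$\mathcal{K}(X_i)=\mathcal{K}(\tilde X_{i-1})\cup\bigcup_{x\in C_i}x\,\mathcal{K}(\hat U_x),$$ where each cone $x\,\mathcal{K}(\hat U_x)$ is glued to $\mathcal{K}(\tilde X_{i-1})$ along its base $\mathcal{K}(\hat U_x)$, and such that, for all $0\le i\le r-1$, $\mathcal{K}(X_i)\subseteq\mathcal{K}(\tilde X_i)$ is a strong deformation retract.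
   Context: All posets and CW-complexes are finite. For $x,y$ in a poset $X$, write $x\prec y$ if $y$ covers $x$, i.e. $x<y$ and there is no $z\in X$ with $x<z<y$. The Hasse diagram $\mathcal{H}(X)$ is the directed graph whose vertices are the points of $X$ and whose edges are the pairs $(x,y)$ with $x\prec y$ (directed from $x$ to $y$). The order complex $\mathcal{K}(X)$ is the simplicial complex of nonempty chains of $X$. A poset is homotopically trivial if its order complex is contractible (in particular nonempty). For a subposet $Y\subseteq X$, $\mathcal{K}(Y)$ is regarded as a subcomplex of $\mathcal{K}(X)$; topological statements concern geometric realizations. The descending link of $x\in X$ is the subposet $\hat U_x=\{y\in X : y<x\}$. For a simplicial complex $L$ and a vertex $x\notin L$, $xL$ denotes the simplicial cone with apex $x$ and base $L$ (if $L$ is empty, $xL$ is the single vertex $x$). A function $f:X\to\mathbb{R}$ is a Morse function if $f(x)<f(y)$ whenever $x\prec y$ in $X$. An edge $(x,y)\in\mathcal{H}(X)$ is admissible for $f$ if (1) $\hat U_y-\{x\}$ is homotopically trivial, and (2) there is no $z\in X$ with $f(x)<f(z)<f(y)$. A matching $M$ on $\mathcal{H}(X)$ is a set of edges such that each vertex is incident to at most one edge in $M$. Given $M$, $\mathcal{H}_M(X)$ is the directed graph obtained from $\mathcal{H}(X)$ by reversing the orientation of all edges not in $M$. $M$ is a Morse matching if $\mathcal{H}_M(X)$ is acyclic (has no directed cycles). It is admissible for $f$ if every edge in $M$ is admissible for $f$. The critical points are the points of $X$ not incident to any edge in $M$. *)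

theory Defs
  imports "HOL-Analysis.Analysis"
begin

text \<open>
  A finite poset is a finite subset of a type of class \<^class>\<open>order\<close>, with the induced order.
\<close>

section \<open>Simplicial complexes\<close>

definition order_complex :: "'a::order set \<Rightarrow> 'a set set" where
  "order_complex X =
     {c. c \<subseteq> X \<and> c \<noteq> {} \<and> finite c \<and> Complete_Partial_Order.chain (\<le>) c}"

definition simplicial_cone :: "'a \<Rightarrow> 'a set set \<Rightarrow> 'a set set" where
  "simplicial_cone x L = insert {x} (L \<union> insert x ` L)"

text \<open>
  Points of the realization are given by their barycentric coordinates. The function type carries
  the product topology, which on a complex with finitely many vertices induces the usual topology.
\<close>

definition realization :: "'a set set \<Rightarrow> ('a \<Rightarrow> real) set" where
  "realization L =
     {w. (\<forall>v. 0 \<le> w v) \<and> {v. w v \<noteq> 0} \<in> L \<and> (\<Sum>v | w v \<noteq> 0. w v) = 1}"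

abbreviation realization_top :: "'a set set \<Rightarrow> ('a \<Rightarrow> real) topology" where
  "realization_top L \<equiv> top_of_set (realization L)"

text \<open>
  In the library the empty space is contractible, so nonemptiness has to be required separately.
\<close>

definition homotopically_trivial :: "'a::order set \<Rightarrow> bool" where
  "homotopically_trivial X \<longleftrightarrow>
     X \<noteq> {} \<and> contractible_space (realization_top (order_complex X))"

section \<open>Morse functions and Morse matchings on posets\<close>

definition hasse :: "'a::order set \<Rightarrow> ('a \<times> 'a) set" where
  "hasse X = {(x, y). x \<in> X \<and> y \<in> X \<and> x < y \<and> \<not> (\<exists>z\<in>X. x < z \<and> z < y)}"

definition descending_link :: "'a::order set \<Rightarrow> 'a \<Rightarrow> 'a set" where
  "descending_link X x = {y \<in> X. y < x}"

definition morse_function :: "'a::order set \<Rightarrow> ('a \<Rightarrow> real) \<Rightarrow> bool" where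
  "morse_function X f \<longleftrightarrow> (\<forall>(x, y) \<in> hasse X. f x < f y)"

definition admissible_edge :: "'a::order set \<Rightarrow> ('a \<Rightarrow> real) \<Rightarrow> 'a \<times> 'a \<Rightarrow> bool" where
  "admissible_edge X f e \<longleftrightarrow> e \<in> hasse X \<and>
     (case e of (x, y) \<Rightarrow>
        homotopically_trivial (descending_link X y - {x}) \<and>
        \<not> (\<exists>z\<in>X. f x < f z \<and> f z < f y))"

definition incident :: "'a \<Rightarrow> 'a \<times> 'a \<Rightarrow> bool" where
  "incident x e \<longleftrightarrow> x = fst e \<or> x = snd e"

definition matching :: "'a::order set \<Rightarrow> ('a \<times> 'a) set \<Rightarrow> bool" where
  "matching X M \<longleftrightarrow> M \<subseteq> hasse X \<and>
     (\<forall>x\<in>X. \<forall>e\<in>M. \<forall>e'\<in>M. incident x e \<longrightarrow> incident x e' \<longrightarrow> e = e')"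

definition hasse_rev :: "'a::order set \<Rightarrow> ('a \<times> 'a) set \<Rightarrow> ('a \<times> 'a) set" where
  "hasse_rev X M = M \<union> (hasse X - M)\<inverse>"

definition morse_matching :: "'a::order set \<Rightarrow> ('a \<times> 'a) set \<Rightarrow> bool" where
  "morse_matching X M \<longleftrightarrow> matching X M \<and> acyclic (hasse_rev X M)"

definition admissible_matching ::
  "'a::order set \<Rightarrow> ('a \<Rightarrow> real) \<Rightarrow> ('a \<times> 'a) set \<Rightarrow> bool" where
  "admissible_matching X f M \<longleftrightarrow> (\<forall>e\<in>M. admissible_edge X f e)"

definition critical_points :: "'a::order set \<Rightarrow> ('a \<times> 'a) set \<Rightarrow> 'a set" where
  "critical_points X M = {x \<in> X. \<forall>e\<in>M. \<not> incident x e}"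

section \<open>Strong deformation retracts, CW-complexes, gluing of cones\<close>

definition strong_deformation_retract_of :: "'b set \<Rightarrow> 'b topology \<Rightarrow> bool"
    (infix \<open>strong'_deformation'_retract'_of\<close> 50) where
  "A strong_deformation_retract_of T \<longleftrightarrow> A \<subseteq> topspace T \<and>
     (\<exists>r. continuous_map T (subtopology T A) r \<and>
          homotopic_with (\<lambda>h. \<forall>a\<in>A. h a = a) T T id r)"

definition disc :: "nat \<Rightarrow> (nat \<Rightarrow> real) set" where
  "disc n = {x \<in> topspace (Euclidean_space n). (\<Sum>i<n. (x i)\<^sup>2) \<le> 1}"

definition open_disc :: "nat \<Rightarrow> (nat \<Rightarrow> real) set" where
  "open_disc n = {x \<in> topspace (Euclidean_space n). (\<Sum>i<n. (x i)\<^sup>2) < 1}"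

text \<open>
  The \<open>k\<close>-th of the \<open>N\<close> cells has dimension \<open>d k\<close> and characteristic map \<open>\<Phi> k\<close>. As there are only
  finitely many cells, closure-finiteness and the weak topology are automatic; the restriction of
  \<open>\<Phi> k\<close> to the open disc is a homeomorphism onto its image because the disc is compact and the
  space is Hausdorff.
\<close>

definition finite_CW_complex :: "'b topology \<Rightarrow> bool" where
  "finite_CW_complex T \<longleftrightarrow> Hausdorff_space T \<and>
     (\<exists>(N::nat) d \<Phi>.
        (\<forall>k<N. continuous_map (subtopology (Euclidean_space (d k)) (disc (d k))) T (\<Phi> k) \<and>
               inj_on (\<Phi> k) (open_disc (d k)) \<and>
               \<Phi> k ` (disc (d k) - open_disc (d k)) \<subseteq>
                 (\<Union>j\<in>{j. j < N \<and> d j < d k}. \<Phi> j ` open_disc (d j))) \<and>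
        disjoint_family_on (\<lambda>k. \<Phi> k ` open_disc (d k)) {..<N} \<and>
        (\<Union>k<N. \<Phi> k ` open_disc (d k)) = topspace T)"

text \<open>
  \<open>T\<close> is the adjunction space obtained from \<open>S\<close> by attaching, for each \<open>x \<in> C\<close>, the cone \<open>x(L x)\<close>
  along the continuous map from its base \<open>L x\<close> to \<open>S\<close> that is the restriction of \<open>\<gamma> x\<close>.
  As a set, \<open>T\<close> is the disjoint union of \<open>S\<close> and the cones without their bases; \<open>\<gamma> x\<close> is the
  canonical map of the cone to \<open>T\<close>; and \<open>T\<close> has the quotient topology from the disjoint
  union of \<open>S\<close> and the cones.
\<close>

definition cones_glued ::
  "'b topology \<Rightarrow> 'a set \<Rightarrow> ('a \<Rightarrow> 'a set set) \<Rightarrow> ('a \<Rightarrow> ('a \<Rightarrow> real) \<Rightarrow> 'b) \<Rightarrow> 'b topology \<Rightarrow> bool"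
where
  "cones_glued S C L \<gamma> T \<longleftrightarrow>
     (let B = (\<lambda>x. realization (L x));
          K = (\<lambda>x. realization (simplicial_cone x (L x)));
          E = (\<lambda>x. \<gamma> x ` (K x - B x))
      in (\<forall>x\<in>C. continuous_map (top_of_set (B x)) S (\<gamma> x) \<and>
                inj_on (\<gamma> x) (K x - B x) \<and>
                E x \<inter> topspace S = {}) \<and>
         disjoint_family_on E C \<and>
         topspace T = topspace S \<union> (\<Union>x\<in>C. E x) \<and>
         (\<forall>U \<subseteq> topspace T.
            openin T U \<longleftrightarrow>
              openin S (U \<inter> topspace S) \<and>
              (\<forall>x\<in>C. openin (top_of_set (K x)) {p \<in> K x. \<gamma> x p \<in> U})))"

end

theory Submission
  imports Defs
begin

text \<open>
  The subposet \<open>X~\<^sub>i\<close> is \<open>X\<^sub>i\<close> together with the matched pairs \<open>(x, y)\<close> with \<open>f x = t\<^sub>i\<close>, and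
  \<open>X\<^sub>i\<^sub>+\<^sub>1\<close> adds the critical points of value \<open>t\<^sub>i\<^sub>+\<^sub>1\<close>, which form an antichain of maximal elements. Acyclicity
  allows the pairs to be added one at a time such that the points below \<open>y\<close> other than \<open>x\<close> are already
  present and nothing present lies above \<open>x\<close> or \<open>y\<close>. Then moving the weight of \<open>x\<close> to \<open>y\<close> and retracting
  the cone from \<open>y\<close> onto its contractible base removes the pair again.

  The CW-complexes \<open>Y\<^sub>i\<close> are built along this filtration: the base of each new cone is mapped to \<open>Y\<^sub>i\<close> by a
  cellular approximation of its inclusion into the order complex of \<open>X~\<^sub>i\<^sub>-\<^sub>1\<close> followed by the homotopy equivalence
  to \<open>Y\<^sub>i\<close>, and gluing cones along homotopic maps into homotopy equivalent spaces gives homotopy equivalent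
  spaces. Cellular approximation rests on an elementary fact: a Lipschitz map from a \<open>k\<close>-simplex to an
  \<open>n\<close>-simplex with \<open>k < n\<close> is not surjective, by counting the points of a fine grid.
\<close>

section \<open>Simplices and realizations\<close>

definition closed_simplex :: "'a set \<Rightarrow> ('a \<Rightarrow> real) set" where
  "closed_simplex \<tau> = {w. (\<forall>v. 0 \<le> w v) \<and> (\<forall>v. v \<notin> \<tau> \<longrightarrow> w v = 0) \<and> sum w \<tau> = 1}"

definition open_simplex :: "'a set \<Rightarrow> ('a \<Rightarrow> real) set" where
  "open_simplex \<tau> = {w \<in> closed_simplex \<tau>. \<forall>v\<in>\<tau>. 0 < w v}"

definition supp :: "('a \<Rightarrow> real) \<Rightarrow> 'a set" where
  "supp w = {v. w v \<noteq> 0}"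

definition finite_complex :: "'a set set \<Rightarrow> bool" where
  "finite_complex L \<longleftrightarrow> finite L \<and> (\<forall>\<sigma>\<in>L. finite \<sigma> \<and> \<sigma> \<noteq> {} \<and> (\<forall>\<rho>\<subseteq>\<sigma>. \<rho> \<noteq> {} \<longrightarrow> \<rho> \<in> L))"

lemma finite_complexD:
  assumes "finite_complex L" "\<sigma> \<in> L"
  shows "finite \<sigma>" "\<sigma> \<noteq> {}" "\<rho> \<subseteq> \<sigma> \<Longrightarrow> \<rho> \<noteq> {} \<Longrightarrow> \<rho> \<in> L"
  using assms unfolding finite_complex_def by blast+

lemma closed_simplexD:
  assumes "w \<in> closed_simplex \<tau>"
  shows "0 \<le> w v" "v \<notin> \<tau> \<Longrightarrow> w v = 0" "sum w \<tau> = 1" "supp w \<subseteq> \<tau>"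
  using assms unfolding closed_simplex_def supp_def by auto

lemma closed_simplex_le_1:
  assumes "finite \<tau>" "w \<in> closed_simplex \<tau>"
  shows "w v \<le> 1"
proof (cases "v \<in> \<tau>")
  case True
  have "w v \<le> sum w \<tau>" using True assms closed_simplexD(1)[OF assms(2)] by (intro member_le_sum) auto
  then show ?thesis using closed_simplexD(3)[OF assms(2)] by simp
next
  case False then show ?thesis using closed_simplexD(2)[OF assms(2)] by simp
qed

lemma sum_supp:
  assumes "finite \<tau>" "supp w \<subseteq> \<tau>"
  shows "sum w \<tau> = sum w (supp w)"
  using assms unfolding supp_def by (intro sum.mono_neutral_right) auto

lemma supp_nonempty: "sum w (supp w) = (1::real) \<Longrightarrow> supp w \<noteq> {}"
  by auto

lemma mem_realization_iff:
  "w \<in> realization L \<longleftrightarrow> (\<forall>v. 0 \<le> w v) \<and> supp w \<in> L \<and> sum w (supp w) = 1"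
  unfolding realization_def supp_def by simp

lemma closed_simplex_iff_supp:
  assumes "finite \<tau>"
  shows "w \<in> closed_simplex \<tau> \<longleftrightarrow> (\<forall>v. 0 \<le> w v) \<and> supp w \<subseteq> \<tau> \<and> sum w (supp w) = 1"
  proof -
  have "supp w \<subseteq> \<tau> \<longleftrightarrow> (\<forall>v. v \<notin> \<tau> \<longrightarrow> w v = 0)" by (auto simp: supp_def)
  then show ?thesis using sum_supp[OF assms, of w] unfolding closed_simplex_def by auto
qed

lemma realization_eq_Union:
  assumes "finite_complex L"
  shows "realization L = (\<Union>\<sigma>\<in>L. closed_simplex \<sigma>)"
proof (intro set_eqI iffI)
  fix w assume "w \<in> realization L"
  then show "w \<in> (\<Union>\<sigma>\<in>L. closed_simplex \<sigma>)"
    using closed_simplex_iff_supp finite_complexD(1)[OF assms] unfolding mem_realization_iff by blast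
next
  fix w assume "w \<in> (\<Union>\<sigma>\<in>L. closed_simplex \<sigma>)"
  then obtain \<sigma> where s: "\<sigma> \<in> L" "w \<in> closed_simplex \<sigma>" by blast
  then have "(\<forall>v. 0 \<le> w v) \<and> supp w \<subseteq> \<sigma> \<and> sum w (supp w) = 1"
    using closed_simplex_iff_supp finite_complexD(1)[OF assms] by blast
  then show "w \<in> realization L"
    using finite_complexD(3)[OF assms s(1)] supp_nonempty[of w] unfolding mem_realization_iff by blast
qed

lemma open_simplex_iff_supp:
  assumes "finite \<tau>"
  shows "w \<in> open_simplex \<tau> \<longleftrightarrow> (\<forall>v. 0 \<le> w v) \<and> supp w = \<tau> \<and> sum w (supp w) = 1"
  unfolding open_simplex_def using closed_simplex_iff_supp[OF assms, of w]
  by (auto simp: supp_def less_le)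

lemma compact_PiE_UNIV:
  fixes S :: "'i \<Rightarrow> real set"
  assumes "\<And>i. compact (S i)"
  shows "compact (Pi UNIV S)"
proof -
  have "compactin (product_topology (\<lambda>i. euclidean) UNIV) (PiE UNIV S)"
    using assms by (auto simp: compactin_PiE)
  then show ?thesis by (simp add: euclidean_product_topology PiE_UNIV_domain)
qed

lemma Hausdorff_space_fun: "Hausdorff_space (euclidean :: ('i \<Rightarrow> real) topology)"
proof -
  have "Hausdorff_space (product_topology (\<lambda>i::'i. (euclidean :: real topology)) UNIV)"
    by (simp add: Hausdorff_space_product_topology Hausdorff_space_euclidean)
  then show ?thesis by (simp add: euclidean_product_topology)
qed

lemma compact_closed_simplex:
  assumes "finite \<tau>"
  shows "compact (closed_simplex \<tau>)"
proof -
  have "compact (Pi UNIV (\<lambda>v. if v \<in> \<tau> then {0..1::real} else {0}))"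
    by (rule compact_PiE_UNIV) simp
  moreover have "closed {w :: 'a \<Rightarrow> real. sum w \<tau> = 1}"
    by (intro closed_Collect_eq continuous_intros continuous_on_product_coordinates)
  ultimately have "compact (Pi UNIV (\<lambda>v. if v \<in> \<tau> then {0..1::real} else {0}) \<inter> {w. sum w \<tau> = 1})"
    by (rule compact_Int_closed)
  also have "Pi UNIV (\<lambda>v. if v \<in> \<tau> then {0..1::real} else {0}) \<inter> {w. sum w \<tau> = 1} = closed_simplex \<tau>"
    using closed_simplex_le_1[OF assms] unfolding closed_simplex_def
    by (auto simp: Pi_iff split: if_splits) (metis atLeastAtMost_iff order_refl singletonD)
  finally show ?thesis .
qed

lemma compact_realization:
  assumes "finite_complex L"
  shows "compact (realization L)"
  unfolding realization_eq_Union[OF assms] using assms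
  by (intro compact_UN compact_closed_simplex) (auto simp: finite_complex_def)

lemma finite_complex_simplicial_cone:
  assumes L: "finite_complex L"
  shows "finite_complex (simplicial_cone x L)"
proof -
  have "\<rho> \<in> simplicial_cone x L" if s: "\<sigma> \<in> L" "\<rho> \<subseteq> insert x \<sigma>" "\<rho> \<noteq> {}" for \<rho> \<sigma>
  proof (cases "\<rho> - {x} = {}")
    case True then have "\<rho> = {x}" using s by auto
    then show ?thesis by (simp add: simplicial_cone_def)
  next
    case False
    have r: "\<rho> - {x} \<in> L" by (rule finite_complexD(3)[OF L s(1)]) (use s False in auto)
    show ?thesis
    proof (cases "x \<in> \<rho>")
      case True then have "\<rho> = insert x (\<rho> - {x})" by auto
      then show ?thesis using r unfolding simplicial_cone_def by blast
    next
      case False then show ?thesis using r by (simp add: simplicial_cone_def)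
    qed
  qed
  moreover have "\<rho> \<in> simplicial_cone x L" if "\<rho> \<subseteq> {x}" "\<rho> \<noteq> {}" for \<rho>
    using that by (simp add: simplicial_cone_def subset_singleton_iff)
  moreover have "\<rho> \<in> simplicial_cone x L" if "\<sigma> \<in> L" "\<rho> \<subseteq> \<sigma>" "\<rho> \<noteq> {}" for \<rho> \<sigma>
    using that finite_complexD(3)[OF L] by (auto simp: simplicial_cone_def)
  moreover have "finite (simplicial_cone x L)"
    using L by (auto simp: finite_complex_def simplicial_cone_def)
  moreover have "finite \<sigma> \<and> \<sigma> \<noteq> {}" if "\<sigma> \<in> simplicial_cone x L" for \<sigma>
    using that finite_complexD(1,2)[OF L] by (auto simp: simplicial_cone_def)
  moreover have "\<sigma> = {x} \<or> \<sigma> \<in> L \<or> (\<exists>\<sigma>'\<in>L. \<sigma> = insert x \<sigma>')" if "\<sigma> \<in> simplicial_cone x L" for \<sigma>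
    using that by (auto simp: simplicial_cone_def)
  ultimately show ?thesis
    unfolding finite_complex_def by (metis (no_types))
qed

lemma finite_complex_order_complex:
  assumes "finite X"
  shows "finite_complex (order_complex X)"
proof -
  have "finite (order_complex X)"
    by (rule finite_subset[of _ "Pow X"]) (use assms in \<open>auto simp: order_complex_def\<close>)
  then show ?thesis
    unfolding finite_complex_def order_complex_def chain_def
    by (auto intro: finite_subset)
qed

text \<open>For a vertex \<open>x\<close> outside \<open>L\<close>, a point \<open>w\<close> of the cone is \<open>(1 - s) a + s x\<close> with \<open>s = w x\<close>
  and \<open>a\<close> in the base. \<open>cone_shift x m w\<close> changes the height from \<open>s\<close> to \<open>(s - m) / (1 - m)\<close> and keeps
  \<open>a\<close>. (At \<open>m = 1\<close> division by zero makes it junk.)\<close>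

definition cone_shift :: "'a \<Rightarrow> real \<Rightarrow> ('a \<Rightarrow> real) \<Rightarrow> 'a \<Rightarrow> real" where
  "cone_shift x m w = (\<lambda>v. (w v - (if v = x then m else 0)) / (1 - m))"

definition cone_base :: "'a \<Rightarrow> ('a \<Rightarrow> real) \<Rightarrow> 'a \<Rightarrow> real" where
  "cone_base x w = cone_shift x (w x) w"

definition cone_join :: "'a \<Rightarrow> real \<Rightarrow> ('a \<Rightarrow> real) \<Rightarrow> 'a \<Rightarrow> real" where
  "cone_join x s a = (\<lambda>v. (1 - s) * a v + (if v = x then s else 0))"

locale pointed_cone =
  fixes x :: 'a and L :: "'a set set"
  assumes fin: "finite_complex L" and apex: "x \<notin> \<Union>L"
begin

abbreviation "B \<equiv> realization L"
abbreviation "K \<equiv> realization (simplicial_cone x L)"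

lemma mem_cone_iff:
  "w \<in> K \<longleftrightarrow> (\<forall>v. 0 \<le> w v) \<and> finite (supp w) \<and> supp w - {x} \<in> insert {} L \<and> sum w (supp w) = 1"
proof -
  have "supp w \<in> simplicial_cone x L \<longleftrightarrow> finite (supp w) \<and> supp w - {x} \<in> insert {} L"
    if "supp w \<noteq> {}"
  proof
    assume "supp w \<in> simplicial_cone x L"
    moreover have "finite (supp w)"
      using finite_complexD(1)[OF finite_complex_simplicial_cone[OF fin] calculation] .
    ultimately show "finite (supp w) \<and> supp w - {x} \<in> insert {} L"
      using apex unfolding simplicial_cone_def by (auto simp: insert_Diff_if)
  next
    assume "finite (supp w) \<and> supp w - {x} \<in> insert {} L"
    then show "supp w \<in> simplicial_cone x L"
      using that unfolding simplicial_cone_def by (cases "x \<in> supp w") (auto simp: insert_absorb image_iff insert_Diff)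
  qed
  then show ?thesis unfolding mem_realization_iff using supp_nonempty by blast
qed

lemma base_iff: "w \<in> B \<longleftrightarrow> w \<in> K \<and> w x = 0"
proof -
  have "w \<in> B \<Longrightarrow> w x = 0"
    using apex unfolding mem_realization_iff supp_def by blast
  moreover have "w \<in> B \<Longrightarrow> w \<in> K"
    unfolding mem_realization_iff by (simp add: simplicial_cone_def)
  moreover have "w \<in> K \<Longrightarrow> w x = 0 \<Longrightarrow> w \<in> B"
  proof -
    assume w: "w \<in> K" "w x = 0"
    then have "supp w - {x} = supp w" by (auto simp: supp_def)
    then show "w \<in> B" using w(1) supp_nonempty[of w] unfolding mem_cone_iff mem_realization_iff[of w L] by auto
  qed
  ultimately show ?thesis by blast
qed

lemma cone_height: "w \<in> K \<Longrightarrow> 0 \<le> w x \<and> w x \<le> 1"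
proof -
  assume w: "w \<in> K"
  then obtain \<sigma> where s: "\<sigma> \<in> simplicial_cone x L" "w \<in> closed_simplex \<sigma>"
    using realization_eq_Union[OF finite_complex_simplicial_cone[OF fin]] by blast
  then show ?thesis
    using closed_simplex_le_1[OF _ s(2)] closed_simplexD(1)[OF s(2)]
      finite_complexD(1)[OF finite_complex_simplicial_cone[OF fin]] by blast
qed

lemma cone_sum:
  assumes "w \<in> K"
  shows "w x + sum w (supp w - {x}) = 1"
proof -
  have f: "finite (supp w)" and s: "sum w (supp w) = 1" using assms by (auto simp: mem_cone_iff)
  show ?thesis
  proof (cases "x \<in> supp w")
    case True then show ?thesis using f s by (simp add: sum.remove)
  next
    case False then show ?thesis using s by (simp add: supp_def)
  qed
qed

lemma mem_coneI:
  assumes "\<And>v. 0 \<le> w v" "supp w - {x} = {} \<or> supp w - {x} \<in> L" "w x + sum w (supp w - {x}) = 1"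
  shows "w \<in> K"
proof -
  have f: "finite (supp w - {x})" using assms(2) finite_complexD(1)[OF fin] by (metis finite.emptyI)
  then have f': "finite (supp w)" by simp
  have "sum w (supp w) = w x + sum w (supp w - {x})"
  proof (cases "x \<in> supp w")
    case True then show ?thesis using f' by (simp add: sum.remove)
  next
    case False then show ?thesis by (simp add: supp_def)
  qed
  then show ?thesis using assms f' by (auto simp: mem_cone_iff)
qed

lemma cone_apex_unique:
  assumes "w \<in> K" "w x = 1" shows "w = (\<lambda>v. if v = x then 1 else 0)"
proof -
  have "sum w (supp w - {x}) = 0" using cone_sum[OF assms(1)] assms(2) by simp
  moreover have "finite (supp w - {x})" "\<And>v. 0 \<le> w v" using assms(1) by (auto simp: mem_cone_iff)
  ultimately have "\<forall>v\<in>supp w - {x}. w v = 0" by (simp add: sum_nonneg_eq_0_iff)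
  then show ?thesis using assms(2) by (auto simp: supp_def fun_eq_iff)
qed

lemma cone_shift_mem:
  assumes w: "w \<in> K" and m: "0 \<le> m" "m \<le> w x" "m < 1"
  shows "cone_shift x m w \<in> K" "cone_shift x m w x = (w x - m) / (1 - m)"
proof -
  let ?w = "cone_shift x m w"
  show x: "?w x = (w x - m) / (1 - m)" by (simp add: cone_shift_def)
  have s: "supp ?w - {x} = supp w - {x}" using m by (auto simp: supp_def cone_shift_def)
  have "sum ?w (supp w - {x}) = (\<Sum>v\<in>supp w - {x}. w v / (1 - m))"
    by (intro sum.cong) (auto simp: cone_shift_def)
  also have "\<dots> = (1 - w x) / (1 - m)" using cone_sum[OF w] by (simp add: sum_divide_distrib[symmetric])
  finally have "?w x + sum ?w (supp ?w - {x}) = 1"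
    unfolding x s using m by (simp add: field_simps)
  moreover have "0 \<le> ?w v" for v using w m by (auto simp: mem_cone_iff cone_shift_def)
  moreover have "supp ?w - {x} = {} \<or> supp ?w - {x} \<in> L" using w s by (auto simp: mem_cone_iff)
  ultimately show "?w \<in> K" by (intro mem_coneI) auto
qed

lemma cone_base_mem:
  assumes w: "w \<in> K" and m: "w x < 1"
  shows "cone_base x w \<in> B"
  using cone_shift_mem[OF w _ _ m] cone_height[OF w] unfolding base_iff cone_base_def by auto

lemma cone_base_base [simp]: "w \<in> B \<Longrightarrow> cone_base x w = w"
  by (auto simp: base_iff cone_base_def cone_shift_def)

lemma cone_shift_0 [simp]: "cone_shift x 0 w = w"
  by (auto simp: cone_shift_def)

lemma cone_shift_cone_shift:
  assumes "m < 1" "n < 1"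
  shows "cone_shift x n (cone_shift x m w) = cone_shift x (m + n - m * n) w"
proof -
  have "1 - (m + n - m * n) = (1 - m) * (1 - n)" by (simp add: algebra_simps)
  then show ?thesis using assms unfolding cone_shift_def
    by (auto simp: fun_eq_iff field_simps)
qed

lemma cone_base_cone_shift:
  assumes "w \<in> K" "m < 1" "w x < 1"
  shows "cone_base x (cone_shift x m w) = cone_base x w"
proof -
  have "cone_shift x m w x = (w x - m) / (1 - m)" by (simp add: cone_shift_def)
  moreover have "(w x - m) / (1 - m) < 1" using assms by simp
  moreover have "m + (w x - m) / (1 - m) - m * ((w x - m) / (1 - m)) = w x"
  proof -
    have "m + q - m * q = m + (1 - m) * q" for q :: real by (simp add: algebra_simps)
    then have "m + (w x - m) / (1 - m) - m * ((w x - m) / (1 - m)) = m + (1 - m) * ((w x - m) / (1 - m))" .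
    also have "\<dots> = w x" using assms by simp
    finally show ?thesis .
  qed
  ultimately show ?thesis
    unfolding cone_base_def by (simp add: cone_shift_cone_shift assms)
qed

lemma cone_join_mem:
  assumes a: "a \<in> B" and s: "0 \<le> s" "s \<le> 1"
  shows "cone_join x s a \<in> K" "cone_join x s a x = s" "s < 1 \<Longrightarrow> cone_base x (cone_join x s a) = a"
proof -
  have ax: "a x = 0" and aK: "a \<in> K" using a base_iff by auto
  let ?w = "cone_join x s a"
  show x: "?w x = s" by (simp add: cone_join_def ax)
  show "cone_base x ?w = a" if "s < 1"
    unfolding cone_base_def x using that ax by (auto simp: cone_shift_def cone_join_def fun_eq_iff)
  show "?w \<in> K"
  proof (cases "s = 1")
    case True
    then have "supp ?w - {x} = {}" by (auto simp: supp_def cone_join_def)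
    then show ?thesis using x True
      by (intro mem_coneI) (auto simp: cone_join_def)
  next
    case False
    have sp: "supp ?w - {x} = supp a" using False ax by (auto simp: supp_def cone_join_def)
    have nn: "0 \<le> ?w v" for v using a s unfolding mem_realization_iff by (auto simp: cone_join_def)
    have "sum ?w (supp a) = (\<Sum>v\<in>supp a. (1 - s) * a v)"
      by (intro sum.cong) (use ax in \<open>auto simp: cone_join_def supp_def\<close>)
    also have "\<dots> = 1 - s" using a unfolding mem_realization_iff by (simp add: sum_distrib_left[symmetric])
    finally have "?w x + sum ?w (supp ?w - {x}) = 1" using sp x by simp
    moreover have "supp a \<in> L" using a unfolding mem_realization_iff by auto
    ultimately show ?thesis using sp nn by (intro mem_coneI) auto
  qed
qed

lemma cone_join_base:
  assumes "w \<in> K" "w x < 1"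
  shows "cone_join x (w x) (cone_base x w) = w"
  using assms by (auto simp: cone_join_def cone_base_def cone_shift_def fun_eq_iff)

end

lemma continuous_on_coordinate:
  fixes f :: "'b::topological_space \<Rightarrow> 'a \<Rightarrow> real"
  assumes "continuous_on S f" shows "continuous_on S (\<lambda>x. f x v)"
  using continuous_on_product_then_coordinatewise[OF assms] .

lemma continuous_on_cone_shift [continuous_intros]:
  assumes "continuous_on S m" "continuous_on S w" "\<And>y. y \<in> S \<Longrightarrow> m y \<noteq> 1"
  shows "continuous_on S (\<lambda>y. cone_shift x (m y) (w y))"
  unfolding cone_shift_def
proof (rule continuous_on_coordinatewise_then_product)
  fix v
  show "continuous_on S (\<lambda>y. (w y v - (if v = x then m y else 0)) / (1 - m y))"
    using assms continuous_on_coordinate[of S _ v] by (cases "v = x") (auto intro!: continuous_intros)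
qed

lemma continuous_on_cone_join [continuous_intros]:
  assumes "continuous_on S s" "continuous_on S a"
  shows "continuous_on S (\<lambda>y. cone_join x (s y) (a y))"
  unfolding cone_join_def
proof (rule continuous_on_coordinatewise_then_product)
  fix v
  show "continuous_on S (\<lambda>y. (1 - s y) * a y v + (if v = x then s y else 0))"
    using assms continuous_on_coordinate[of S _ v] by (cases "v = x") (auto intro!: continuous_intros)
qed

lemma continuous_on_cone_base [continuous_intros]:
  assumes "continuous_on S w" "\<And>y. y \<in> S \<Longrightarrow> w y x \<noteq> 1"
  shows "continuous_on S (\<lambda>y. cone_base x (w y))"
  unfolding cone_base_def using assms continuous_on_coordinate[OF assms(1)] by (intro continuous_intros) auto

section \<open>Gluing cones\<close>

lemma continuous_map_from_charts:
  assumes T: "Hausdorff_space T" and I: "finite I"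
    and cov: "topspace T \<subseteq> S \<union> (\<Union>i\<in>I. \<gamma> i ` topspace (P i))"
    and S: "closedin T S" "continuous_map (subtopology T S) W f"
    and P: "\<And>i. i \<in> I \<Longrightarrow> compact_space (P i)"
      "\<And>i. i \<in> I \<Longrightarrow> continuous_map (P i) T (\<gamma> i)"
      "\<And>i. i \<in> I \<Longrightarrow> continuous_map (P i) W (\<lambda>p. f (\<gamma> i p))"
  shows "continuous_map T W f"
proof -
  have ST: "S \<subseteq> topspace T" using S(1) closedin_subset by blast
  have im: "\<gamma> i p \<in> topspace T" if "i \<in> I" "p \<in> topspace (P i)" for i p
    using P(2)[OF that(1)] that(2) by (auto simp: continuous_map_def)
  have fS: "f y \<in> topspace W" if "y \<in> S" for y
    using S(2) that ST by (auto simp: continuous_map_def)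
  have fP: "f (\<gamma> i p) \<in> topspace W" if "i \<in> I" "p \<in> topspace (P i)" for i p
    using P(3)[OF that(1)] that(2) by (auto simp: continuous_map_def)
  have "f y \<in> topspace W" if "y \<in> topspace T" for y
    using cov that fS fP by blast
  moreover have "closedin T {y \<in> topspace T. f y \<in> V}" if V: "closedin W V" for V
  proof -
    have eq: "{y \<in> topspace T. f y \<in> V} = {y \<in> S. f y \<in> V} \<union> (\<Union>i\<in>I. \<gamma> i ` {p \<in> topspace (P i). f (\<gamma> i p) \<in> V})"
      using cov ST im by blast
    have "closedin (subtopology T S) {y \<in> topspace (subtopology T S). f y \<in> V}"
      using S(2) V by (auto simp: continuous_map_closedin)
    then have 1: "closedin T {y \<in> S. f y \<in> V}"
      using closedin_trans_full[OF _ S(1)] by (simp add: topspace_subtopology_subset[OF ST] del: topspace_subtopology)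
    have 2: "closedin T (\<gamma> i ` {p \<in> topspace (P i). f (\<gamma> i p) \<in> V})" if i: "i \<in> I" for i
    proof -
      have "closedin (P i) {p \<in> topspace (P i). f (\<gamma> i p) \<in> V}"
        using P(3)[OF i] V by (auto simp: continuous_map_closedin)
      then show ?thesis
        using P(1,2)[OF i] T closedin_compact_space compactin_imp_closedin image_compactin by blast
    qed
    show ?thesis unfolding eq by (intro closedin_Un 1 closedin_Union) (use I 2 in auto)
  qed
  ultimately show ?thesis by (auto simp: continuous_map_closedin)
qed

definition glued ::
  "'b topology \<Rightarrow> 'a set \<Rightarrow> ('a \<Rightarrow> 'a set set) \<Rightarrow> ('a \<Rightarrow> ('a \<Rightarrow> real) \<Rightarrow> 'b) \<Rightarrow> 'b topology \<Rightarrow> bool"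
where
  "glued S C L \<gamma> T \<longleftrightarrow>
     finite C \<and> (\<forall>x\<in>C. pointed_cone x (L x)) \<and> compact_space S \<and> Hausdorff_space T \<and>
     topspace S \<subseteq> topspace T \<and> subtopology T (topspace S) = S \<and>
     (\<forall>x\<in>C. continuous_map (top_of_set (realization (simplicial_cone x (L x)))) T (\<gamma> x) \<and>
            \<gamma> x ` realization (L x) \<subseteq> topspace S \<and>
            inj_on (\<gamma> x) (realization (simplicial_cone x (L x)) - realization (L x)) \<and>
            \<gamma> x ` (realization (simplicial_cone x (L x)) - realization (L x)) \<inter> topspace S = {}) \<and>
     disjoint_family_on (\<lambda>x. \<gamma> x ` (realization (simplicial_cone x (L x)) - realization (L x))) C \<and>
     topspace T = topspace S \<union> (\<Union>x\<in>C. \<gamma> x ` (realization (simplicial_cone x (L x)) - realization (L x)))"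

locale gluing =
  fixes S :: "'b topology" and C :: "'a set" and L :: "'a \<Rightarrow> 'a set set"
    and \<gamma> :: "'a \<Rightarrow> ('a \<Rightarrow> real) \<Rightarrow> 'b" and T :: "'b topology"
  assumes glued: "glued S C L \<gamma> T"
begin

abbreviation "base x \<equiv> realization (L x)"
abbreviation "con x \<equiv> realization (simplicial_cone x (L x))"

lemma
  shows finite_C: "finite C" and cone: "x \<in> C \<Longrightarrow> pointed_cone x (L x)" and compact_S: "compact_space S"
    and haus: "Hausdorff_space T" and sub: "topspace S \<subseteq> topspace T"
    and subtop: "subtopology T (topspace S) = S"
    and cont: "x \<in> C \<Longrightarrow> continuous_map (top_of_set (con x)) T (\<gamma> x)"
    and base: "x \<in> C \<Longrightarrow> w \<in> base x \<Longrightarrow> \<gamma> x w \<in> topspace S"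
    and inj: "x \<in> C \<Longrightarrow> inj_on (\<gamma> x) (con x - base x)"
    and off: "x \<in> C \<Longrightarrow> w \<in> con x - base x \<Longrightarrow> \<gamma> x w \<notin> topspace S"
    and disj: "disjoint_family_on (\<lambda>x. \<gamma> x ` (con x - base x)) C"
    and top: "topspace T = topspace S \<union> (\<Union>x\<in>C. \<gamma> x ` (con x - base x))"
proof -
  note g = glued[unfolded glued_def]
  show "finite C" "x \<in> C \<Longrightarrow> pointed_cone x (L x)" "compact_space S" "Hausdorff_space T"
    "topspace S \<subseteq> topspace T" "subtopology T (topspace S) = S"
    "x \<in> C \<Longrightarrow> continuous_map (top_of_set (con x)) T (\<gamma> x)"
    "x \<in> C \<Longrightarrow> inj_on (\<gamma> x) (con x - base x)"
    "disjoint_family_on (\<lambda>x. \<gamma> x ` (con x - base x)) C"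
    "topspace T = topspace S \<union> (\<Union>x\<in>C. \<gamma> x ` (con x - base x))"
    using g by simp_all
  show "x \<in> C \<Longrightarrow> w \<in> base x \<Longrightarrow> \<gamma> x w \<in> topspace S"
    "x \<in> C \<Longrightarrow> w \<in> con x - base x \<Longrightarrow> \<gamma> x w \<notin> topspace S"
  proof -
    assume x: "x \<in> C"
    then have "\<gamma> x ` base x \<subseteq> topspace S" "\<gamma> x ` (con x - base x) \<inter> topspace S = {}" using g by simp_all
    then show "w \<in> base x \<Longrightarrow> \<gamma> x w \<in> topspace S" "w \<in> con x - base x \<Longrightarrow> \<gamma> x w \<notin> topspace S" by blast+
  qed
qed

lemma base_sub: "x \<in> C \<Longrightarrow> base x \<subseteq> con x"
  using pointed_cone.base_iff[OF cone] by blast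

lemma compact_con: "x \<in> C \<Longrightarrow> compact_space (top_of_set (con x))"
  by (simp add: compact_space_subtopology compact_realization finite_complex_simplicial_cone pointed_cone.fin[OF cone])

lemma closed_S: "closedin T (topspace S)"
proof -
  have "compactin T (topspace S)"
    using compact_S subtop sub by (metis compact_space_def compactin_subtopology topspace_subtopology_subset)
  then show ?thesis using haus compactin_imp_closedin by blast
qed

lemma cover: "topspace T \<subseteq> topspace S \<union> (\<Union>x\<in>C. \<gamma> x ` con x)"
  unfolding top by blast

lemma gamma_mem: "x \<in> C \<Longrightarrow> w \<in> con x \<Longrightarrow> \<gamma> x w \<in> topspace T"
  using cont by (force simp: continuous_map_def)

lemma cont_base: "x \<in> C \<Longrightarrow> continuous_map (top_of_set (base x)) S (\<gamma> x)"
proof -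
  assume x: "x \<in> C"
  have "continuous_map (top_of_set (base x)) T (\<gamma> x)"
    by (rule continuous_map_from_subtopology_mono[OF cont[OF x] base_sub[OF x]])
  then have "continuous_map (top_of_set (base x)) (subtopology T (topspace S)) (\<gamma> x)"
    using base[OF x] by (auto simp: continuous_map_in_subtopology)
  then show ?thesis by (simp add: subtop)
qed

lemma closed_images_union:
  assumes "closedin S V" "\<And>x. x \<in> C \<Longrightarrow> closedin (top_of_set (con x)) (Q x)"
  shows "closedin T (V \<union> (\<Union>x\<in>C. \<gamma> x ` Q x))"
proof -
  have "closedin T V"
    using assms(1) closed_S subtop by (metis closedin_trans_full)
  moreover have "closedin T (\<gamma> x ` Q x)" if "x \<in> C" for x
    using assms(2)[OF that] compact_con[OF that] cont[OF that] haus
    by (meson closedin_compact_space compactin_imp_closedin image_compactin)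
  ultimately show ?thesis
    by (intro closedin_Un closedin_Union) (use finite_C in auto)
qed

lemma compact_T: "compact_space T"
proof -
  have "compactin T (topspace S)"
    using compact_S subtop sub by (metis compact_space_def compactin_subtopology topspace_subtopology_subset)
  moreover have "compactin T (\<gamma> x ` con x)" if "x \<in> C" for x
    using compact_con[OF that] cont[OF that] by (metis compact_space_def image_compactin topspace_euclidean_subtopology)
  ultimately have "compactin T (topspace S \<union> (\<Union>x\<in>C. \<gamma> x ` con x))"
    by (intro compactin_Un compactin_Union) (use finite_C in auto)
  moreover have "topspace S \<union> (\<Union>x\<in>C. \<gamma> x ` con x) = topspace T"
    using cover sub gamma_mem by blast
  ultimately show ?thesis by (simp add: compact_space_def)
qed

lemma openin_iff:
  assumes U: "U \<subseteq> topspace T"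
  shows "openin T U \<longleftrightarrow> openin S (U \<inter> topspace S) \<and> (\<forall>x\<in>C. openin (top_of_set (con x)) {p \<in> con x. \<gamma> x p \<in> U})"
proof
  assume o: "openin T U"
  then have "openin S (U \<inter> topspace S)"
    using subtop by (metis openin_subtopology)
  moreover have "openin (top_of_set (con x)) {p \<in> con x. \<gamma> x p \<in> U}" if "x \<in> C" for x
    using cont[OF that] o by (force simp: continuous_map_def)
  ultimately show "openin S (U \<inter> topspace S) \<and> (\<forall>x\<in>C. openin (top_of_set (con x)) {p \<in> con x. \<gamma> x p \<in> U})"
    by blast
next
  assume o: "openin S (U \<inter> topspace S) \<and> (\<forall>x\<in>C. openin (top_of_set (con x)) {p \<in> con x. \<gamma> x p \<in> U})"
  have "closedin T ((topspace S - U \<inter> topspace S) \<union> (\<Union>x\<in>C. \<gamma> x ` (con x - {p \<in> con x. \<gamma> x p \<in> U})))"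
    using o by (intro closed_images_union) (auto intro!: openin_closedin_eq[THEN iffD1, THEN conjunct2] closedin_diff)
  moreover have "(topspace S - U \<inter> topspace S) \<union> (\<Union>x\<in>C. \<gamma> x ` (con x - {p \<in> con x. \<gamma> x p \<in> U})) = topspace T - U"
    using cover sub gamma_mem by blast
  ultimately show "openin T U" using U by (simp add: openin_closedin)
qed

lemma cones_glued: "cones_glued S C L \<gamma> T"
  unfolding cones_glued_def Let_def
  using cont_base inj off disj top openin_iff by blast

lemma extend_parametric:
  assumes Z: "Hausdorff_space Z" "compact_space Z"
    and f: "continuous_map (prod_topology Z S) W f"
    and k: "\<And>x. x \<in> C \<Longrightarrow> continuous_map (prod_topology Z (top_of_set (con x))) W (k x)"
    and fk: "\<And>x z w. x \<in> C \<Longrightarrow> z \<in> topspace Z \<Longrightarrow> w \<in> base x \<Longrightarrow> k x (z, w) = f (z, \<gamma> x w)"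
  obtains F where "continuous_map (prod_topology Z T) W F"
    "\<And>z y. z \<in> topspace Z \<Longrightarrow> y \<in> topspace S \<Longrightarrow> F (z, y) = f (z, y)"
    "\<And>x z w. x \<in> C \<Longrightarrow> z \<in> topspace Z \<Longrightarrow> w \<in> con x \<Longrightarrow> F (z, \<gamma> x w) = k x (z, w)"
proof -
  define p where "p y = (SOME q. fst q \<in> C \<and> snd q \<in> con (fst q) - base (fst q) \<and> \<gamma> (fst q) (snd q) = y)" for y
  have p: "p (\<gamma> x w) = (x, w)" if x: "x \<in> C" "w \<in> con x - base x" for x w
    unfolding p_def
  proof (rule some_equality)
    fix q assume q: "fst q \<in> C \<and> snd q \<in> con (fst q) - base (fst q) \<and> \<gamma> (fst q) (snd q) = \<gamma> x w"
    have "fst q = x"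
    proof (rule ccontr)
      assume "fst q \<noteq> x"
      then have "\<gamma> (fst q) ` (con (fst q) - base (fst q)) \<inter> \<gamma> x ` (con x - base x) = {}"
        using disj q x unfolding disjoint_family_on_def by blast
      then show False using q x by (metis disjoint_iff imageI)
    qed
    then show "q = (x, w)" using q x inj[OF x(1)] by (auto simp: inj_on_def prod_eq_iff)
  qed (use that in auto)
  define F where "F = (\<lambda>(z, y). if y \<in> topspace S then f (z, y) else k (fst (p y)) (z, snd (p y)))"
  have 1: "F (z, y) = f (z, y)" if "z \<in> topspace Z" "y \<in> topspace S" for z y
    using that by (simp add: F_def)
  have 2: "F (z, \<gamma> x w) = k x (z, w)" if "x \<in> C" "z \<in> topspace Z" "w \<in> con x" for x z w
  proof (cases "w \<in> base x")
    case True then show ?thesis using base[OF that(1) True] fk that by (simp add: F_def)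
  next
    case False
    then show ?thesis using off[OF that(1)] p[OF that(1)] that by (simp add: F_def)
  qed
  have "continuous_map (prod_topology Z T) W F"
  proof (rule continuous_map_from_charts[where I = C and S = "topspace Z \<times> topspace S"
        and P = "\<lambda>x. prod_topology Z (top_of_set (con x))" and \<gamma> = "\<lambda>x p. (fst p, \<gamma> x (snd p))"])
    show "Hausdorff_space (prod_topology Z T)" using Z haus by (simp add: Hausdorff_space_prod_topology)
    show "topspace (prod_topology Z T) \<subseteq> topspace Z \<times> topspace S \<union> (\<Union>x\<in>C. (\<lambda>p. (fst p, \<gamma> x (snd p))) ` topspace (prod_topology Z (top_of_set (con x))))"
      using cover by force
    show "closedin (prod_topology Z T) (topspace Z \<times> topspace S)"
      using closed_S by (simp add: closedin_prod_Times_iff)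
    have "subtopology (prod_topology Z T) (topspace Z \<times> topspace S) = prod_topology Z S"
      by (metis subtopology_Times subtop subtopology_topspace)
    moreover have "continuous_map (prod_topology Z S) W F"
      by (rule continuous_map_eq[OF f]) (use 1 in auto)
    ultimately show "continuous_map (subtopology (prod_topology Z T) (topspace Z \<times> topspace S)) W F" by simp
    fix x assume x: "x \<in> C"
    show "compact_space (prod_topology Z (top_of_set (con x)))"
      using Z compact_con[OF x] by (simp add: compact_space_prod_topology)
    show "continuous_map (prod_topology Z (top_of_set (con x))) (prod_topology Z T) (\<lambda>p. (fst p, \<gamma> x (snd p)))"
      by (intro continuous_map_pairedI continuous_map_fst continuous_map_compose[OF continuous_map_snd cont[OF x], unfolded o_def])
    show "continuous_map (prod_topology Z (top_of_set (con x))) W (\<lambda>p. F (fst p, \<gamma> x (snd p)))"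
      by (rule continuous_map_eq[OF k[OF x]]) (use 2 x in auto)
  qed (use finite_C in auto)
  then show ?thesis using 1 2 that by blast
qed

lemma extend:
  assumes f: "continuous_map S W f"
    and k: "\<And>x. x \<in> C \<Longrightarrow> continuous_map (top_of_set (con x)) W (k x)"
    and fk: "\<And>x w. x \<in> C \<Longrightarrow> w \<in> base x \<Longrightarrow> k x w = f (\<gamma> x w)"
  obtains F where "continuous_map T W F"
    "\<And>y. y \<in> topspace S \<Longrightarrow> F y = f y"
    "\<And>x w. x \<in> C \<Longrightarrow> w \<in> con x \<Longrightarrow> F (\<gamma> x w) = k x w"
proof -
  let ?Z = "discrete_topology {()}"
  obtain F where F: "continuous_map (prod_topology ?Z T) W F"
    "\<And>z y. z \<in> topspace ?Z \<Longrightarrow> y \<in> topspace S \<Longrightarrow> F (z, y) = (f \<circ> snd) (z, y)"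
    "\<And>x z w. x \<in> C \<Longrightarrow> z \<in> topspace ?Z \<Longrightarrow> w \<in> con x \<Longrightarrow> F (z, \<gamma> x w) = (k x \<circ> snd) (z, w)"
  proof (rule extend_parametric)
    show "continuous_map (prod_topology ?Z S) W (f \<circ> snd)"
      by (rule continuous_map_compose[OF continuous_map_snd f])
    show "continuous_map (prod_topology ?Z (top_of_set (con x))) W (k x \<circ> snd)" if "x \<in> C" for x
      by (rule continuous_map_compose[OF continuous_map_snd k[OF that]])
  qed (use fk in \<open>auto simp: compact_space_def Hausdorff_space_discrete_topology\<close>)
  have "continuous_map T W (\<lambda>y. F ((), y))"
    by (rule continuous_map_compose[OF _ F(1), unfolded o_def]) (auto intro!: continuous_map_pairedI)
  then show ?thesis using F(2,3) that by auto
qed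

end

text \<open>The points of the open cone with apex \<open>x\<close> are added to the space as pairs \<open>(x, w)\<close>. Separating
  points of \<open>S\<close> in the adjunction space uses the retraction of the punctured cones onto their bases.\<close>

lemma glue_exists:
  fixes S :: "('a \<times> ('a \<Rightarrow> real)) topology"
  assumes C: "finite C" and cone: "\<And>x. x \<in> C \<Longrightarrow> pointed_cone x (L x)"
    and S: "compact_space S" "Hausdorff_space S"
    and new: "\<And>x w. x \<in> C \<Longrightarrow> (x, w) \<notin> topspace S"
    and \<psi>: "\<And>x. x \<in> C \<Longrightarrow> continuous_map (top_of_set (realization (L x))) S (\<psi> x)"
  obtains T where "glued S C L (\<lambda>x w. if w \<in> realization (L x) then \<psi> x w else (x, w)) T"
proof -
  let ?B = "\<lambda>x. realization (L x)" and ?K = "\<lambda>x. realization (simplicial_cone x (L x))"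
  define g where "g = (\<lambda>x w. if w \<in> realization (L x) then \<psi> x w else (x, w))"
  have g [simp]: "w \<in> ?B x \<Longrightarrow> g x w = \<psi> x w" "w \<notin> ?B x \<Longrightarrow> g x w = (x, w)" for x w
    by (auto simp: g_def)
  define TS where "TS = topspace S \<union> (\<Union>x\<in>C. {x} \<times> (?K x - ?B x))"
  define P where "P U \<longleftrightarrow> U \<subseteq> TS \<and> openin S (U \<inter> topspace S) \<and>
    (\<forall>x\<in>C. openin (top_of_set (?K x)) {p \<in> ?K x. g x p \<in> U})" for U
  define T where "T = topology P"
  have \<psi>mem: "\<psi> x w \<in> topspace S" if "x \<in> C" "w \<in> ?B x" for x w
    using \<psi>[OF that(1)] that(2) by (force simp: continuous_map_def)
  have gmem: "g x p \<in> TS" if "x \<in> C" "p \<in> ?K x" for x p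
    using that \<psi>mem by (cases "p \<in> ?B x") (auto simp: TS_def)
  have bk: "p \<in> ?K x" if "x \<in> C" "p \<in> ?B x" for x p
    using that pointed_cone.base_iff[OF cone] by blast
  have b0: "p \<in> ?B x \<longleftrightarrow> p x = 0" if "x \<in> C" "p \<in> ?K x" for x p
    using that pointed_cone.base_iff[OF cone] by blast
  have pos: "0 < p x" if "x \<in> C" "p \<in> ?K x - ?B x" for x p
    using that b0 pointed_cone.cone_height[OF cone] by (metis DiffD1 DiffD2 less_eq_real_def)
  have "istopology P"
    unfolding istopology_def
  proof (intro conjI allI impI)
    fix U V assume U: "P U" and V: "P V"
    show "P (U \<inter> V)"
      unfolding P_def
    proof (intro conjI ballI)
      show "U \<inter> V \<subseteq> TS" using U unfolding P_def by blast
      have "U \<inter> V \<inter> topspace S = (U \<inter> topspace S) \<inter> (V \<inter> topspace S)" by blast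
      then show "openin S (U \<inter> V \<inter> topspace S)" using U V by (simp add: P_def openin_Int)
      fix x assume "x \<in> C"
      moreover have "{p \<in> ?K x. g x p \<in> U \<inter> V} = {p \<in> ?K x. g x p \<in> U} \<inter> {p \<in> ?K x. g x p \<in> V}" by blast
      ultimately show "openin (top_of_set (?K x)) {p \<in> ?K x. g x p \<in> U \<inter> V}"
        using U V unfolding P_def by (metis (no_types, lifting) openin_Int)
    qed
  next
    fix \<U> assume "\<forall>U\<in>\<U>. P U"
    then have U: "\<And>U. U \<in> \<U> \<Longrightarrow> U \<subseteq> TS" "\<And>U. U \<in> \<U> \<Longrightarrow> openin S (U \<inter> topspace S)"
      "\<And>U x. U \<in> \<U> \<Longrightarrow> x \<in> C \<Longrightarrow> openin (top_of_set (?K x)) {p \<in> ?K x. g x p \<in> U}"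
      unfolding P_def by blast+
    show "P (\<Union>\<U>)"
      unfolding P_def
    proof (intro conjI ballI)
      have "\<Union>\<U> \<inter> topspace S = (\<Union>U\<in>\<U>. U \<inter> topspace S)" by blast
      then show "openin S (\<Union>\<U> \<inter> topspace S)" using U(2) by (metis (no_types, lifting) imageE openin_Union)
      fix x assume "x \<in> C"
      moreover have "{p \<in> ?K x. g x p \<in> \<Union>\<U>} = (\<Union>U\<in>\<U>. {p \<in> ?K x. g x p \<in> U})" by blast
      ultimately show "openin (top_of_set (?K x)) {p \<in> ?K x. g x p \<in> \<Union>\<U>}"
        using U(3) by (metis (no_types, lifting) imageE openin_Union)
    qed (use U(1) in blast)
  qed
  then have oT: "openin T U \<longleftrightarrow> P U" for U
    by (simp add: T_def topology_inverse')
  have "P TS"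
  proof -
    have "{p \<in> ?K x. g x p \<in> TS} = ?K x" if "x \<in> C" for x using gmem[OF that] by blast
    moreover have "TS \<inter> topspace S = topspace S" by (auto simp: TS_def)
    ultimately show ?thesis by (simp add: P_def)
  qed
  then have tT: "topspace T = TS"
    using oT by (metis P_def openin_subset openin_topspace subset_antisym)
  define thick where "thick V = V \<union> (\<Union>x\<in>C. {x} \<times> {w \<in> ?K x - ?B x. w x < 1 \<and> \<psi> x (cone_base x w) \<in> V})" for V
  have thickS: "thick V \<inter> topspace S = V" if "V \<subseteq> topspace S" for V
    using that new by (auto simp: thick_def)
  have thick: "openin T (thick V)" if V: "openin S V" for V
    unfolding oT P_def
  proof (intro conjI ballI)
    have VS: "V \<subseteq> topspace S" using V openin_subset by blast
    show "thick V \<subseteq> TS" using VS by (auto simp: thick_def TS_def)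
    show "openin S (thick V \<inter> topspace S)" using thickS[OF VS] V by simp
    fix x assume x: "x \<in> C"
    interpret c: pointed_cone x "L x" by (rule cone[OF x])
    let ?O = "{p \<in> ?K x. p x < 1}"
    have "(g x p \<in> thick V) = (p \<in> ?O \<and> \<psi> x (cone_base x p) \<in> V)" if p: "p \<in> ?K x" for p
    proof (cases "p \<in> ?B x")
      case True
      have "g x p \<in> thick V \<longleftrightarrow> g x p \<in> thick V \<inter> topspace S" using \<psi>mem[OF x True] True by simp
      also have "\<dots> \<longleftrightarrow> \<psi> x p \<in> V" using True thickS[OF VS] by simp
      finally show ?thesis using p True c.base_iff by auto
    next
      case False
      then show ?thesis using p x new[OF x] VS by (auto simp: thick_def)
    qed
    then have "{p \<in> ?K x. g x p \<in> thick V} = {p \<in> ?K x. p \<in> ?O \<and> \<psi> x (cone_base x p) \<in> V}"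
      by (intro Collect_cong conj_cong refl)
    also have "\<dots> = {p \<in> ?O. \<psi> x (cone_base x p) \<in> V}" by blast
    finally have eq: "{p \<in> ?K x. g x p \<in> thick V} = {p \<in> ?O. \<psi> x (cone_base x p) \<in> V}" .
    have "openin (top_of_set (?K x)) {p \<in> ?O. \<psi> x (cone_base x p) \<in> V}"
    proof (rule openin_trans)
      have "?O = {p. p x < 1} \<inter> ?K x" by blast
      moreover have "open {p :: 'a \<Rightarrow> real. p x < 1}"
        by (intro open_Collect_less continuous_intros continuous_on_product_coordinates)
      ultimately show "openin (top_of_set (?K x)) ?O" using openin_open_Int by (metis inf_commute)
      have "continuous_on ?O (cone_base x)"
        by (intro continuous_intros) auto
      then have "continuous_map (top_of_set ?O) (top_of_set (?B x)) (cone_base x)"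
        using c.cone_base_mem by auto
      then have "continuous_map (top_of_set ?O) S (\<lambda>p. \<psi> x (cone_base x p))"
        using continuous_map_compose[OF _ \<psi>[OF x], unfolded o_def] by blast
      then show "openin (top_of_set ?O) {p \<in> ?O. \<psi> x (cone_base x p) \<in> V}"
        using V by (force simp: continuous_map_def)
    qed
    then show "openin (top_of_set (?K x)) {p \<in> ?K x. g x p \<in> thick V}" unfolding eq .
  qed
  have open_cell: "openin T ({x} \<times> (O' \<inter> (?K x - ?B x)))" if x: "x \<in> C" and O: "open O'" for x and O' :: "('a \<Rightarrow> real) set"
    unfolding oT P_def
  proof (intro conjI ballI)
    show "{x} \<times> (O' \<inter> (?K x - ?B x)) \<subseteq> TS" using x by (auto simp: TS_def)
    have "({x} \<times> (O' \<inter> (?K x - ?B x))) \<inter> topspace S = {}" using new[OF x] by auto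
    then show "openin S (({x} \<times> (O' \<inter> (?K x - ?B x))) \<inter> topspace S)" by simp
    fix x' assume x': "x' \<in> C"
    have ps: "\<psi> x' p \<notin> {x} \<times> (O' \<inter> (?K x - ?B x))" if "p \<in> ?B x'" for p
      using \<psi>mem[OF x' that] new[OF x] by auto
    show "openin (top_of_set (?K x')) {p \<in> ?K x'. g x' p \<in> {x} \<times> (O' \<inter> (?K x - ?B x))}"
    proof (cases "x' = x")
      case True
      have eq: "{p \<in> ?K x'. g x' p \<in> {x} \<times> (O' \<inter> (?K x - ?B x))} = ?K x \<inter> (O' \<inter> {p. p x \<noteq> 0})"
      proof (intro set_eqI)
        fix p
        show "p \<in> {p \<in> ?K x'. g x' p \<in> {x} \<times> (O' \<inter> (?K x - ?B x))} \<longleftrightarrow> p \<in> ?K x \<inter> (O' \<inter> {p. p x \<noteq> 0})"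
          using ps[of p] True b0[OF x, of p] bk[OF x, of p] by (cases "p \<in> ?B x") auto
      qed
      have o: "open {p :: 'a \<Rightarrow> real. p x \<noteq> 0}"
        by (intro open_Collect_neq continuous_intros continuous_on_product_coordinates)
      show ?thesis unfolding eq unfolding True by (rule openin_open_Int[OF open_Int[OF O o]])
    next
      case False
      then have eq: "{p \<in> ?K x'. g x' p \<in> {x} \<times> (O' \<inter> (?K x - ?B x))} = {}"
      proof -
        have "g x' p \<notin> {x} \<times> (O' \<inter> (?K x - ?B x))" for p
          using ps[of p] False by (cases "p \<in> ?B x'") auto
        then show ?thesis by (simp only: simp_thms empty_def)
      qed
      show ?thesis unfolding eq by (rule openin_empty)
    qed
  qed
  have open_low: "openin T (topspace S \<union> (\<Union>x\<in>C. {x} \<times> {w \<in> ?K x - ?B x. w x < c}))" (is "openin T ?U") if c: "0 < c" for c :: real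
    unfolding oT P_def
  proof (intro conjI ballI)
    show "?U \<subseteq> TS" by (auto simp: TS_def)
    have "?U \<inter> topspace S = topspace S" by blast
    then show "openin S (?U \<inter> topspace S)" by simp
    fix x assume x: "x \<in> C"
    have "g x p \<in> ?U \<longleftrightarrow> p x < c" if "p \<in> ?K x" for p
    proof (cases "p \<in> ?B x")
      case True
      then have "g x p \<in> topspace S" using \<psi>mem[OF x] by simp
      then have "g x p \<in> ?U" by (rule UnI1)
      moreover have "p x < c" using True b0[OF x that] c by simp
      ultimately show ?thesis by iprover
    next
      case False
      then show ?thesis using that x new[OF x] by simp
    qed
    then have "{p \<in> ?K x. g x p \<in> ?U} = {p \<in> ?K x. p x < c}" by (intro Collect_cong conj_cong refl)
    also have "\<dots> = ?K x \<inter> {p. p x < c}" by blast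
    finally have eq: "{p \<in> ?K x. g x p \<in> ?U} = ?K x \<inter> {p. p x < c}" .
    have o: "open {p :: 'a \<Rightarrow> real. p x < c}"
      by (intro open_Collect_less continuous_intros continuous_on_product_coordinates)
    show "openin (top_of_set (?K x)) {p \<in> ?K x. g x p \<in> ?U}" unfolding eq by (rule openin_open_Int[OF o])
  qed
  have sep_SE: "\<exists>U V. openin T U \<and> openin T V \<and> p \<in> U \<and> q \<in> V \<and> disjnt U V"
    if p: "p \<in> topspace S" and q: "q = (x, w)" "x \<in> C" "w \<in> ?K x - ?B x" for p q x w
  proof -
    let ?c = "w x / 2"
    have c: "0 < ?c" using pos[OF q(2,3)] by simp
    have "open {p :: 'a \<Rightarrow> real. p x > ?c}"
      by (intro open_Collect_less continuous_intros continuous_on_product_coordinates)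
    note 1 = open_cell[OF q(2) this] and 2 = open_low[OF c]
    show ?thesis
      by (intro exI conjI, rule 2, rule 1) (use p q c new in \<open>auto simp: disjnt_iff\<close>)
  qed
  have "Hausdorff_space T"
    unfolding Hausdorff_space_def tT
  proof (intro allI impI, elim conjE)
    fix p q assume p: "p \<in> TS" and q: "q \<in> TS" and pq: "p \<noteq> q"
    consider "p \<in> topspace S" "q \<in> topspace S" | x w where "p \<in> topspace S" "q = (x, w)" "x \<in> C" "w \<in> ?K x - ?B x"
      | x w where "q \<in> topspace S" "p = (x, w)" "x \<in> C" "w \<in> ?K x - ?B x"
      | x w x' w' where "p = (x, w)" "x \<in> C" "w \<in> ?K x - ?B x" "q = (x', w')" "x' \<in> C" "w' \<in> ?K x' - ?B x'"
      using p q unfolding TS_def by blast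
    then show "\<exists>U V. openin T U \<and> openin T V \<and> p \<in> U \<and> q \<in> V \<and> disjnt U V"
    proof cases
      case 1
      then obtain U V where UV: "openin S U" "openin S V" "p \<in> U" "q \<in> V" "disjnt U V"
        using S(2) pq unfolding Hausdorff_space_def by blast
      have "U \<subseteq> topspace S" "V \<subseteq> topspace S" using UV openin_subset by blast+
      then have "disjnt (thick U) (thick V)"
        using UV(5) new unfolding disjnt_def thick_def by (auto 0 0) (metis disjoint_iff subsetD)+
      moreover have "p \<in> thick U" "q \<in> thick V" using UV by (auto simp: thick_def)
      ultimately show ?thesis using thick UV by blast
    next
      case 2 then show ?thesis using sep_SE by blast
    next
      case 3 then show ?thesis using sep_SE[OF 3] disjnt_sym by blast
    next
      case 4
      show ?thesis
      proof (cases "x = x'")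
        case True
        then have "w \<noteq> w'" using pq 4 by auto
        then obtain U V where UV: "open U" "open V" "w \<in> U" "w' \<in> V" "disjnt U V"
          using Hausdorff_space_fun unfolding Hausdorff_space_def by force
        show ?thesis
          by (intro exI conjI, rule open_cell[OF 4(2) UV(1)], rule open_cell[OF 4(2) UV(2)])
            (use 4 UV True in \<open>auto simp: disjnt_iff\<close>)
      next
        case False
        show ?thesis
          by (intro exI conjI, rule open_cell[OF 4(2) open_UNIV], rule open_cell[OF 4(5) open_UNIV])
            (use 4 False in \<open>auto simp: disjnt_iff\<close>)
      qed
    qed
  qed
  moreover have "subtopology T (topspace S) = S"
  proof (rule topology_eq[THEN iffD2], intro allI)
    fix V
    show "openin (subtopology T (topspace S)) V = openin S V"
    proof
      assume "openin (subtopology T (topspace S)) V"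
      then show "openin S V" unfolding openin_subtopology oT P_def by blast
    next
      assume V: "openin S V"
      then have "V = thick V \<inter> topspace S" using thickS openin_subset by blast
      then show "openin (subtopology T (topspace S)) V"
        using thick[OF V] unfolding openin_subtopology by blast
    qed
  qed
  moreover have "continuous_map (top_of_set (?K x)) T (g x)" if x: "x \<in> C" for x
    unfolding continuous_map_def
  proof (intro conjI allI impI)
    show "g x \<in> topspace (top_of_set (?K x)) \<rightarrow> topspace T" using gmem[OF x] tT by auto
    fix U assume "openin T U"
    then show "openin (top_of_set (?K x)) {p \<in> topspace (top_of_set (?K x)). g x p \<in> U}"
      using x unfolding oT P_def by simp
  qed
  moreover have im: "g x ` (?K x - ?B x) = {x} \<times> (?K x - ?B x)" for x
  proof -
    have "g x ` (?K x - ?B x) = (\<lambda>w. (x, w)) ` (?K x - ?B x)" by (intro image_cong) auto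
    then show ?thesis by auto
  qed
  moreover have "inj_on (g x) (?K x - ?B x)" for x
    by (rule inj_onI) simp
  moreover have "g x ` ?B x \<subseteq> topspace S" if "x \<in> C" for x
    using \<psi>mem[OF that] by auto
  moreover have "({x} \<times> Q) \<inter> topspace S = {}" if "x \<in> C" for x Q
    using new[OF that] by auto
  moreover have "disjoint_family_on (\<lambda>x. g x ` (?K x - ?B x)) C"
    unfolding im by (auto simp: disjoint_family_on_def)
  moreover have "topspace S \<subseteq> topspace T" "topspace T = topspace S \<union> (\<Union>x\<in>C. g x ` (?K x - ?B x))"
    unfolding im tT TS_def by auto
  ultimately have "glued S C L g T"
    unfolding glued_def using C cone S(1) by (simp only: ball_simps simp_thms) simp
  then show ?thesis using that unfolding g_def by blast
qed

abbreviation unit_interval :: "real topology" where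
  "unit_interval \<equiv> top_of_set {0..1}"

lemma Hausdorff_unit_interval: "Hausdorff_space unit_interval"
  and compact_unit_interval: "compact_space unit_interval"
  by (simp_all add: Hausdorff_space_subtopology Hausdorff_space_euclidean compact_space_subtopology)

lemma continuous_map_comp2:
  assumes "continuous_map (prod_topology X Y) W f" "continuous_map Z X p" "continuous_map Z Y q"
  shows "continuous_map Z W (\<lambda>z. f (p z, q z))"
  using continuous_map_compose[OF continuous_map_pairedI[OF assms(2,3)] assms(1)] by (simp add: o_def)

lemma continuous_map_comp1:
  assumes "continuous_map X W f" "continuous_map Z X p"
  shows "continuous_map Z W (\<lambda>z. f (p z))"
  using continuous_map_compose[OF assms(2,1)] by (simp add: o_def)

lemma homotopic_withI:
  assumes "continuous_map (prod_topology unit_interval X) Y h"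
    "\<And>x. x \<in> topspace X \<Longrightarrow> h (0, x) = p x" "\<And>x. x \<in> topspace X \<Longrightarrow> h (1, x) = q x"
  shows "homotopic_with (\<lambda>_. True) X Y p q"
  using assms by (subst homotopic_with) auto

lemma continuous_on_eval: "continuous_on S (\<lambda>w :: 'i \<Rightarrow> real. w v)"
  by (rule continuous_on_coordinate[OF continuous_on_id])

lemma continuous_on_cone_base_shift:
  shows "(\<And>w. w \<in> S \<Longrightarrow> w x \<noteq> 1) \<Longrightarrow> continuous_on S (cone_base x)"
    and "m \<noteq> 1 \<Longrightarrow> continuous_on S (cone_shift x m)"
  by (rule continuous_on_cone_base[OF continuous_on_id], simp)
    (rule continuous_on_cone_shift[OF continuous_on_const continuous_on_id], simp)

lemma (in pointed_cone) continuous_map_from_cone: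
  assumes c: "0 < c" "c < 1"
    and V: "continuous_map (prod_topology Z (prod_topology unit_interval (top_of_set B))) W V"
    and \<eta>: "continuous_map (top_of_set K) W \<eta>"
    and V\<eta>: "\<And>z a. z \<in> topspace Z \<Longrightarrow> a \<in> B \<Longrightarrow> V (z, 1, a) = \<eta> a"
  shows "continuous_map (prod_topology Z (top_of_set K)) W
    (\<lambda>(z, w). if w x \<le> c then V (z, w x / c, cone_base x w) else \<eta> (cone_shift x c w))"
proof -
  let ?T = "prod_topology Z (top_of_set K)"
  have ht: "continuous_map ?T euclideanreal (\<lambda>p. snd p x)"
    by (rule continuous_map_comp1[OF _ continuous_map_snd, where f = "\<lambda>w. w x"])
      (auto intro: continuous_on_eval)
  have "continuous_map ?T W (\<lambda>p. if snd p x \<le> c then V (fst p, snd p x / c, cone_base x (snd p)) else \<eta> (cone_shift x c (snd p)))"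
  proof (rule continuous_map_cases_le[OF ht])
    show "continuous_map ?T euclideanreal (\<lambda>p. c)" by simp
    let ?L = "subtopology ?T {p \<in> topspace ?T. snd p x \<le> c}"
    let ?U = "subtopology ?T {p \<in> topspace ?T. c \<le> snd p x}"
    have sL: "continuous_map ?L (top_of_set {w \<in> K. w x \<le> c}) snd"
      by (rule continuous_map_into_subtopology[where X = ?L and Y = euclidean])
        (auto intro!: continuous_map_from_subtopology continuous_map_into_fulltopology[OF continuous_map_snd])
    have sU: "continuous_map ?U (top_of_set {w \<in> K. c \<le> w x}) snd"
      by (rule continuous_map_into_subtopology[where X = ?U and Y = euclidean])
        (auto intro!: continuous_map_from_subtopology continuous_map_into_fulltopology[OF continuous_map_snd])
    have "continuous_map (top_of_set {w \<in> K. w x \<le> c}) unit_interval (\<lambda>w. w x / c)"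
    proof -
      have "continuous_on {w \<in> K. w x \<le> c} (\<lambda>w. w x / c)"
        by (intro continuous_on_divide continuous_on_eval continuous_on_const) (use c in auto)
      then show ?thesis using c cone_height by (auto simp: divide_simps)
    qed
    note 1 = continuous_map_comp1[OF this sL]
    have "continuous_map (top_of_set {w \<in> K. w x \<le> c}) (top_of_set B) (cone_base x)"
      using c cone_base_mem by (auto intro!: continuous_on_cone_base_shift)
    note 2 = continuous_map_comp1[OF this sL]
    have 0: "continuous_map ?L Z fst"
      by (intro continuous_map_from_subtopology continuous_map_fst)
    show "continuous_map ?L W (\<lambda>p. V (fst p, snd p x / c, cone_base x (snd p)))"
      by (rule continuous_map_comp2[OF V 0 continuous_map_pairedI[OF 1 2]])
    have "continuous_map (top_of_set {w \<in> K. c \<le> w x}) (top_of_set K) (cone_shift x c)"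
      using c cone_shift_mem by (auto intro!: continuous_on_cone_base_shift)
    note 3 = continuous_map_comp1[OF this sU]
    show "continuous_map ?U W (\<lambda>p. \<eta> (cone_shift x c (snd p)))"
      by (rule continuous_map_comp1[OF \<eta> 3])
  next
    fix p assume p: "p \<in> topspace ?T" "snd p x = c"
    then have "cone_base x (snd p) \<in> B" using c cone_base_mem by auto
    then show "V (fst p, snd p x / c, cone_base x (snd p)) = \<eta> (cone_shift x c (snd p))"
      using p c V\<eta>[of "fst p" "cone_base x (snd p)"] by (auto simp: cone_base_def)
  qed
  then show ?thesis by (simp add: case_prod_unfold)
qed

definition glue_map ::
  "'b topology \<Rightarrow> 'a set \<Rightarrow> ('a \<Rightarrow> 'a set set) \<Rightarrow> ('a \<Rightarrow> ('a \<Rightarrow> real) \<Rightarrow> 'b) \<Rightarrow> 'b topology \<Rightarrow>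
   ('a \<Rightarrow> ('a \<Rightarrow> real) \<Rightarrow> 'c) \<Rightarrow> 'c topology \<Rightarrow> ('b \<Rightarrow> 'c) \<Rightarrow> ('a \<Rightarrow> real \<times> ('a \<Rightarrow> real) \<Rightarrow> 'c) \<Rightarrow> ('b \<Rightarrow> 'c) \<Rightarrow> bool"
where
  "glue_map S C L \<alpha> T \<beta> T' h H h' \<longleftrightarrow> continuous_map T T' h' \<and> (\<forall>y\<in>topspace S. h' y = h y) \<and>
     (\<forall>x\<in>C. \<forall>w\<in>realization (simplicial_cone x (L x)).
        h' (\<alpha> x w) = (if w x \<le> 1/2 then H x (2 * w x, cone_base x w) else \<beta> x (cone_shift x (1/2) w)))"

definition base_homotopy ::
  "'a set \<Rightarrow> ('a \<Rightarrow> 'a set set) \<Rightarrow> ('a \<Rightarrow> ('a \<Rightarrow> real) \<Rightarrow> 'c) \<Rightarrow> ('a \<Rightarrow> ('a \<Rightarrow> real) \<Rightarrow> 'c) \<Rightarrow> 'c topology \<Rightarrow>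
   ('a \<Rightarrow> real \<times> ('a \<Rightarrow> real) \<Rightarrow> 'c) \<Rightarrow> bool"
where
  "base_homotopy C L p q S H \<longleftrightarrow> (\<forall>x\<in>C.
     continuous_map (prod_topology unit_interval (top_of_set (realization (L x)))) S (H x) \<and>
     (\<forall>a\<in>realization (L x). H x (0, a) = p x a \<and> H x (1, a) = q x a))"

context
  fixes SA :: "'b topology" and SB :: "'c topology" and C L \<alpha> \<beta> TA TB
  assumes A: "glued SA C L \<alpha> TA" and B: "glued SB C L \<beta> TB"
begin

interpretation A: gluing SA C L \<alpha> TA by unfold_locales (rule A)
interpretation B: gluing SB C L \<beta> TB by unfold_locales (rule B)

lemma into_B: "continuous_map Z SB f \<Longrightarrow> continuous_map Z TB f"
  using B.subtop by (metis continuous_map_into_fulltopology)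

lemma into_A: "continuous_map Z SA f \<Longrightarrow> continuous_map Z TA f"
  using A.subtop by (metis continuous_map_into_fulltopology)

lemma glue_map_exists:
  assumes h: "continuous_map SA SB h" and H: "base_homotopy C L (\<lambda>x a. h (\<alpha> x a)) \<beta> SB H"
  obtains h' where "glue_map SA C L \<alpha> TA \<beta> TB h H h'"
proof -
  let ?k = "\<lambda>x w. if w x \<le> 1/2 then H x (2 * w x, cone_base x w) else \<beta> x (cone_shift x (1/2) w)"
  have "continuous_map (top_of_set (A.con x)) TB (?k x)" if x: "x \<in> C" for x
  proof -
    interpret c: pointed_cone x "L x" by (rule A.cone[OF x])
    let ?Z = "discrete_topology {()}"
    have "continuous_map (prod_topology ?Z (top_of_set c.K)) TB
      (\<lambda>(z, w). if w x \<le> 1/2 then (\<lambda>(z, q). H x q) (z, w x / (1/2), cone_base x w) else \<beta> x (cone_shift x (1/2) w))"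
    proof (rule c.continuous_map_from_cone[OF _ _ _ B.cont[OF x]])
      have "continuous_map (prod_topology unit_interval (top_of_set c.B)) TB (H x)"
        using H x into_B unfolding base_homotopy_def by blast
      from continuous_map_comp1[OF this continuous_map_snd]
      show "continuous_map (prod_topology ?Z (prod_topology unit_interval (top_of_set c.B))) TB (\<lambda>(z, q). H x q)"
        by (simp add: case_prod_unfold)
    qed (use H x in \<open>auto simp: base_homotopy_def\<close>)
    then have "continuous_map (top_of_set c.K) TB (\<lambda>w. (\<lambda>(z, w). if w x \<le> 1/2 then (\<lambda>(z, q). H x q) (z, w x / (1/2), cone_base x w)
        else \<beta> x (cone_shift x (1/2) w)) ((), w))"
      by (rule continuous_map_comp1) (auto intro!: continuous_map_pairedI)
    then have "continuous_map (top_of_set c.K) TB (\<lambda>w. if w x \<le> 1/2 then H x (w x / (1/2), cone_base x w) else \<beta> x (cone_shift x (1/2) w))"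
      by (simp cong del: if_weak_cong)
    then show ?thesis by (simp add: mult.commute cong del: if_weak_cong)
  qed
  moreover have "?k x w = h (\<alpha> x w)" if x: "x \<in> C" and w: "w \<in> A.base x" for x w
  proof -
    interpret c: pointed_cone x "L x" by (rule A.cone[OF x])
    have "w x = 0" using w c.base_iff by blast
    then show ?thesis using H x w by (simp add: base_homotopy_def)
  qed
  ultimately obtain F where "continuous_map TA TB F"
    "\<And>y. y \<in> topspace SA \<Longrightarrow> F y = h y"
    "\<And>x w. x \<in> C \<Longrightarrow> w \<in> A.con x \<Longrightarrow> F (\<alpha> x w) = ?k x w"
    using A.extend[of TB h ?k, OF into_B[OF h]] by blast
  then show ?thesis using that unfolding glue_map_def by blast
qed

text \<open>The homotopy for the map back traverses that of \<open>h\<close> in reverse and continues with the given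
  homotopy from \<open>g \<circ> h\<close> to the identity. On the cones, \<open>g' \<circ> h'\<close> therefore follows a path that
  runs back and forth, and this path is contracted by pulling its parameter to the endpoint.\<close>

lemma glue_map_left_inverse:
  assumes h: "continuous_map SA SB h" and g: "continuous_map SB SA g"
    and gh: "homotopic_with (\<lambda>_. True) SA SA (g \<circ> h) id"
    and H: "base_homotopy C L (\<lambda>x a. h (\<alpha> x a)) \<beta> SB H"
  obtains G where "base_homotopy C L (\<lambda>x a. g (\<beta> x a)) \<alpha> SA G"
    "\<And>h' g'. glue_map SA C L \<alpha> TA \<beta> TB h H h' \<Longrightarrow> glue_map SB C L \<beta> TB \<alpha> TA g G g' \<Longrightarrow>
       homotopic_with (\<lambda>_. True) TA TA (g' \<circ> h') id"
proof -
  obtain k where k: "continuous_map (prod_topology unit_interval SA) SA k"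
    "\<And>y. k (0, y) = g (h y)" "\<And>y. k (1, y) = y"
    using gh unfolding homotopic_with_def by auto
  define Vp where "Vp x = (\<lambda>(q::real, a). if q \<le> 0 then g (H x (- q, a)) else k (q, \<alpha> x a))" for x
  have Hx: "continuous_map (prod_topology unit_interval (top_of_set (A.base x))) SB (H x)"
    "\<And>a. a \<in> A.base x \<Longrightarrow> H x (0, a) = h (\<alpha> x a)" "\<And>a. a \<in> A.base x \<Longrightarrow> H x (1, a) = \<beta> x a" if "x \<in> C" for x
    using H that unfolding base_homotopy_def by auto
  have Vp: "continuous_map (prod_topology (top_of_set {-1..1}) (top_of_set (A.base x))) SA (Vp x)" if x: "x \<in> C" for x
  proof -
    let ?T = "prod_topology (top_of_set {-1..1::real}) (top_of_set (A.base x))"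
    have f: "continuous_map ?T euclideanreal fst"
      by (rule continuous_map_into_fulltopology[OF continuous_map_fst])
    have "continuous_map ?T SA (\<lambda>p. if fst p \<le> 0 then g (H x (- fst p, snd p)) else k (fst p, \<alpha> x (snd p)))"
    proof (rule continuous_map_cases_le[OF f])
      show "continuous_map ?T euclideanreal (\<lambda>p. 0)" by simp
      let ?L = "subtopology ?T {p \<in> topspace ?T. fst p \<le> 0}"
      let ?U = "subtopology ?T {p \<in> topspace ?T. 0 \<le> fst p}"
      have fU: "continuous_map ?U unit_interval fst"
        by (rule continuous_map_into_subtopology) (intro continuous_map_from_subtopology f, auto)
      have fL: "continuous_map ?L unit_interval (\<lambda>p. - fst p)"
        by (rule continuous_map_into_subtopology) (intro continuous_map_from_subtopology f continuous_map_minus, auto)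
      have s: "continuous_map (subtopology ?T Q) (top_of_set (A.base x)) snd" for Q
        by (intro continuous_map_from_subtopology continuous_map_snd)
      show "continuous_map ?L SA (\<lambda>p. g (H x (- fst p, snd p)))"
        by (rule continuous_map_comp1[OF g continuous_map_comp2[OF Hx(1)[OF x] fL s]])
      show "continuous_map ?U SA (\<lambda>p. k (fst p, \<alpha> x (snd p)))"
        by (rule continuous_map_comp2[OF k(1) fU continuous_map_comp1[OF A.cont_base[OF x] s]])
      show "g (H x (- fst p, snd p)) = k (fst p, \<alpha> x (snd p))" if "p \<in> topspace ?T" "fst p = 0" for p
        using that Hx(2)[OF x] k(2) by auto
    qed
    then show ?thesis by (simp add: Vp_def case_prod_unfold)
  qed
  have Vp1: "Vp x (1, a) = \<alpha> x a" for x a by (simp add: Vp_def k)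
  have Vpk: "Vp x (q, a) = k (q, \<alpha> x a)" if "x \<in> C" "a \<in> A.base x" "0 \<le> q" for x q a
    using that Hx(2) k(2) by (cases "q = 0") (auto simp: Vp_def)
  define G where "G x = (\<lambda>(v, a). Vp x (2 * v - 1, a))" for x
  have "base_homotopy C L (\<lambda>x a. g (\<beta> x a)) \<alpha> SA G"
    unfolding base_homotopy_def
  proof (intro ballI conjI)
    fix x assume x: "x \<in> C"
    have "continuous_map unit_interval (top_of_set {-1..1::real}) (\<lambda>v. 2 * v - 1)"
      by (auto intro!: continuous_intros)
    from continuous_map_comp2[OF Vp[OF x] continuous_map_comp1[OF this continuous_map_fst] continuous_map_snd]
    show "continuous_map (prod_topology unit_interval (top_of_set (A.base x))) SA (G x)"
      by (simp add: G_def case_prod_unfold)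
    fix a assume "a \<in> A.base x"
    then show "G x (0, a) = g (\<beta> x a)" "G x (1, a) = \<alpha> x a"
      using Hx(3)[OF x] Vp1 by (auto simp: G_def Vp_def)
  qed
  moreover have "homotopic_with (\<lambda>_. True) TA TA (g' \<circ> h') id"
    if h': "glue_map SA C L \<alpha> TA \<beta> TB h H h'" and g': "glue_map SB C L \<beta> TB \<alpha> TA g G g'" for h' g'
  proof -
    define q0 :: "real \<Rightarrow> real" where "q0 s = max (- 2 * s) (8 * s - 5)" for s
    define E where "E x w = (if w x \<le> 3/4 then Vp x (q0 (w x), cone_base x w) else \<alpha> x (cone_shift x (3/4) w))" for x w
    have h'g'S: "g' (h' y) = g (h y)" if y: "y \<in> topspace SA" for y
    proof -
      have "h y \<in> topspace SB" using h y by (auto simp: continuous_map_def)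
      then show ?thesis using h' g' y by (simp add: glue_map_def)
    qed
    have comp: "g' (h' (\<alpha> x w)) = E x w" if x: "x \<in> C" and w: "w \<in> A.con x" for x w
    proof -
      interpret c: pointed_cone x "L x" by (rule A.cone[OF x])
      show ?thesis
      proof (cases "w x \<le> 1/2")
        case True
        have b: "cone_base x w \<in> c.B" using c.cone_base_mem[OF w] True by auto
        then have "H x (2 * w x, cone_base x w) \<in> topspace SB"
          using Hx(1)[OF x] True c.cone_height[OF w] by (force simp: continuous_map_def Pi_iff)
        then have "g' (h' (\<alpha> x w)) = g (H x (2 * w x, cone_base x w))"
          using h' g' x w True by (simp add: glue_map_def)
        moreover have "q0 (w x) = - 2 * w x" using True by (simp add: q0_def)
        ultimately show ?thesis using True c.cone_height[OF w] by (simp add: E_def Vp_def)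
      next
        case False
        let ?w = "cone_shift x (1/2) w"
        have w': "?w \<in> c.K" "?w x = 2 * w x - 1" using c.cone_shift_mem[OF w, of "1/2"] False by auto
        have "g' (h' (\<alpha> x w)) = g' (\<beta> x ?w)"
          using h' x w False by (simp add: glue_map_def)
        also have "\<dots> = (if ?w x \<le> 1/2 then G x (2 * ?w x, cone_base x ?w) else \<alpha> x (cone_shift x (1/2) ?w))"
          using g' x w'(1) by (simp add: glue_map_def)
        also have "\<dots> = E x w"
        proof (cases "w x \<le> 3/4")
          case True
          have "cone_base x ?w = cone_base x w" using c.cone_base_cone_shift[OF w, of "1/2"] True by simp
          moreover have "q0 (w x) = 8 * w x - 5" using False by (simp add: q0_def)
          moreover have "2 * (2 * ?w x) - 1 = 8 * w x - 5" using w'(2) by simp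
          ultimately have "G x (2 * ?w x, cone_base x ?w) = Vp x (q0 (w x), cone_base x w)" by (simp only: G_def prod.case)
          then show ?thesis using True w'(2) by (simp add: E_def)
        next
          case F: False
          have "cone_shift x (1/2) ?w = cone_shift x (3/4) w" by (simp add: c.cone_shift_cone_shift)
          then show ?thesis using F w'(2) by (simp add: E_def)
        qed
        finally show ?thesis .
      qed
    qed
    have q0: "-1 \<le> (1 - u) * q0 (3 * s / 4) + u \<and> (1 - u) * q0 (3 * s / 4) + u \<le> 1" if "u \<in> {0..1}" "s \<in> {0..1}" for u s
    proof -
      have q: "-1 \<le> q0 (3 * s / 4)" "q0 (3 * s / 4) \<le> 1" using that by (auto simp: q0_def max_def)
      have "(1 - u) * (-1) \<le> (1 - u) * q0 (3 * s / 4)" "(1 - u) * q0 (3 * s / 4) \<le> (1 - u) * 1"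
        using q that by (intro mult_left_mono; simp)+
      then show ?thesis using that by auto
    qed
    let ?k1 = "\<lambda>x (u, w). if w x \<le> 3/4 then Vp x ((1 - u) * q0 (w x) + u, cone_base x w) else \<alpha> x (cone_shift x (3/4) w)"
    obtain F1 where F1: "continuous_map (prod_topology unit_interval TA) TA F1"
      "\<And>z y. z \<in> topspace unit_interval \<Longrightarrow> y \<in> topspace SA \<Longrightarrow> F1 (z, y) = k (z, y)"
      "\<And>x z w. x \<in> C \<Longrightarrow> z \<in> topspace unit_interval \<Longrightarrow> w \<in> A.con x \<Longrightarrow> F1 (z, \<alpha> x w) = ?k1 x (z, w)"
    proof (rule A.extend_parametric[OF Hausdorff_unit_interval compact_unit_interval, of TA k ?k1])
      show "continuous_map (prod_topology unit_interval SA) TA k" by (rule into_A[OF k(1)])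
      fix x assume x: "x \<in> C"
      interpret c: pointed_cone x "L x" by (rule A.cone[OF x])
      let ?V = "\<lambda>(u, s, a). Vp x ((1 - u) * q0 (3 * s / 4) + u, a)"
      have "continuous_map (prod_topology unit_interval (top_of_set c.K)) TA
        (\<lambda>(z, w). if w x \<le> 3/4 then ?V (z, w x / (3/4), cone_base x w) else \<alpha> x (cone_shift x (3/4) w))"
      proof (rule c.continuous_map_from_cone[OF _ _ _ A.cont[OF x]])
        let ?P = "prod_topology unit_interval (prod_topology unit_interval (top_of_set c.B))"
        have "continuous_on ({0..1} \<times> {0..1} \<times> c.B) (\<lambda>p. (1 - fst p) * q0 (3 * fst (snd p) / 4) + fst p)"
          unfolding q0_def by (intro continuous_intros) auto
        then have 1: "continuous_map ?P (top_of_set {-1..1}) (\<lambda>p. (1 - fst p) * q0 (3 * fst (snd p) / 4) + fst p)"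
          using q0 by auto
        have "continuous_map ?P SA (\<lambda>p. Vp x ((1 - fst p) * q0 (3 * fst (snd p) / 4) + fst p, snd (snd p)))"
          by (rule continuous_map_comp2[OF Vp[OF x] 1]) (intro continuous_map_compose[OF continuous_map_snd continuous_map_snd, unfolded o_def])
        then show "continuous_map ?P TA ?V" by (intro into_A) (simp add: case_prod_unfold)
        show "?V (z, 1, a) = \<alpha> x a" for z a by (simp add: q0_def Vp1)
      qed auto
      moreover have "(\<lambda>(z, w). if w x \<le> 3/4 then ?V (z, w x / (3/4), cone_base x w) else \<alpha> x (cone_shift x (3/4) w)) = ?k1 x"
        by (auto simp: fun_eq_iff)
      ultimately show "continuous_map (prod_topology unit_interval (top_of_set (A.con x))) TA (?k1 x)" by simp
      fix u w assume u: "u \<in> topspace unit_interval" and w: "w \<in> A.base x"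
      then have "w x = 0" using c.base_iff by blast
      then show "?k1 x (u, w) = k (u, \<alpha> x w)" using w u Vpk[OF x w] by (simp add: q0_def)
    qed blast
    define m where "m y = F1 (1, y)" for y
    have covT: "y \<in> topspace SA \<or> (\<exists>x\<in>C. \<exists>w\<in>A.con x. y = \<alpha> x w)" if "y \<in> topspace TA" for y
      using that A.cover by blast
    have "homotopic_with (\<lambda>_. True) TA TA (g' \<circ> h') m"
    proof (rule homotopic_withI[OF F1(1)])
      fix y assume "y \<in> topspace TA"
      then consider "y \<in> topspace SA" | x w where "x \<in> C" "w \<in> A.con x" "y = \<alpha> x w" using covT by blast
      then show "F1 (0, y) = (g' \<circ> h') y"
      proof cases
        case 1 then show ?thesis using F1(2)[of 0] h'g'S k(2) by simp
      next
        case 2 then show ?thesis using F1(3)[of x 0 w] comp by (simp add: E_def)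
      qed
    qed (simp add: m_def)
    moreover have "homotopic_with (\<lambda>_. True) TA TA m id"
    proof -
      let ?mu = "\<lambda>x u w. min (w x) (3/4 * (1 - u)) :: real"
      let ?k2 = "\<lambda>x (u, w). \<alpha> x (cone_shift x (?mu x u w) w)"
      obtain F2 where F2: "continuous_map (prod_topology unit_interval TA) TA F2"
        "\<And>z y. z \<in> topspace unit_interval \<Longrightarrow> y \<in> topspace SA \<Longrightarrow> F2 (z, y) = snd (z, y)"
        "\<And>x z w. x \<in> C \<Longrightarrow> z \<in> topspace unit_interval \<Longrightarrow> w \<in> A.con x \<Longrightarrow> F2 (z, \<alpha> x w) = ?k2 x (z, w)"
      proof (rule A.extend_parametric[OF Hausdorff_unit_interval compact_unit_interval, of TA snd ?k2])
        show "continuous_map (prod_topology unit_interval SA) TA snd"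
          by (rule into_A[OF continuous_map_snd])
        fix x assume x: "x \<in> C"
        interpret c: pointed_cone x "L x" by (rule A.cone[OF x])
        have mu: "0 \<le> ?mu x u w" "?mu x u w \<le> w x" "?mu x u w < 1" if "u \<in> {0..1}" "w \<in> c.K" for u w
          using that c.cone_height[OF that(2)] by (auto simp: min_def)
        have "continuous_on ({0..1} \<times> c.K) (\<lambda>p. cone_shift x (?mu x (fst p) (snd p)) (snd p))"
        proof (rule continuous_on_cone_shift)
          show "continuous_on ({0..1} \<times> c.K) (\<lambda>p. ?mu x (fst p) (snd p))"
            by (intro continuous_on_min continuous_on_coordinate[OF continuous_on_snd[OF continuous_on_id]]
                continuous_on_mult continuous_on_diff continuous_on_const continuous_on_fst continuous_on_id)
          show "continuous_on ({0..1} \<times> c.K) snd" by (intro continuous_intros)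
          fix p :: "real \<times> ('a \<Rightarrow> real)" assume "p \<in> {0..1} \<times> c.K"
          then show "?mu x (fst p) (snd p) \<noteq> 1" using mu(3)[of "fst p" "snd p"] by (auto simp del: min_less_iff_disj)
        qed
        then have "continuous_map (prod_topology unit_interval (top_of_set c.K)) (top_of_set c.K) (\<lambda>p. cone_shift x (?mu x (fst p) (snd p)) (snd p))"
          using c.cone_shift_mem(1) mu by auto
        from continuous_map_comp1[OF A.cont[OF x] this]
        show "continuous_map (prod_topology unit_interval (top_of_set (A.con x))) TA (?k2 x)"
          by (simp add: case_prod_unfold)
        fix u w assume u: "u \<in> topspace unit_interval" and w: "w \<in> A.base x"
        then have "w x = 0" using c.base_iff by blast
        then show "?k2 x (u, w) = snd (u, \<alpha> x w)" using u by (simp add: min_def)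
      qed blast
      show ?thesis
      proof (rule homotopic_withI[OF F2(1)])
        fix y assume "y \<in> topspace TA"
        then consider "y \<in> topspace SA" | x w where "x \<in> C" "w \<in> A.con x" "y = \<alpha> x w" using covT by blast
        then show "F2 (0, y) = m y"
        proof cases
          case 1 then show ?thesis using F2(2)[of 0] F1(2)[of 1] k(3) by (simp add: m_def)
        next
          case 2
          then show ?thesis
            using F2(3)[of x 0 w] F1(3)[of x 1 w] Vp1 by (auto simp: m_def min_def cone_base_def)
        qed
      next
        fix y assume "y \<in> topspace TA"
        then consider "y \<in> topspace SA" | x w where "x \<in> C" "w \<in> A.con x" "y = \<alpha> x w" using covT by blast
        then show "F2 (1, y) = id y"
        proof cases
          case 1 then show ?thesis using F2(2)[of 1] by simp
        next
          case 2
          then have "0 \<le> w x" using pointed_cone.cone_height[OF A.cone] by blast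
          then show ?thesis using 2 F2(3)[of x 1 w] pointed_cone.cone_shift_0[OF A.cone[OF 2(1)]] by (simp add: min_def)
        qed
      qed
    qed
    ultimately show ?thesis by (rule homotopic_with_trans)
  qed
  ultimately show ?thesis using that by blast
qed

end

theorem homotopy_equivalent_glued:
  assumes A: "glued SA C L \<alpha> TA" and B: "glued SB C L \<beta> TB"
    and h: "continuous_map SA SB h" and g: "continuous_map SB SA g"
    and gh: "homotopic_with (\<lambda>_. True) SA SA (g \<circ> h) id"
    and hg: "homotopic_with (\<lambda>_. True) SB SB (h \<circ> g) id"
    and hom: "\<And>x. x \<in> C \<Longrightarrow> homotopic_with (\<lambda>_. True) (top_of_set (realization (L x))) SB (h \<circ> \<alpha> x) (\<beta> x)"
  shows "TA homotopy_equivalent_space TB"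
proof -
  have "\<forall>x\<in>C. \<exists>H. continuous_map (prod_topology unit_interval (top_of_set (realization (L x)))) SB H \<and>
     (\<forall>a. H (0, a) = h (\<alpha> x a)) \<and> (\<forall>a. H (1, a) = \<beta> x a)"
    using hom unfolding homotopic_with_def by auto
  then obtain H where H: "base_homotopy C L (\<lambda>x a. h (\<alpha> x a)) \<beta> SB H"
    unfolding base_homotopy_def by metis
  obtain G where G: "base_homotopy C L (\<lambda>x a. g (\<beta> x a)) \<alpha> SA G"
    and GH: "\<And>h' g'. glue_map SA C L \<alpha> TA \<beta> TB h H h' \<Longrightarrow> glue_map SB C L \<beta> TB \<alpha> TA g G g' \<Longrightarrow>
       homotopic_with (\<lambda>_. True) TA TA (g' \<circ> h') id"
    using glue_map_left_inverse[OF A B h g gh H] by blast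
  obtain H2 where H2: "base_homotopy C L (\<lambda>x a. h (\<alpha> x a)) \<beta> SB H2"
    and HG: "\<And>g' h'. glue_map SB C L \<beta> TB \<alpha> TA g G g' \<Longrightarrow> glue_map SA C L \<alpha> TA \<beta> TB h H2 h' \<Longrightarrow>
       homotopic_with (\<lambda>_. True) TB TB (h' \<circ> g') id"
    using glue_map_left_inverse[OF B A g h hg G] by blast
  obtain h' where h': "glue_map SA C L \<alpha> TA \<beta> TB h H h'" using glue_map_exists[OF A B h H] .
  obtain g' where g': "glue_map SB C L \<beta> TB \<alpha> TA g G g'" using glue_map_exists[OF B A g G] .
  obtain h'' where h'': "glue_map SA C L \<alpha> TA \<beta> TB h H2 h''" using glue_map_exists[OF A B h H2] .
  have c: "continuous_map TA TB h'" "continuous_map TB TA g'" "continuous_map TA TB h''"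
    using h' g' h'' by (auto simp: glue_map_def)
  note 1 = GH[OF h' g'] and 2 = HG[OF g' h'']
  have "homotopic_with (\<lambda>_. True) TA TB (h'' \<circ> (g' \<circ> h')) (h'' \<circ> id)"
    by (rule homotopic_with_compose_continuous_map_left[OF 1 c(3)]) simp
  moreover have "homotopic_with (\<lambda>_. True) TA TB ((h'' \<circ> g') \<circ> h') (id \<circ> h')"
    by (rule homotopic_with_compose_continuous_map_right[OF 2 c(1)]) simp
  ultimately have "homotopic_with (\<lambda>_. True) TA TB h' h''"
    by (metis comp_assoc comp_id id_comp homotopic_with_symD homotopic_with_trans)
  then have "homotopic_with (\<lambda>_. True) TB TB (h' \<circ> g') (h'' \<circ> g')"
    by (rule homotopic_with_compose_continuous_map_right[OF _ c(2)]) simp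
  then have "homotopic_with (\<lambda>_. True) TB TB (h' \<circ> g') id"
    using 2 homotopic_with_trans by blast
  then show ?thesis unfolding homotopy_equivalent_space_def using 1 c by blast
qed

section \<open>Radial maps in a simplex\<close>

text \<open>\<open>simplex_gauge \<tau> z\<close> is the Minkowski functional of the simplex \<open>\<tau>\<close> with respect to the interior point \<open>z\<close>:
  the ray from \<open>z\<close> through \<open>w\<close> leaves the simplex at \<open>ray z (1 / simplex_gauge \<tau> z w) w\<close>.\<close>

definition affine_simplex :: "'a set \<Rightarrow> ('a \<Rightarrow> real) set" where
  "affine_simplex \<tau> = {w. (\<forall>v. v \<notin> \<tau> \<longrightarrow> w v = 0) \<and> sum w \<tau> = 1}"

definition simplex_gauge :: "'a set \<Rightarrow> ('a \<Rightarrow> real) \<Rightarrow> ('a \<Rightarrow> real) \<Rightarrow> real" where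
  "simplex_gauge \<tau> z w = Max ((\<lambda>v. 1 - w v / z v) ` \<tau>)"

definition ray :: "('a \<Rightarrow> real) \<Rightarrow> real \<Rightarrow> ('a \<Rightarrow> real) \<Rightarrow> 'a \<Rightarrow> real" where
  "ray z l w = (\<lambda>v. z v + l * (w v - z v))"

definition barycenter :: "'a set \<Rightarrow> 'a \<Rightarrow> real" where
  "barycenter \<tau> = (\<lambda>v. if v \<in> \<tau> then 1 / card \<tau> else 0)"

lemma barycenter_mem:
  assumes "finite \<tau>" "\<tau> \<noteq> {}"
  shows "barycenter \<tau> \<in> open_simplex \<tau>"
proof -
  have "0 < card \<tau>" using assms by (simp add: card_gt_0_iff)
  then show ?thesis by (auto simp: open_simplex_def closed_simplex_def barycenter_def)
qed

lemma continuous_on_Max_family: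
  fixes f :: "'i \<Rightarrow> 'b::topological_space \<Rightarrow> real"
  assumes "finite \<tau>" "\<tau> \<noteq> {}" "\<And>v. v \<in> \<tau> \<Longrightarrow> continuous_on S (f v)"
  shows "continuous_on S (\<lambda>y. Max ((\<lambda>v. f v y) ` \<tau>))"
  using assms
proof (induction \<tau> rule: finite_ne_induct)
  case (insert v \<tau>)
  then have "continuous_on S (\<lambda>y. max (f v y) (Max ((\<lambda>v. f v y) ` \<tau>)))"
    by (intro continuous_on_max) auto
  then show ?case using insert by simp
qed auto

lemma continuous_on_ray:
  assumes "continuous_on S l" "continuous_on S w"
  shows "continuous_on S (\<lambda>y. ray z (l y) (w y))"
  unfolding ray_def
  by (rule continuous_on_coordinatewise_then_product)
    (intro continuous_on_add continuous_on_mult continuous_on_diff continuous_on_const assms(1)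
      continuous_on_coordinate[OF assms(2)])

lemma ray_1 [simp]: "ray z 1 w = w"
  by (simp add: ray_def)

lemma closed_simplex_affine: "w \<in> closed_simplex \<tau> \<Longrightarrow> w \<in> affine_simplex \<tau>"
  by (auto simp: closed_simplex_def affine_simplex_def)

lemma open_simplex_closed: "w \<in> open_simplex \<tau> \<Longrightarrow> w \<in> closed_simplex \<tau>"
  by (auto simp: open_simplex_def)

locale pointed_simplex =
  fixes \<tau> :: "'a set" and z :: "'a \<Rightarrow> real"
  assumes finite_simplex: "finite \<tau>" and center: "z \<in> open_simplex \<tau>"
begin

lemma simplex_nonempty: "\<tau> \<noteq> {}"
  using center by (auto simp: open_simplex_def closed_simplex_def)

lemma center_pos: "v \<in> \<tau> \<Longrightarrow> 0 < z v"
  using center by (auto simp: open_simplex_def)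

lemma center_closed: "z \<in> closed_simplex \<tau>" and center_affine: "z \<in> affine_simplex \<tau>"
  using center open_simplex_closed closed_simplex_affine by blast+

lemma gauge_le_iff: "simplex_gauge \<tau> z w \<le> c \<longleftrightarrow> (\<forall>v\<in>\<tau>. (1 - c) * z v \<le> w v)"
proof -
  have "1 - w v / z v \<le> c \<longleftrightarrow> (1 - c) * z v \<le> w v" if "v \<in> \<tau>" for v
    using center_pos[OF that] by (simp add: field_simps)
  then show ?thesis
    using simplex_nonempty finite_simplex unfolding simplex_gauge_def by (simp add: Max_le_iff)
qed

lemma gauge_less_iff: "simplex_gauge \<tau> z w < c \<longleftrightarrow> (\<forall>v\<in>\<tau>. (1 - c) * z v < w v)"
proof -
  have "1 - w v / z v < c \<longleftrightarrow> (1 - c) * z v < w v" if "v \<in> \<tau>" for v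
    using center_pos[OF that] by (simp add: field_simps)
  then show ?thesis
    using simplex_nonempty finite_simplex unfolding simplex_gauge_def by (simp add: Max_less_iff)
qed

lemma gauge_center: "w = z \<longleftrightarrow> simplex_gauge \<tau> z w \<le> 0" if "w \<in> affine_simplex \<tau>"
proof
  assume "simplex_gauge \<tau> z w \<le> 0"
  then have le: "\<forall>v\<in>\<tau>. 0 \<le> w v - z v" by (simp add: gauge_le_iff)
  moreover have "(\<Sum>v\<in>\<tau>. w v - z v) = 0"
    using that center_affine by (simp add: sum_subtractf affine_simplex_def)
  ultimately have "\<forall>v\<in>\<tau>. w v - z v = 0"
    using finite_simplex by (simp add: sum_nonneg_eq_0_iff)
  then show "w = z" using that center_affine by (auto simp: affine_simplex_def fun_eq_iff)
qed (simp add: gauge_le_iff)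

lemma gauge_nonneg:
  assumes "w \<in> affine_simplex \<tau>" shows "0 \<le> simplex_gauge \<tau> z w"
proof (rule ccontr)
  assume n: "\<not> 0 \<le> simplex_gauge \<tau> z w"
  then have "w = z" using gauge_center[OF assms] by simp
  then have "\<forall>v\<in>\<tau>. z v < z v" using n gauge_less_iff[of w 0] by simp
  then show False using simplex_nonempty by auto
qed

lemma gauge_closed: "w \<in> closed_simplex \<tau> \<longleftrightarrow> w \<in> affine_simplex \<tau> \<and> simplex_gauge \<tau> z w \<le> 1"
proof -
  have "(\<forall>v. 0 \<le> w v) \<longleftrightarrow> (\<forall>v\<in>\<tau>. 0 \<le> w v)" if "\<forall>v. v \<notin> \<tau> \<longrightarrow> w v = 0"
    using that by (metis order_refl)
  then show ?thesis by (auto simp: gauge_le_iff closed_simplex_def affine_simplex_def)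
qed

lemma gauge_open: "w \<in> open_simplex \<tau> \<longleftrightarrow> w \<in> affine_simplex \<tau> \<and> simplex_gauge \<tau> z w < 1"
  using gauge_closed[of w] unfolding open_simplex_def gauge_less_iff gauge_le_iff by (auto simp: less_imp_le)

lemma gauge_boundary: "w \<in> closed_simplex \<tau> - open_simplex \<tau> \<longleftrightarrow> w \<in> affine_simplex \<tau> \<and> simplex_gauge \<tau> z w = 1"
  using gauge_closed gauge_open by auto

lemma ray_affine: "w \<in> affine_simplex \<tau> \<Longrightarrow> ray z l w \<in> affine_simplex \<tau>"
  using center_affine unfolding affine_simplex_def ray_def
  by (simp add: sum.distrib sum_subtractf sum_distrib_left[symmetric])

lemma gauge_ray:
  assumes "0 \<le> l"
  shows "simplex_gauge \<tau> z (ray z l w) = l * simplex_gauge \<tau> z w"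
proof -
  have "(\<lambda>v. 1 - ray z l w v / z v) ` \<tau> = (\<lambda>x. l * x) ` (\<lambda>v. 1 - w v / z v) ` \<tau>"
    unfolding image_image
  proof (rule image_cong[OF refl])
    fix v assume "v \<in> \<tau>"
    then have "z v \<noteq> 0" using center_pos by force
    then show "1 - ray z l w v / z v = l * (1 - w v / z v)" by (simp add: ray_def field_simps)
  qed
  moreover have "mono (\<lambda>x. l * x)" using assms by (auto intro!: monoI mult_left_mono)
  ultimately show ?thesis
    unfolding simplex_gauge_def using mono_Max_commute[of "\<lambda>x. l * x" "(\<lambda>v. 1 - w v / z v) ` \<tau>"] finite_simplex simplex_nonempty by simp
qed

lemma continuous_on_gauge:
  assumes "continuous_on S w" shows "continuous_on S (\<lambda>y. simplex_gauge \<tau> z (w y))"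
  unfolding simplex_gauge_def
  by (intro continuous_on_Max_family finite_simplex simplex_nonempty continuous_intros continuous_on_coordinate[OF assms])
    (use center_pos in force)

lemma ray_closed:
  assumes "w \<in> affine_simplex \<tau>" "0 \<le> l" "l * simplex_gauge \<tau> z w \<le> 1"
  shows "ray z l w \<in> closed_simplex \<tau>"
  using assms ray_affine gauge_ray gauge_closed by simp

lemma ray_boundary:
  assumes "w \<in> affine_simplex \<tau>" "0 \<le> l" "l * simplex_gauge \<tau> z w = 1"
  shows "ray z l w \<in> closed_simplex \<tau> - open_simplex \<tau>"
  using assms ray_affine gauge_ray gauge_boundary by simp

text \<open>The retraction of \<open>[0,1] \<times> \<Delta>\<close> onto \<open>{0} \<times> \<Delta> \<union> [0,1] \<times> \<partial>\<Delta>\<close> is the projection from the point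
  \<open>(2, z)\<close>.\<close>

lemma homotopy_extension_simplex:
  assumes \<phi>: "continuous_map (top_of_set (closed_simplex \<tau>)) T \<phi>"
    and H: "continuous_map (prod_topology unit_interval (top_of_set (closed_simplex \<tau> - open_simplex \<tau>))) T H"
    and H0: "\<And>w. w \<in> closed_simplex \<tau> - open_simplex \<tau> \<Longrightarrow> H (0, w) = \<phi> w"
  obtains G where "continuous_map (prod_topology unit_interval (top_of_set (closed_simplex \<tau>))) T G"
    "\<And>w. w \<in> closed_simplex \<tau> \<Longrightarrow> G (0, w) = \<phi> w"
    "\<And>t w. t \<in> {0..1} \<Longrightarrow> w \<in> closed_simplex \<tau> - open_simplex \<tau> \<Longrightarrow> G (t, w) = H (t, w)"
proof -
  let ?D = "closed_simplex \<tau>" and ?m = "simplex_gauge \<tau> z"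
  let ?S = "{0..1::real} \<times> ?D"
  define G where "G p = (if ?m (snd p) \<le> 1 - fst p / 2 then \<phi> (ray z (2 / (2 - fst p)) (snd p))
     else H (2 - (2 - fst p) / ?m (snd p), ray z (1 / ?m (snd p)) (snd p)))" for p
  have cm: "continuous_on Q (\<lambda>p. ?m (snd p))" for Q :: "(real \<times> ('a \<Rightarrow> real)) set"
    by (intro continuous_on_gauge continuous_on_snd continuous_on_id)
  have aff: "w \<in> ?D \<Longrightarrow> w \<in> affine_simplex \<tau> \<and> 0 \<le> ?m w \<and> ?m w \<le> 1" for w
    using gauge_closed gauge_nonneg by blast
  let ?L = "{p \<in> ?S. ?m (snd p) \<le> 1 - fst p / 2}" and ?U = "{p \<in> ?S. 1 - fst p / 2 \<le> ?m (snd p)}"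
  have "continuous_map (top_of_set ?S) T G"
    unfolding G_def
  proof (rule continuous_map_cases_le)
    show "continuous_map (top_of_set ?S) euclideanreal (\<lambda>p. ?m (snd p))" using cm by simp
    show "continuous_map (top_of_set ?S) euclideanreal (\<lambda>p. 1 - fst p / 2)"
      by (auto intro!: continuous_intros)
    have "ray z (2 / (2 - fst p)) (snd p) \<in> ?D" if "p \<in> ?L" for p
      using that aff[of "snd p"] by (intro ray_closed) (auto simp: field_simps)
    moreover have "continuous_on ?L (\<lambda>p. ray z (2 / (2 - fst p)) (snd p))"
      by (intro continuous_on_ray continuous_intros) auto
    ultimately have "continuous_map (top_of_set ?L) (top_of_set ?D) (\<lambda>p. ray z (2 / (2 - fst p)) (snd p))"
      by auto
    from continuous_map_comp1[OF \<phi> this]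
    show "continuous_map (subtopology (top_of_set ?S) {p \<in> topspace (top_of_set ?S). ?m (snd p) \<le> 1 - fst p / 2}) T
      (\<lambda>p. \<phi> (ray z (2 / (2 - fst p)) (snd p)))"
      by (simp add: subtopology_subtopology Int_absorb1 Collect_mono_iff del: prod_topology_subtopology_eu)
    have pos: "0 < ?m (snd p)" if "p \<in> ?U" for p using that by auto
    have "ray z (1 / ?m (snd p)) (snd p) \<in> ?D - open_simplex \<tau>" if "p \<in> ?U" for p
      using pos[OF that] that aff[of "snd p"] by (intro ray_boundary) auto
    moreover have "2 - (2 - fst p) / ?m (snd p) \<in> {0..1}" if "p \<in> ?U" for p
      using pos[OF that] that aff[of "snd p"] by (auto simp: field_simps)
    moreover have "continuous_on ?U (\<lambda>p. ray z (1 / ?m (snd p)) (snd p))"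
      using pos by (intro continuous_on_ray continuous_intros cm) force
    moreover have "continuous_on ?U (\<lambda>p. 2 - (2 - fst p) / ?m (snd p))"
      using pos by (intro continuous_intros cm) force
    ultimately have 1: "continuous_map (top_of_set ?U) unit_interval (\<lambda>p. 2 - (2 - fst p) / ?m (snd p))"
      and 2: "continuous_map (top_of_set ?U) (top_of_set (?D - open_simplex \<tau>)) (\<lambda>p. ray z (1 / ?m (snd p)) (snd p))"
      by auto
    from continuous_map_comp2[OF H 1 2]
    show "continuous_map (subtopology (top_of_set ?S) {p \<in> topspace (top_of_set ?S). 1 - fst p / 2 \<le> ?m (snd p)}) T
      (\<lambda>p. H (2 - (2 - fst p) / ?m (snd p), ray z (1 / ?m (snd p)) (snd p)))"
      by (simp add: subtopology_subtopology Int_absorb1 Collect_mono_iff del: prod_topology_subtopology_eu)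
    fix p assume p: "p \<in> topspace (top_of_set ?S)" "?m (snd p) = 1 - fst p / 2"
    then have pp: "p \<in> ?U" by auto
    have "(2 - fst p) / ?m (snd p) = 2" "1 / ?m (snd p) = 2 / (2 - fst p)"
      unfolding p(2) using p(1) by (auto simp: field_simps)
    then show "\<phi> (ray z (2 / (2 - fst p)) (snd p)) = H (2 - (2 - fst p) / ?m (snd p), ray z (1 / ?m (snd p)) (snd p))"
      using H0 \<open>\<And>p. p \<in> ?U \<Longrightarrow> ray z (1 / ?m (snd p)) (snd p) \<in> ?D - open_simplex \<tau>\<close>[OF pp] by simp
  qed
  moreover have "G (0, w) = \<phi> w" if "w \<in> ?D" for w
    using aff[OF that] by (simp add: G_def)
  moreover have "G (t, w) = H (t, w)" if "t \<in> {0..1}" "w \<in> ?D - open_simplex \<tau>" for t w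
    using that gauge_boundary[of w] H0[OF that(2)] by (auto simp: G_def)
  ultimately show ?thesis using that[of G] by simp
qed

end

section \<open>Pushing a map off a cell\<close>

locale attached_cell =
  fixes T :: "'b topology" and Z :: "'b set" and \<tau> :: "'a set" and \<kappa> :: "('a \<Rightarrow> real) \<Rightarrow> 'b"
  assumes hausdorff: "Hausdorff_space T" and closed: "closedin T Z"
    and finite_cell: "finite \<tau>" "\<tau> \<noteq> {}"
    and char_cont: "continuous_map (top_of_set (closed_simplex \<tau>)) T \<kappa>"
    and char_inj: "inj_on \<kappa> (open_simplex \<tau>)"
    and char_open: "w \<in> open_simplex \<tau> \<Longrightarrow> \<kappa> w \<notin> Z"
    and char_boundary: "w \<in> closed_simplex \<tau> - open_simplex \<tau> \<Longrightarrow> \<kappa> w \<in> Z"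
begin

lemma char_unique: "w \<in> closed_simplex \<tau> \<Longrightarrow> w' \<in> open_simplex \<tau> \<Longrightarrow> \<kappa> w = \<kappa> w' \<Longrightarrow> w = w'"
  using char_inj char_open char_boundary by (metis Diff_iff inj_onD)

lemma push_off:
  assumes X: "compact_space X" and \<phi>: "continuous_map X T \<phi>"
    and im: "\<And>p. p \<in> topspace X \<Longrightarrow> \<phi> p \<in> Z \<union> \<kappa> ` closed_simplex \<tau>"
    and z: "z \<in> open_simplex \<tau>" "\<And>p. p \<in> topspace X \<Longrightarrow> \<phi> p \<noteq> \<kappa> z"
  obtains k where "continuous_map (prod_topology unit_interval X) T k"
    "\<And>p. p \<in> topspace X \<Longrightarrow> k (0, p) = \<phi> p" "\<And>p. p \<in> topspace X \<Longrightarrow> k (1, p) \<in> Z"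
    "\<And>t p. t \<in> {0..1} \<Longrightarrow> p \<in> topspace X \<Longrightarrow> \<phi> p \<in> Z \<Longrightarrow> k (t, p) = \<phi> p"
proof -
  interpret pointed_simplex \<tau> z by unfold_locales (fact finite_cell z)+
  let ?m = "simplex_gauge \<tau> z"
  define Im where "Im = \<phi> ` topspace X"
  define D where "D = {w \<in> closed_simplex \<tau>. \<kappa> w \<in> Im}"
  have cIm: "compactin T Im" unfolding Im_def
    using X \<phi> by (metis compact_space_def image_compactin)
  have ImT: "Im \<subseteq> topspace T" using cIm compactin_subset_topspace by blast
  have "closedin (top_of_set (closed_simplex \<tau>)) D"
    unfolding D_def using char_cont compactin_imp_closedin[OF hausdorff cIm]
    by (auto simp: continuous_map_closedin)
  moreover have "compact_space (top_of_set (closed_simplex \<tau>))"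
    using compact_closed_simplex[OF finite_cell(1)] by (simp add: compact_space_subtopology)
  ultimately have cD: "compact_space (top_of_set D)"
    by (metis closedin_compact_space compactin_subspace compactin_subtopology inf.absorb_iff2 subtopology_subtopology
        compactin_euclidean_iff compact_space_subtopology)
  have Dc: "D \<subseteq> closed_simplex \<tau>" by (auto simp: D_def)
  have pos: "0 < ?m w" if "w \<in> D" for w
  proof -
    have "w \<noteq> z" using that z(2) unfolding D_def Im_def by (metis (no_types, lifting) imageE mem_Collect_eq)
    then show ?thesis using gauge_center[of w] that gauge_closed by (fastforce simp: D_def)
  qed
  have aff: "w \<in> affine_simplex \<tau> \<and> ?m w \<le> 1" if "w \<in> D" for w
    using that gauge_closed by (auto simp: D_def)
  define \<rho> where "\<rho> t w = ray z ((1 - t) + t / ?m w) w" for t w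
  have \<rho>: "\<rho> t w \<in> closed_simplex \<tau>" if "t \<in> {0..1}" "w \<in> D" for t w
  proof -
    have "((1 - t) + t / ?m w) * ?m w = (1 - t) * ?m w + t" using pos[OF that(2)] by (simp add: field_simps)
    also have "\<dots> \<le> (1 - t) * 1 + t" using that aff by (intro add_right_mono mult_left_mono) auto
    finally show ?thesis unfolding \<rho>_def using that aff pos[OF that(2)] by (intro ray_closed) auto
  qed
  have \<rho>0: "\<rho> 0 w = w" for w by (simp add: \<rho>_def)
  have \<rho>1: "\<rho> 1 w \<in> closed_simplex \<tau> - open_simplex \<tau>" if "w \<in> D" for w
    unfolding \<rho>_def using aff[OF that] pos[OF that] by (intro ray_boundary) auto
  have \<rho>b: "\<rho> t w = w" if "w \<in> D" "\<kappa> w \<in> Z" for t w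
  proof -
    have "w \<in> closed_simplex \<tau> - open_simplex \<tau>" using that char_open by (auto simp: D_def)
    then have "?m w = 1" using gauge_boundary by blast
    then show ?thesis by (simp add: \<rho>_def)
  qed
  define inv where "inv y = (SOME w. w \<in> D \<and> \<kappa> w = y)" for y
  have inv: "inv (\<kappa> w) = w" if "w \<in> D" "\<kappa> w \<notin> Z" for w
    unfolding inv_def using that char_unique char_boundary Dc
    by (intro some_equality) (auto simp: D_def)
  define R where "R = (\<lambda>(t, y). if y \<in> Z then y else \<kappa> (\<rho> t (inv y)))"
  have R\<kappa>: "R (t, \<kappa> w) = \<kappa> (\<rho> t w)" if "w \<in> D" for t w
    using that inv \<rho>b by (auto simp: R_def)
  have "continuous_map (prod_topology unit_interval (subtopology T Im)) T R"
  proof (rule continuous_map_from_charts[where I = "{()}" and S = "{0..1} \<times> (Im \<inter> Z)"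
        and P = "\<lambda>_. prod_topology unit_interval (top_of_set D)" and \<gamma> = "\<lambda>_ p. (fst p, \<kappa> (snd p))"])
    show "Hausdorff_space (prod_topology unit_interval (subtopology T Im))"
      using hausdorff Hausdorff_unit_interval by (simp add: Hausdorff_space_prod_topology Hausdorff_space_subtopology)
    show "topspace (prod_topology unit_interval (subtopology T Im)) \<subseteq> {0..1} \<times> (Im \<inter> Z) \<union>
      (\<Union>i\<in>{()}. (\<lambda>p. (fst p, \<kappa> (snd p))) ` topspace (prod_topology unit_interval (top_of_set D)))"
    proof
      fix q assume q: "q \<in> topspace (prod_topology unit_interval (subtopology T Im))"
      then obtain x0 where "x0 \<in> topspace X" "snd q = \<phi> x0" by (auto simp: Im_def)
      then have "snd q \<in> Z \<union> \<kappa> ` closed_simplex \<tau>" using im by simp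
      then consider "snd q \<in> Z" | w where "w \<in> closed_simplex \<tau>" "snd q = \<kappa> w" by blast
      then show "q \<in> {0..1} \<times> (Im \<inter> Z) \<union>
        (\<Union>i\<in>{()}. (\<lambda>p. (fst p, \<kappa> (snd p))) ` topspace (prod_topology unit_interval (top_of_set D)))"
      proof cases
        case 1 then show ?thesis using q by auto
      next
        case 2
        then have "(fst q, w) \<in> topspace (prod_topology unit_interval (top_of_set D))" using q by (auto simp: D_def)
        then show ?thesis using 2 by (auto intro!: image_eqI[of _ _ "(fst q, w)"] simp: prod_eq_iff)
      qed
    qed
    show "closedin (prod_topology unit_interval (subtopology T Im)) ({0..1} \<times> (Im \<inter> Z))"
      using closed by (auto simp: closedin_prod_Times_iff closedin_subtopology Int_commute)
    have "continuous_map (subtopology (prod_topology unit_interval (subtopology T Im)) ({0..1} \<times> (Im \<inter> Z))) T snd"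
      by (intro continuous_map_from_subtopology continuous_map_into_fulltopology[OF continuous_map_snd])
    then show "continuous_map (subtopology (prod_topology unit_interval (subtopology T Im)) ({0..1} \<times> (Im \<inter> Z))) T R"
      by (rule continuous_map_eq) (auto simp: R_def)
    show "compact_space (prod_topology unit_interval (top_of_set D))"
      using cD compact_unit_interval by (simp add: compact_space_prod_topology del: prod_topology_subtopology_eu)
    have cs: "continuous_map (prod_topology unit_interval (top_of_set D)) (top_of_set (closed_simplex \<tau>)) snd"
      by (rule continuous_map_into_subtopology[OF continuous_map_into_fulltopology[OF continuous_map_snd]]) (use Dc in auto)
    have "continuous_map (prod_topology unit_interval (top_of_set D)) (subtopology T Im) (\<lambda>p. \<kappa> (snd p))"
      by (rule continuous_map_into_subtopology[OF continuous_map_comp1[OF char_cont cs]]) (auto simp: D_def)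
    then show "continuous_map (prod_topology unit_interval (top_of_set D)) (prod_topology unit_interval (subtopology T Im)) (\<lambda>p. (fst p, \<kappa> (snd p)))"
      by (intro continuous_map_pairedI continuous_map_fst)
    have "continuous_on ({0..1} \<times> D) (\<lambda>p. \<rho> (fst p) (snd p))"
      unfolding \<rho>_def using pos
      by (intro continuous_on_ray continuous_intros continuous_on_gauge) (auto simp: less_imp_neq[symmetric])
    then have "continuous_map (prod_topology unit_interval (top_of_set D)) (top_of_set (closed_simplex \<tau>)) (\<lambda>p. \<rho> (fst p) (snd p))"
      using \<rho> by auto
    from continuous_map_comp1[OF char_cont this]
    show "continuous_map (prod_topology unit_interval (top_of_set D)) T (\<lambda>p. R (fst p, \<kappa> (snd p)))"
      by (rule continuous_map_eq) (auto simp: R\<kappa>)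
  qed auto
  moreover have \<phi>': "continuous_map X (subtopology T Im) \<phi>"
    using \<phi> by (auto simp: continuous_map_in_subtopology Im_def)
  ultimately have "continuous_map (prod_topology unit_interval X) T (\<lambda>p. R (fst p, \<phi> (snd p)))"
    by (rule continuous_map_comp2[OF _ continuous_map_fst continuous_map_comp1[OF _ continuous_map_snd]])
  moreover have "R (0, \<phi> p) = \<phi> p \<and> R (1, \<phi> p) \<in> Z" if p: "p \<in> topspace X" for p
  proof (cases "\<phi> p \<in> Z")
    case False
    then obtain w where w: "w \<in> closed_simplex \<tau>" "\<phi> p = \<kappa> w" using im[OF p] by blast
    moreover have "\<phi> p \<in> Im" using p by (simp add: Im_def)
    ultimately have "w \<in> D" "\<phi> p = \<kappa> w" by (simp_all add: D_def)
    then show ?thesis using R\<kappa> \<rho>0 \<rho>1 char_boundary by simp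
  qed (simp add: R_def)
  ultimately show ?thesis using that[of "\<lambda>p. R (fst p, \<phi> (snd p))"] by (simp add: R_def)
qed

end

section \<open>Avoiding a point of a cell of larger dimension\<close>

definition l1_dist :: "'a set \<Rightarrow> ('a \<Rightarrow> real) \<Rightarrow> ('a \<Rightarrow> real) \<Rightarrow> real" where
  "l1_dist \<sigma> s s' = (\<Sum>v\<in>\<sigma>. \<bar>s v - s' v\<bar>)"

lemma l1_dist_triangle: "l1_dist \<sigma> a c \<le> l1_dist \<sigma> a b + l1_dist \<sigma> b c"
  unfolding l1_dist_def sum.distrib[symmetric] by (intro sum_mono) auto

lemma l1_dist_commute: "l1_dist \<sigma> a b = l1_dist \<sigma> b a"
  unfolding l1_dist_def by (simp add: abs_minus_commute)

lemma l1_dist_nonneg: "0 \<le> l1_dist \<sigma> a b"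
  unfolding l1_dist_def by (simp add: sum_nonneg)

lemma Lipschitz_continuous_on:
  fixes p :: "('a \<Rightarrow> real) \<Rightarrow> real"
  assumes "\<And>s s'. s \<in> K \<Longrightarrow> s' \<in> K \<Longrightarrow> \<bar>p s - p s'\<bar> \<le> \<Lambda> * l1_dist \<sigma> s s'"
  shows "continuous_on K p"
  unfolding continuous_on_def
proof
  fix s assume s: "s \<in> K"
  have "continuous_on K (\<lambda>s'. \<Lambda> * l1_dist \<sigma> s' s)"
    unfolding l1_dist_def
    by (intro continuous_on_mult continuous_on_const continuous_on_sum continuous_on_rabs continuous_on_diff
        continuous_on_coordinate[OF continuous_on_id])
  then have "((\<lambda>s'. \<Lambda> * l1_dist \<sigma> s' s) \<longlongrightarrow> \<Lambda> * l1_dist \<sigma> s s) (at s within K)"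
    using s by (simp add: continuous_on_def)
  then have "((\<lambda>s'. \<Lambda> * l1_dist \<sigma> s' s) \<longlongrightarrow> 0) (at s within K)" by (simp add: l1_dist_def)
  then have "((\<lambda>s'. p s' - p s) \<longlongrightarrow> 0) (at s within K)"
    by (rule Lim_null_comparison[rotated]) (use assms s in \<open>auto simp: eventually_at_filter\<close>)
  then show "(p \<longlongrightarrow> p s) (at s within K)" by (simp add: LIM_zero_iff)
qed

text \<open>The approximation is the infimal convolution of \<open>u\<close> with a large multiple of the distance.\<close>

lemma Lipschitz_approximation:
  fixes u :: "('a \<Rightarrow> real) \<Rightarrow> real"
  assumes K: "compact K" and \<sigma>: "finite \<sigma>" and supp: "\<And>s v. s \<in> K \<Longrightarrow> v \<notin> \<sigma> \<Longrightarrow> s v = 0"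
    and u: "continuous_on K u" and \<epsilon>: "0 < \<epsilon>"
  obtains p \<Lambda> where "0 < \<Lambda>" "\<And>s s'. s \<in> K \<Longrightarrow> s' \<in> K \<Longrightarrow> \<bar>p s - p s'\<bar> \<le> \<Lambda> * l1_dist \<sigma> s s'"
    "\<And>s. s \<in> K \<Longrightarrow> \<bar>p s - u s\<bar> \<le> \<epsilon>"
proof (cases "K = {}")
  case True then show ?thesis using that[of 1] by simp
next
  case ne: False
  let ?d = "l1_dist \<sigma>"
  have KK: "compact (K \<times> K)" using K by (simp add: compact_Times)
  have cu: "continuous_on (K \<times> K) (\<lambda>q. u (fst q) - u (snd q))"
    by (intro continuous_on_diff continuous_on_compose2[OF u]) (auto intro!: continuous_on_fst continuous_on_snd continuous_on_id)
  have cd: "continuous_on (K \<times> K) (\<lambda>q. ?d (fst q) (snd q))"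
    unfolding l1_dist_def
    by (intro continuous_on_sum continuous_on_rabs continuous_on_diff
        continuous_on_coordinate[OF continuous_on_fst[OF continuous_on_id]] continuous_on_coordinate[OF continuous_on_snd[OF continuous_on_id]])
  obtain \<Lambda> where \<Lambda>: "0 < \<Lambda>" "\<And>s s'. s \<in> K \<Longrightarrow> s' \<in> K \<Longrightarrow> u s - u s' \<le> \<epsilon> + \<Lambda> * ?d s s'"
  proof -
    define Q where "Q = {q \<in> K \<times> K. \<epsilon> \<le> u (fst q) - u (snd q)}"
    have "closedin (top_of_set (K \<times> K)) Q"
    proof -
      have "Q = (K \<times> K) \<inter> (\<lambda>q. u (fst q) - u (snd q)) -` {\<epsilon>..}" by (auto simp: Q_def)
      then show ?thesis using continuous_closedin_preimage[OF cu closed_atLeast] by simp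
    qed
    then have cQ: "compact Q" using KK closedin_compact by blast
    have QK: "Q \<subseteq> K \<times> K" by (auto simp: Q_def)
    show ?thesis
    proof (cases "Q = {}")
      case True
      then have "u s - u s' \<le> \<epsilon> + 1 * ?d s s'" if "s \<in> K" "s' \<in> K" for s s'
      proof -
        have "u s - u s' < \<epsilon>" using True that by (force simp: Q_def)
        then show ?thesis using l1_dist_nonneg[of \<sigma> s s'] by simp
      qed
      then show ?thesis using that[of 1] by auto
    next
      case False
      obtain q0 where q0: "q0 \<in> Q" "\<And>q. q \<in> Q \<Longrightarrow> ?d (fst q0) (snd q0) \<le> ?d (fst q) (snd q)"
        using continuous_attains_inf[OF cQ False continuous_on_subset[OF cd QK]] by auto
      obtain q1 where q1: "q1 \<in> Q" "\<And>q. q \<in> Q \<Longrightarrow> u (fst q) - u (snd q) \<le> u (fst q1) - u (snd q1)"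
        using continuous_attains_sup[OF cQ False continuous_on_subset[OF cu QK]] by auto
      let ?dmin = "?d (fst q0) (snd q0)" and ?b = "u (fst q1) - u (snd q1)"
      have "?dmin \<noteq> 0"
      proof
        assume "?dmin = 0"
        then have "\<forall>v\<in>\<sigma>. fst q0 v = snd q0 v" using \<sigma> by (simp add: l1_dist_def sum_nonneg_eq_0_iff)
        moreover have "fst q0 \<in> K" "snd q0 \<in> K" using q0(1) by (auto simp: Q_def)
        ultimately have "fst q0 v = snd q0 v" for v
          using supp[of "fst q0" v] supp[of "snd q0" v] by (cases "v \<in> \<sigma>") auto
        then have "fst q0 = snd q0" by (rule ext)
        then show False using q0(1) \<epsilon> by (simp add: Q_def)
      qed
      then have d0: "0 < ?dmin" using l1_dist_nonneg[of \<sigma> "fst q0" "snd q0"] by linarith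
      have b: "0 < ?b" using q1(1) \<epsilon> by (simp add: Q_def)
      have "u s - u s' \<le> \<epsilon> + ?b / ?dmin * ?d s s'" if "s \<in> K" "s' \<in> K" for s s'
      proof (cases "(s, s') \<in> Q")
        case True
        have "?b * ?dmin \<le> ?b * ?d s s'" using q0(2)[OF True] b by simp
        then have "?b \<le> ?b / ?dmin * ?d s s'" using d0 by (simp add: field_simps)
        moreover have "u s - u s' \<le> ?b" using q1(2)[OF True] by simp
        ultimately show ?thesis using \<epsilon> by linarith
      next
        case False
        then have "u s - u s' < \<epsilon>" using that by (auto simp: Q_def)
        moreover have "0 \<le> ?b / ?dmin * ?d s s'" using b d0 l1_dist_nonneg[of \<sigma> s s'] by simp
        ultimately show ?thesis by linarith
      qed
      then show ?thesis using that[of "?b / ?dmin"] b d0 by simp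
    qed
  qed
  define p where "p s = (INF s'\<in>K. u s' + \<Lambda> * ?d s s')" for s
  have bdd: "bdd_below ((\<lambda>s'. u s' + \<Lambda> * ?d s s') ` K)" if "s \<in> K" for s
    by (rule bdd_belowI2[of _ "u s - \<epsilon>"]) (use \<Lambda>(2) that in \<open>fastforce simp: algebra_simps\<close>)
  have le: "p s \<le> u s' + \<Lambda> * ?d s s'" if "s \<in> K" "s' \<in> K" for s s'
    unfolding p_def using bdd[OF that(1)] that(2) by (rule cINF_lower)
  have half: "p s \<le> p s' + \<Lambda> * ?d s s'" if "s \<in> K" "s' \<in> K" for s s'
  proof -
    have "p s - \<Lambda> * ?d s s' \<le> p s'"
      unfolding p_def[of s']
    proof (rule cINF_greatest[OF ne])
      fix x assume x: "x \<in> K"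
      have "p s \<le> u x + \<Lambda> * ?d s x" using le that x by blast
      also have "\<dots> \<le> u x + \<Lambda> * (?d s s' + ?d s' x)"
        using l1_dist_triangle[of \<sigma> s x s'] \<Lambda>(1) by simp
      finally show "p s - \<Lambda> * ?d s s' \<le> u x + \<Lambda> * ?d s' x" by (simp add: algebra_simps)
    qed
    then show ?thesis by simp
  qed
  have "\<bar>p s - p s'\<bar> \<le> \<Lambda> * ?d s s'" if "s \<in> K" "s' \<in> K" for s s'
    using half[OF that] half[OF that(2,1)] l1_dist_commute[of \<sigma> s s'] by (simp add: abs_le_iff)
  moreover have "\<bar>p s - u s\<bar> \<le> \<epsilon>" if "s \<in> K" for s
  proof -
    have "p s \<le> u s" using le[OF that that] by (simp add: l1_dist_def)
    moreover have "u s - \<epsilon> \<le> p s"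
      unfolding p_def using \<Lambda>(2)[OF that] by (intro cINF_greatest[OF ne]) (simp add: algebra_simps)
    ultimately show ?thesis by simp
  qed
  ultimately show ?thesis using that \<Lambda>(1) by blast
qed

text \<open>Pigeonhole principle: a grid of \<open>N ^ card \<tau>\<close> points with mesh \<open>\<delta> / N\<close> in the target would have
  preimages in pairwise different ones of only about \<open>N ^ (card \<sigma> - 1)\<close> small cubes.\<close>

lemma Lipschitz_image_misses_grid_point:
  fixes p :: "('a \<Rightarrow> real) \<Rightarrow> 'b \<Rightarrow> real" and a :: "'b \<Rightarrow> real"
  assumes \<sigma>: "finite \<sigma>" and \<tau>: "finite \<tau>" "card \<sigma> \<le> card \<tau>" and K: "K \<subseteq> closed_simplex \<sigma>"
    and Lip: "\<And>v s s'. v \<in> \<tau> \<Longrightarrow> s \<in> K \<Longrightarrow> s' \<in> K \<Longrightarrow> \<bar>p s v - p s' v\<bar> \<le> \<Lambda> * l1_dist \<sigma> s s'"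
    and \<Lambda>: "0 < \<Lambda>" and \<delta>: "0 < \<delta>"
  obtains N :: nat and j :: "'b \<Rightarrow> nat" where "0 < N" "\<And>v. v \<in> \<tau> \<Longrightarrow> j v < N"
    "\<not> (\<exists>s\<in>K. \<forall>v\<in>\<tau>. p s v = a v + \<delta> * (real (j v) / real N))"
proof (cases "K = {}")
  case True then show ?thesis using that[of 1 "\<lambda>_. 0"] by auto
next
  case False
  then have "\<sigma> \<noteq> {}" using K by (auto simp: closed_simplex_def)
  then obtain v1 where v1: "v1 \<in> \<sigma>" by blast
  define \<sigma>' where "\<sigma>' = \<sigma> - {v1}"
  define k where "k = card \<sigma>'"
  have \<sigma>': "finite \<sigma>'" "\<sigma> = insert v1 \<sigma>'" "v1 \<notin> \<sigma>'" using \<sigma> v1 by (auto simp: \<sigma>'_def)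
  have kn: "k < card \<tau>" using \<tau>(2) \<sigma>' by (simp add: k_def)
  obtain q :: nat where q: "2 * real k * \<Lambda> / \<delta> < real q" using reals_Archimedean2 by blast
  have "0 \<le> 2 * real k * \<Lambda> / \<delta>" using \<Lambda> \<delta> by simp
  then have q0: "0 < q" using q by linarith
  define N where "N = (q + 1) ^ k + 1"
  define M where "M = q * N"
  have N0: "0 < N" by (simp add: N_def)
  then have M0: "0 < M" using q0 by (simp add: M_def)
  have "(M + 1) ^ k \<le> ((q + 1) * N) ^ k"
    using N0 by (intro power_mono) (auto simp: M_def)
  also have "\<dots> = (q + 1) ^ k * N ^ k" by (rule power_mult_distrib)
  also have "\<dots> < N * N ^ k" using N0 by (intro mult_strict_right_mono) (auto simp: N_def)
  also have "\<dots> \<le> N ^ card \<tau>" using kn N0 power_increasing[of "Suc k" "card \<tau>" N] by simp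
  finally have count: "(M + 1) ^ k < N ^ card \<tau>" .
  show ?thesis
  proof (rule ccontr)
    assume no: "\<not> thesis"
    have "\<exists>s\<in>K. \<forall>v\<in>\<tau>. p s v = a v + \<delta> * (real (j v) / real N)" if "j \<in> PiE \<tau> (\<lambda>_. {..<N})" for j
      using no that N0 \<open>\<And>N j. \<lbrakk>0 < N; \<And>v. v \<in> \<tau> \<Longrightarrow> j v < N; \<not> (\<exists>s\<in>K. \<forall>v\<in>\<tau>. p s v = a v + \<delta> * (real (j v) / real N))\<rbrakk> \<Longrightarrow> thesis\<close>
      by (metis PiE_mem lessThan_iff)
    then obtain S where S: "\<And>j. j \<in> PiE \<tau> (\<lambda>_. {..<N}) \<Longrightarrow> S j \<in> K \<and> (\<forall>v\<in>\<tau>. p (S j) v = a v + \<delta> * (real (j v) / real N))"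
      by metis
    define cl where "cl j = restrict (\<lambda>v. nat \<lfloor>real M * S j v\<rfloor>) \<sigma>'" for j
    have SK: "S j v \<in> {0..1}" if "j \<in> PiE \<tau> (\<lambda>_. {..<N})" for j v
      using S[OF that] K closed_simplex_le_1[OF \<sigma>] closed_simplexD(1) by (metis atLeastAtMost_iff subsetD)
    have "cl ` PiE \<tau> (\<lambda>_. {..<N}) \<subseteq> PiE \<sigma>' (\<lambda>_. {..M})"
    proof (rule image_subsetI)
      fix j assume j: "j \<in> PiE \<tau> (\<lambda>_. {..<N})"
      have "nat \<lfloor>real M * S j v\<rfloor> \<le> M" for v
      proof -
        have "real M * S j v \<le> real M" using SK[OF j, of v] M0 by (simp add: mult_left_le)
        then show ?thesis by linarith
      qed
      then show "cl j \<in> PiE \<sigma>' (\<lambda>_. {..M})" by (auto simp: cl_def)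
    qed
    then have "card (cl ` PiE \<tau> (\<lambda>_. {..<N})) \<le> card (PiE \<sigma>' (\<lambda>_. {..M}))"
      using \<sigma>' by (intro card_mono finite_PiE) auto
    also have "\<dots> = (M + 1) ^ k" using \<sigma>' by (simp add: card_PiE k_def)
    also have "\<dots> < card (PiE \<tau> (\<lambda>_. {..<N}))" using count \<tau>(1) by (simp add: card_PiE)
    finally have "\<not> inj_on cl (PiE \<tau> (\<lambda>_. {..<N}))" by (rule pigeonhole)
    then obtain j j' where jj: "j \<in> PiE \<tau> (\<lambda>_. {..<N})" "j' \<in> PiE \<tau> (\<lambda>_. {..<N})" "cl j = cl j'" "j \<noteq> j'"
      unfolding inj_on_def by blast
    let ?s = "S j" and ?s' = "S j'"
    have near: "\<bar>?s v - ?s' v\<bar> \<le> 1 / real M" if v: "v \<in> \<sigma>'" for v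
    proof -
      have "nat \<lfloor>real M * ?s v\<rfloor> = nat \<lfloor>real M * ?s' v\<rfloor>"
        using fun_cong[OF jj(3), of v] v by (simp add: cl_def)
      moreover have "0 \<le> real M * ?s v" "0 \<le> real M * ?s' v" using SK jj by auto
      ultimately have "\<lfloor>real M * ?s v\<rfloor> = \<lfloor>real M * ?s' v\<rfloor>"
        by (metis zero_le_floor eq_nat_nat_iff)
      then have "\<bar>real M * ?s v - real M * ?s' v\<bar> \<le> 1" by linarith
      moreover have "real M * ?s v - real M * ?s' v = real M * (?s v - ?s' v)" by (simp add: algebra_simps)
      ultimately have "real M * \<bar>?s v - ?s' v\<bar> \<le> 1" using M0 by (simp add: abs_mult)
      then show ?thesis using M0 by (simp add: field_simps)
    qed
    have sum1: "?s v1 = 1 - sum ?s \<sigma>'" "?s' v1 = 1 - sum ?s' \<sigma>'"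
    proof -
      have "sum (S i) \<sigma> = 1" if "i \<in> PiE \<tau> (\<lambda>_. {..<N})" for i
        using S[OF that] K closed_simplexD(3) by blast
      then show "?s v1 = 1 - sum ?s \<sigma>'" "?s' v1 = 1 - sum ?s' \<sigma>'"
        using \<sigma>' jj(1,2) by (simp_all add: sum.insert) (metis add_diff_cancel_right')+
    qed
    have rest: "(\<Sum>v\<in>\<sigma>'. \<bar>?s v - ?s' v\<bar>) \<le> real k / real M"
      using sum_bounded_above[of \<sigma>' "\<lambda>v. \<bar>?s v - ?s' v\<bar>", OF near] by (simp add: k_def)
    have "?s v1 - ?s' v1 = - (\<Sum>v\<in>\<sigma>'. ?s v - ?s' v)" by (simp add: sum1 sum_subtractf)
    then have "\<bar>?s v1 - ?s' v1\<bar> \<le> (\<Sum>v\<in>\<sigma>'. \<bar>?s v - ?s' v\<bar>)" by (simp add: sum_abs)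
    then have "l1_dist \<sigma> ?s ?s' \<le> 2 * (real k / real M)"
      unfolding l1_dist_def \<sigma>'(2) using \<sigma>'(1,3) rest by simp
    then have d: "\<Lambda> * l1_dist \<sigma> ?s ?s' \<le> \<Lambda> * (2 * (real k / real M))"
      using \<Lambda> by (intro mult_left_mono) auto
    obtain v where v: "v \<in> \<tau>" "j v \<noteq> j' v"
      using jj by (metis PiE_ext)
    have "\<bar>real (j v) - real (j' v)\<bar> \<ge> 1" using v(2) by linarith
    then have "\<delta> / real N * 1 \<le> \<delta> / real N * \<bar>real (j v) - real (j' v)\<bar>" using \<delta> by (intro mult_left_mono) auto
    also have "\<dots> = \<bar>p ?s v - p ?s' v\<bar>"
    proof -
      have "p ?s v - p ?s' v = \<delta> / real N * (real (j v) - real (j' v))"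
        using S jj(1,2) v(1) by (simp add: algebra_simps diff_divide_distrib)
      then show ?thesis using \<delta> by (simp add: abs_mult)
    qed
    also have "\<dots> \<le> \<Lambda> * l1_dist \<sigma> ?s ?s'" using Lip v(1) S jj by blast
    also note d
    finally have "\<delta> / real N \<le> \<Lambda> * (2 * (real k / real M))" by simp
    then have "\<delta> * real q \<le> 2 * real k * \<Lambda>"
      using N0 q0 by (simp add: M_def field_simps)
    moreover have "2 * real k * \<Lambda> < \<delta> * real q" using q \<delta> by (simp add: field_simps)
    ultimately show False by simp
  qed
qed

context attached_cell
begin

lemma miss_point:
  assumes \<sigma>: "finite \<sigma>" "card \<sigma> < card \<tau>"
    and \<phi>: "continuous_map (top_of_set (closed_simplex \<sigma>)) T \<phi>"
    and im: "\<And>p. p \<in> closed_simplex \<sigma> \<Longrightarrow> \<phi> p \<in> Z \<union> \<kappa> ` closed_simplex \<tau>"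
  obtains k z where "continuous_map (prod_topology unit_interval (top_of_set (closed_simplex \<sigma>))) T k"
    "\<And>p. p \<in> closed_simplex \<sigma> \<Longrightarrow> k (0, p) = \<phi> p"
    "\<And>t p. t \<in> {0..1} \<Longrightarrow> p \<in> closed_simplex \<sigma> \<Longrightarrow> k (t, p) \<in> Z \<union> \<kappa> ` closed_simplex \<tau>"
    "\<And>t p. t \<in> {0..1} \<Longrightarrow> p \<in> closed_simplex \<sigma> \<Longrightarrow> \<phi> p \<in> Z \<Longrightarrow> k (t, p) = \<phi> p"
    "z \<in> open_simplex \<tau>" "\<And>p. p \<in> closed_simplex \<sigma> \<Longrightarrow> k (1, p) \<noteq> \<kappa> z"
proof -
  define b where "b = barycenter \<tau>"
  interpret pointed_simplex \<tau> b by unfold_locales (simp_all add: finite_cell barycenter_mem b_def)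
  let ?g = "simplex_gauge \<tau> b" and ?D = "closed_simplex \<sigma>"
  define N where "N = real (card \<tau>)"
  have N: "1 \<le> N" using finite_cell card_gt_0_iff[of \<tau>] by (simp add: N_def)
  have bN: "b v = 1 / N" if "v \<in> \<tau>" for v using that by (simp add: b_def barycenter_def N_def)
  define Kap where "Kap = {w \<in> closed_simplex \<tau>. ?g w \<le> 3/4}"
  define Far where "Far = {w \<in> closed_simplex \<tau>. 3/4 \<le> ?g w}"
  have ct: "compact (closed_simplex \<tau>)" by (rule compact_closed_simplex[OF finite_cell(1)])
  have cg: "continuous_on (closed_simplex \<tau>) ?g" by (rule continuous_on_gauge[OF continuous_on_id])
  have Kap: "compact Kap"
  proof -
    have "Kap = closed_simplex \<tau> \<inter> ?g -` {..3/4}" by (auto simp: Kap_def)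
    then show ?thesis
      using continuous_closedin_preimage[OF cg, of "{..3/4}"] closedin_compact[OF ct] by simp
  qed
  have Far: "compact Far"
  proof -
    have "Far = closed_simplex \<tau> \<inter> ?g -` {3/4..}" by (auto simp: Far_def)
    then show ?thesis
      using continuous_closedin_preimage[OF cg, of "{3/4..}"] closedin_compact[OF ct] by simp
  qed
  have Kap_open: "w \<in> open_simplex \<tau>" if "w \<in> Kap" for w
    using that gauge_open gauge_closed by (fastforce simp: Kap_def)
  have closed_image: "closedin T (\<kappa> ` Q)" if "compact Q" "Q \<subseteq> closed_simplex \<tau>" for Q
  proof -
    have "compactin (top_of_set (closed_simplex \<tau>)) Q" using that by (simp add: compactin_subtopology)
    then show ?thesis using char_cont hausdorff image_compactin compactin_imp_closedin by blast
  qed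
  have preimage: "closedin (top_of_set ?D) {s \<in> ?D. \<phi> s \<in> Q}" if "closedin T Q" for Q
    using \<phi> that by (auto simp: continuous_map_closedin)
  define K where "K = {s \<in> ?D. \<phi> s \<in> \<kappa> ` Kap}"
  have KapD: "Kap \<subseteq> closed_simplex \<tau>" "Far \<subseteq> closed_simplex \<tau>" by (auto simp: Kap_def Far_def)
  have KD: "K \<subseteq> ?D" by (auto simp: K_def)
  have cD: "compact ?D" by (rule compact_closed_simplex[OF \<sigma>(1)])
  have cK: "compact K"
    unfolding K_def using preimage[OF closed_image[OF Kap KapD(1)]] cD closedin_compact by blast
  define u where "u s = (SOME w. w \<in> Kap \<and> \<kappa> w = \<phi> s)" for s
  have u: "u s \<in> Kap" "\<kappa> (u s) = \<phi> s" if "s \<in> K" for s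
  proof -
    have "\<exists>w. w \<in> Kap \<and> \<kappa> w = \<phi> s" using that unfolding K_def by force
    from someI_ex[OF this] show "u s \<in> Kap" "\<kappa> (u s) = \<phi> s" by (auto simp: u_def)
  qed
  have u_unique: "w = u s" if "s \<in> K" "w \<in> closed_simplex \<tau>" "\<kappa> w = \<phi> s" for s w
    using char_unique[OF that(2) Kap_open[OF u(1)[OF that(1)]]] u(2)[OF that(1)] that(3) by simp
  have cu: "continuous_on K u"
  proof -
    have "continuous_map (top_of_set K) (top_of_set Kap) u"
      unfolding continuous_map_closedin
    proof (intro conjI allI impI)
      show "u \<in> topspace (top_of_set K) \<rightarrow> topspace (top_of_set Kap)" using u by auto
      fix V assume V: "closedin (top_of_set Kap) V"
      then have "compact V" "V \<subseteq> Kap" using closedin_compact[OF Kap] closedin_imp_subset by blast+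
      then have c: "closedin (top_of_set ?D) {s \<in> ?D. \<phi> s \<in> \<kappa> ` V}"
        using preimage closed_image KapD(1) by (metis subset_trans)
      moreover have "{s \<in> ?D. \<phi> s \<in> \<kappa> ` V} = {s \<in> topspace (top_of_set K). u s \<in> V}"
      proof (intro equalityI subsetI)
        fix s assume "s \<in> {s \<in> ?D. \<phi> s \<in> \<kappa> ` V}"
        then obtain w where w: "s \<in> ?D" "w \<in> V" "\<phi> s = \<kappa> w" by blast
        then have "s \<in> K" using \<open>V \<subseteq> Kap\<close> by (auto simp: K_def)
        moreover have "w = u s" using u_unique[OF calculation, of w] w \<open>V \<subseteq> Kap\<close> KapD(1) by auto
        ultimately show "s \<in> {s \<in> topspace (top_of_set K). u s \<in> V}" using w by simp
      next
        fix s assume "s \<in> {s \<in> topspace (top_of_set K). u s \<in> V}"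
        then have s: "s \<in> K" "u s \<in> V" by auto
        then have "\<phi> s \<in> \<kappa> ` V" using u(2) by (metis imageI)
        then show "s \<in> {s \<in> ?D. \<phi> s \<in> \<kappa> ` V}" using s KD by blast
      qed
      ultimately have "closedin (top_of_set ?D) {s \<in> topspace (top_of_set K). u s \<in> V}" by simp
      then show "closedin (top_of_set K) {s \<in> topspace (top_of_set K). u s \<in> V}"
        by (rule closedin_subset_trans) (use KD in auto)
    qed
    then show ?thesis by simp
  qed
  obtain v0 where v0: "v0 \<in> \<tau>" using finite_cell by blast
  define \<tau>' where "\<tau>' = \<tau> - {v0}"
  have \<tau>': "finite \<tau>'" "\<tau> = insert v0 \<tau>'" "v0 \<notin> \<tau>'" using finite_cell v0 by (auto simp: \<tau>'_def)
  have card': "real (card \<tau>') = N - 1" using \<tau>' by (simp add: N_def)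
  define \<epsilon> where "\<epsilon> = 1 / (4 * N * N)"
  have \<epsilon>: "0 < \<epsilon>" "\<epsilon> \<le> 1 / (4 * N)" "(N - 1) * \<epsilon> \<le> 1 / (4 * N)"
  proof -
    show 0: "0 < \<epsilon>" using N by (simp add: \<epsilon>_def)
    have "N * \<epsilon> = 1 / (4 * N)" using N by (simp add: \<epsilon>_def)
    moreover have "1 * \<epsilon> \<le> N * \<epsilon>" "(N - 1) * \<epsilon> \<le> N * \<epsilon>" using N 0 by (intro mult_right_mono; simp)+
    ultimately show "\<epsilon> \<le> 1 / (4 * N)" "(N - 1) * \<epsilon> \<le> 1 / (4 * N)" by simp_all
  qed
  have "\<exists>p \<Lambda>. 0 < \<Lambda> \<and> (\<forall>s\<in>K. \<forall>s'\<in>K. \<bar>p s - p s'\<bar> \<le> \<Lambda> * l1_dist \<sigma> s s') \<and> (\<forall>s\<in>K. \<bar>p s - u s v\<bar> \<le> \<epsilon>)" for v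
  proof -
    show ?thesis
    proof (rule Lipschitz_approximation[of K \<sigma> "\<lambda>s. u s v" \<epsilon>])
      show "s v = 0" if "s \<in> K" "v \<notin> \<sigma>" for s v using closed_simplexD(2)[of s \<sigma> v] that KD by auto
      show "continuous_on K (\<lambda>s. u s v)" by (rule continuous_on_coordinate[OF cu])
      fix p \<Lambda>
      assume "0 < \<Lambda>" "\<And>s s'. s \<in> K \<Longrightarrow> s' \<in> K \<Longrightarrow> \<bar>p s - p s'\<bar> \<le> \<Lambda> * l1_dist \<sigma> s s'"
        "\<And>s. s \<in> K \<Longrightarrow> \<bar>p s - u s v\<bar> \<le> \<epsilon>"
      then show ?thesis by (intro exI[of _ p] exI[of _ \<Lambda>]) simp
    qed (use cK \<sigma>(1) \<epsilon>(1) in auto)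
  qed
  then obtain P \<Lambda> where P: "\<And>v. 0 < \<Lambda> v" "\<And>v s s'. s \<in> K \<Longrightarrow> s' \<in> K \<Longrightarrow> \<bar>P v s - P v s'\<bar> \<le> \<Lambda> v * l1_dist \<sigma> s s'"
    "\<And>v s. s \<in> K \<Longrightarrow> \<bar>P v s - u s v\<bar> \<le> \<epsilon>" by metis
  define p where "p s v = (if v = v0 then 1 - (\<Sum>v\<in>\<tau>'. P v s) else if v \<in> \<tau>' then P v s else 0)" for s v
  have p': "p s v = P v s" if "v \<in> \<tau>'" for s v using that \<tau>' by (auto simp: p_def)
  have p_aff: "p s \<in> affine_simplex \<tau>" for s
  proof -
    have "sum (p s) \<tau>' = (\<Sum>v\<in>\<tau>'. P v s)" using p' by (intro sum.cong) auto
    then show ?thesis using \<tau>' by (simp add: affine_simplex_def p_def)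
  qed
  have u_aff: "u s \<in> affine_simplex \<tau>" if "s \<in> K" for s
    using u(1)[OF that] gauge_closed by (auto simp: Kap_def)
  have pu: "\<bar>p s v - u s v\<bar> \<le> 1 / (4 * N)" if s: "s \<in> K" and v: "v \<in> \<tau>" for s v
  proof (cases "v = v0")
    case True
    have "u s v0 = 1 - (\<Sum>v\<in>\<tau>'. u s v)" using u_aff[OF s] \<tau>' by (simp add: affine_simplex_def)
    then have "p s v0 - u s v0 = - (\<Sum>v\<in>\<tau>'. P v s - u s v)" by (simp add: p_def sum_subtractf)
    then have "\<bar>p s v0 - u s v0\<bar> \<le> (\<Sum>v\<in>\<tau>'. \<bar>P v s - u s v\<bar>)" by (simp add: sum_abs)
    also have "\<dots> \<le> (N - 1) * \<epsilon>"
      using sum_bounded_above[of \<tau>' "\<lambda>v. \<bar>P v s - u s v\<bar>" \<epsilon>] P(3)[OF s] by (simp add: card')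
    finally show ?thesis using \<epsilon> True by simp
  next
    case False
    then show ?thesis using v \<tau>' p' P(3)[OF s, of v] \<epsilon>(2) by simp
  qed
  have cP: "continuous_on K (P v)" for v
    by (rule Lipschitz_continuous_on[of K "P v" "\<Lambda> v" \<sigma>]) (use P(2) in blast)
  have cp: "continuous_on K (\<lambda>s. p s v)" for v
  proof -
    consider "v = v0" | "v \<in> \<tau>'" "v \<noteq> v0" | "v \<notin> \<tau>'" "v \<noteq> v0" by blast
    then show ?thesis
      by cases (auto simp: p_def intro!: continuous_on_diff continuous_on_const continuous_on_sum cP)
  qed
  define \<mu> where "\<mu> s = min 1 (max 0 (3 - 4 * ?g (u s)))" for s
  have \<mu>: "0 \<le> \<mu> s" "\<mu> s \<le> 1" for s by (auto simp: \<mu>_def)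
  have c\<mu>: "continuous_on K \<mu>"
    unfolding \<mu>_def by (intro continuous_on_min continuous_on_max continuous_on_diff continuous_on_mult continuous_on_const continuous_on_gauge cu)
  define W where "W t s v = u s v + (t * \<mu> s) * (p s v - u s v)" for t s v
  have W: "W t s \<in> closed_simplex \<tau>" if t: "t \<in> {0..1}" and s: "s \<in> K" for t s
  proof -
    have "W t s v = 0" if "v \<notin> \<tau>" for v
      using that u_aff[OF s] p_aff[of s] by (auto simp: W_def affine_simplex_def)
    moreover have "sum (W t s) \<tau> = 1"
      using u_aff[OF s] p_aff[of s] unfolding W_def
      by (simp add: affine_simplex_def sum.distrib sum_subtractf sum_distrib_left[symmetric])
    moreover have "0 \<le> W t s v" if v: "v \<in> \<tau>" for v
    proof -
      have "?g (u s) \<le> 3/4" using u(1)[OF s] by (simp add: Kap_def)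
      then have "(1 - 3/4) * b v \<le> u s v" unfolding gauge_le_iff using v by blast
      then have 1: "1 / (4 * N) \<le> u s v" using bN[OF v] by simp
      have "\<bar>t * \<mu> s\<bar> \<le> 1" using t \<mu>[of s] by (auto simp: abs_mult intro!: mult_le_one)
      then have "\<bar>t * \<mu> s\<bar> * \<bar>p s v - u s v\<bar> \<le> 1 * (1 / (4 * N))" using pu[OF s v] by (intro mult_mono) auto
      then have "\<bar>(t * \<mu> s) * (p s v - u s v)\<bar> \<le> 1 / (4 * N)" by (simp add: abs_mult)
      then show ?thesis using 1 unfolding W_def by linarith
    qed
    ultimately show ?thesis unfolding closed_simplex_def by (auto, metis order_refl)
  qed
  define A where "A = {s \<in> ?D. \<phi> s \<in> Z \<union> \<kappa> ` Far}"
  have A: "closedin (top_of_set ?D) A"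
    unfolding A_def by (intro preimage closedin_Un closed closed_image Far KapD)
  have AK: "\<mu> s = 0" if s: "s \<in> A" "s \<in> K" for s
  proof -
    have "\<phi> s \<notin> Z" using char_open[OF Kap_open[OF u(1)[OF s(2)]]] u(2)[OF s(2)] by simp
    then obtain w where w: "w \<in> Far" "\<phi> s = \<kappa> w" using s(1) by (auto simp: A_def)
    then have "w = u s" using u_unique[OF s(2), of w] KapD by auto
    then show ?thesis using w(1) by (simp add: Far_def \<mu>_def)
  qed
  have cov: "s \<in> A \<or> s \<in> K" if s: "s \<in> ?D" for s
  proof (cases "\<phi> s \<in> Z")
    case True then show ?thesis using s by (simp add: A_def)
  next
    case False
    then obtain w where "w \<in> closed_simplex \<tau>" "\<phi> s = \<kappa> w" using im[OF s] by blast
    then show ?thesis using s by (cases "?g w \<le> 3/4") (auto simp: A_def K_def Far_def Kap_def)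
  qed
  define k where "k = (\<lambda>(t, s). if s \<in> A then \<phi> s else \<kappa> (W t s))"
  have kK: "k (t, s) = \<kappa> (W t s)" if "s \<in> K" for t s
  proof (cases "s \<in> A")
    case True
    then have "W t s = u s" using AK[OF True that] by (simp add: W_def fun_eq_iff)
    then show ?thesis using True u(2)[OF that] by (simp add: k_def)
  qed (simp add: k_def)
  have AD: "A \<subseteq> ?D" by (auto simp: A_def)
  have "continuous_map (prod_topology unit_interval (top_of_set ?D)) T k"
  proof (rule continuous_map_from_charts[where I = "{()}" and S = "{0..1} \<times> A"
        and P = "\<lambda>_. prod_topology unit_interval (top_of_set K)" and \<gamma> = "\<lambda>_ p. p"])
    show "Hausdorff_space (prod_topology unit_interval (top_of_set ?D))"
      unfolding Hausdorff_space_prod_topology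
      using Hausdorff_unit_interval Hausdorff_space_subtopology[OF Hausdorff_space_fun] by blast
    show "closedin (prod_topology unit_interval (top_of_set ?D)) ({0..1} \<times> A)"
      using A unfolding closedin_prod_Times_iff by auto
    have "continuous_map (prod_topology unit_interval (top_of_set ?D)) T (\<lambda>q. \<phi> (snd q))"
      by (rule continuous_map_comp1[OF \<phi> continuous_map_snd])
    then have "continuous_map (subtopology (prod_topology unit_interval (top_of_set ?D)) ({0..1} \<times> A)) T (\<lambda>q. \<phi> (snd q))"
      by (rule continuous_map_from_subtopology)
    then show "continuous_map (subtopology (prod_topology unit_interval (top_of_set ?D)) ({0..1} \<times> A)) T k"
      by (rule continuous_map_eq) (auto simp: k_def)
    show "compact_space (prod_topology unit_interval (top_of_set K))"
      unfolding compact_space_prod_topology using compact_unit_interval cK by (simp add: compact_space_subtopology)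
    show "continuous_map (prod_topology unit_interval (top_of_set K)) (prod_topology unit_interval (top_of_set ?D)) (\<lambda>p. p)"
      using KD by (auto intro!: continuous_on_id)
    have sK: "continuous_on ({0..1::real} \<times> K) (\<lambda>q. f (snd q))" if "continuous_on K f" for f :: "('c \<Rightarrow> real) \<Rightarrow> real"
      by (rule continuous_on_compose2[OF that continuous_on_snd[OF continuous_on_id]]) auto
    have "continuous_on ({0..1} \<times> K) (\<lambda>q. W (fst q) (snd q))"
      unfolding W_def
      by (rule continuous_on_coordinatewise_then_product)
        (intro continuous_on_add continuous_on_mult continuous_on_diff continuous_on_fst continuous_on_id
          sK[OF c\<mu>] sK[OF cp] sK[OF continuous_on_coordinate[OF cu]])
    then have "continuous_map (prod_topology unit_interval (top_of_set K)) (top_of_set (closed_simplex \<tau>)) (\<lambda>q. W (fst q) (snd q))"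
      using W by auto
    from continuous_map_comp1[OF char_cont this]
    show "continuous_map (prod_topology unit_interval (top_of_set K)) T (\<lambda>p. k p)"
      by (rule continuous_map_eq) (auto simp: kK)
  qed (use cov in auto)
  moreover have "k (0, s) = \<phi> s" if "s \<in> ?D" for s
  proof -
    have "W 0 s = u s" by (simp add: W_def fun_eq_iff)
    then show ?thesis using cov[OF that] kK[of s 0] u(2)[of s] by (auto simp: k_def)
  qed
  moreover have "k (t, s) \<in> Z \<union> \<kappa> ` closed_simplex \<tau>" if "t \<in> {0..1}" "s \<in> ?D" for t s
    using cov[OF that(2)] kK[of s t] W[OF that(1)] im[OF that(2)] by (auto simp: k_def)
  moreover have "k (t, s) = \<phi> s" if "s \<in> ?D" "\<phi> s \<in> Z" for t s
    using that by (simp add: k_def A_def)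
  moreover obtain z where z: "z \<in> open_simplex \<tau>" "?g z < 1/4" "\<not> (\<exists>s\<in>K. \<forall>v\<in>\<tau>'. P v s = z v)"
  proof -
    define \<delta> where "\<delta> = 1 / (8 * N * N)"
    have \<delta>: "0 < \<delta>" "N * \<delta> = 1 / (8 * N)" using N by (auto simp: \<delta>_def)
    have Lip: "\<bar>P v s - P v s'\<bar> \<le> (\<Sum>v\<in>\<tau>. \<Lambda> v) * l1_dist \<sigma> s s'" if "v \<in> \<tau>'" "s \<in> K" "s' \<in> K" for v s s'
    proof -
      have "\<Lambda> v \<le> (\<Sum>v\<in>\<tau>. \<Lambda> v)" using that \<tau>' finite_cell P(1) by (intro member_le_sum) (auto simp: less_imp_le)
      then have "\<Lambda> v * l1_dist \<sigma> s s' \<le> (\<Sum>v\<in>\<tau>. \<Lambda> v) * l1_dist \<sigma> s s'"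
        by (rule mult_right_mono[OF _ l1_dist_nonneg])
      then show ?thesis using P(2)[OF that(2,3), of v] by linarith
    qed
    have \<Lambda>: "0 < (\<Sum>v\<in>\<tau>. \<Lambda> v)" using finite_cell P(1) by (intro sum_pos) auto
    have "card \<sigma> \<le> card \<tau>'" using \<sigma>(2) \<tau>' by simp
    from Lipschitz_image_misses_grid_point[where a = "\<lambda>_. 1 / N" and p = "\<lambda>s v. P v s", OF \<sigma>(1) \<tau>'(1) this KD Lip \<Lambda> \<delta>(1)]
    obtain n :: nat and j :: "'a \<Rightarrow> nat" where n: "0 < n" "\<And>v. v \<in> \<tau>' \<Longrightarrow> j v < n"
      "\<not> (\<exists>s\<in>K. \<forall>v\<in>\<tau>'. P v s = 1 / N + \<delta> * (real (j v) / real n))" by blast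
    define e where "e v = \<delta> * (real (j v) / real n)" for v
    have e: "0 \<le> e v" "e v \<le> \<delta>" if "v \<in> \<tau>'" for v
    proof -
      have "real (j v) / real n \<le> 1" using n(2)[OF that] by simp
      then show "e v \<le> \<delta>" unfolding e_def using \<delta>(1) by (intro mult_left_le) auto
    qed (use \<delta>(1) in \<open>simp add: e_def\<close>)
    define z where "z v = (if v = v0 then 1 - (\<Sum>v\<in>\<tau>'. 1 / N + e v) else if v \<in> \<tau>' then 1 / N + e v else 0)" for v
    have z': "z v = 1 / N + e v" if "v \<in> \<tau>'" for v using that \<tau>' by (auto simp: z_def)
    have "sum z \<tau>' = (\<Sum>v\<in>\<tau>'. 1 / N + e v)" using z' by (intro sum.cong) auto
    then have z_aff: "z \<in> affine_simplex \<tau>" using \<tau>' by (simp add: affine_simplex_def z_def)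
    have "(1 - 1/4) * b v < z v" if v: "v \<in> \<tau>" for v
    proof (cases "v = v0")
      case True
      have "(\<Sum>v\<in>\<tau>'. e v) \<le> (N - 1) * \<delta>" using sum_bounded_above[of \<tau>' e \<delta>] e by (simp add: card')
      also have "\<dots> \<le> 1 / (8 * N)" using \<delta> by (simp add: algebra_simps)
      finally have "1 - (N - 1) * (1 / N) - 1 / (8 * N) \<le> z v0"
        by (simp add: z_def sum.distrib card')
      moreover have "3 / (4 * N) < 1 - (N - 1) * (1 / N) - 1 / (8 * N)" using N by (simp add: field_simps)
      ultimately show ?thesis using bN[OF v] True by simp
    next
      case False
      then have "v \<in> \<tau>'" using v \<tau>' by auto
      then have "z v = b v + e v" "0 \<le> e v" using z' e(1) bN[OF v] by auto
      moreover have "0 < b v" using bN[OF v] N by simp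
      ultimately show ?thesis by (simp add: algebra_simps)
    qed
    then have g: "?g z < 1/4" unfolding gauge_less_iff by blast
    moreover have "z \<in> open_simplex \<tau>" using g z_aff gauge_open by simp
    moreover have "\<not> (\<exists>s\<in>K. \<forall>v\<in>\<tau>'. P v s = z v)" using n(3) z' by (simp add: e_def)
    ultimately show ?thesis using that by blast
  qed
  moreover have "k (1, s) \<noteq> \<kappa> z" if s: "s \<in> ?D" for s
  proof
    assume eq: "k (1, s) = \<kappa> z"
    have zZ: "\<kappa> z \<notin> Z" by (rule char_open[OF z(1)])
    show False
    proof (cases "s \<in> A")
      case True
      then have "\<phi> s = \<kappa> z" using eq by (simp add: k_def)
      then obtain w where w: "w \<in> Far" "\<kappa> w = \<kappa> z" using True zZ by (auto simp: A_def)
      then have "w = z" using char_unique[OF _ z(1)] KapD by blast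
      then show False using w(1) z(2) by (simp add: Far_def)
    next
      case False
      then have sK: "s \<in> K" using cov[OF s] by blast
      then have "\<kappa> (W 1 s) = \<kappa> z" using eq kK by simp
      then have Wz: "W 1 s = z" using char_unique[OF W[OF _ sK] z(1)] by simp
      have "(1 - 1/2) * b v \<le> u s v" if v: "v \<in> \<tau>" for v
      proof -
        have "3 / (4 * N) < z v" using z(2)[unfolded gauge_less_iff, rule_format, OF v] bN[OF v] by simp
        moreover have "\<bar>z v - u s v\<bar> \<le> 1 / (4 * N)"
        proof -
          have "z v - u s v = \<mu> s * (p s v - u s v)" using fun_cong[OF Wz, of v] by (simp add: W_def)
          then have "\<bar>z v - u s v\<bar> = \<mu> s * \<bar>p s v - u s v\<bar>" using \<mu>[of s] by (simp add: abs_mult)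
          also have "\<dots> \<le> 1 * (1 / (4 * N))" using \<mu>[of s] pu[OF sK v] by (intro mult_mono) auto
          finally show ?thesis by simp
        qed
        ultimately have "3 / (4 * N) - 1 / (4 * N) \<le> u s v" by linarith
        then show ?thesis using bN[OF v] by simp
      qed
      then have "?g (u s) \<le> 1/2" unfolding gauge_le_iff by blast
      then have "\<mu> s = 1" by (simp add: \<mu>_def)
      then have "p s v = z v" for v using fun_cong[OF Wz, of v] by (simp add: W_def)
      then show False using z(3) sK p' by metis
    qed
  qed
  ultimately show ?thesis using that by blast
qed

lemma compress:
  assumes \<sigma>: "finite \<sigma>" "card \<sigma> < card \<tau>"
    and \<phi>: "continuous_map (top_of_set (closed_simplex \<sigma>)) T \<phi>"
    and im: "\<And>p. p \<in> closed_simplex \<sigma> \<Longrightarrow> \<phi> p \<in> Z \<union> \<kappa> ` closed_simplex \<tau>"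
  obtains \<psi> where "homotopic_with (\<lambda>h. \<forall>p\<in>closed_simplex \<sigma>. \<phi> p \<in> Z \<longrightarrow> h p = \<phi> p) (top_of_set (closed_simplex \<sigma>)) T \<phi> \<psi>"
    "\<And>p. p \<in> closed_simplex \<sigma> \<Longrightarrow> \<psi> p \<in> Z"
proof -
  let ?X = "top_of_set (closed_simplex \<sigma>)" and ?P = "\<lambda>h. \<forall>p\<in>closed_simplex \<sigma>. \<phi> p \<in> Z \<longrightarrow> h p = \<phi> p"
  obtain k z where k: "continuous_map (prod_topology unit_interval ?X) T k"
    "\<And>p. p \<in> closed_simplex \<sigma> \<Longrightarrow> k (0, p) = \<phi> p"
    "\<And>t p. t \<in> {0..1} \<Longrightarrow> p \<in> closed_simplex \<sigma> \<Longrightarrow> k (t, p) \<in> Z \<union> \<kappa> ` closed_simplex \<tau>"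
    "\<And>t p. t \<in> {0..1} \<Longrightarrow> p \<in> closed_simplex \<sigma> \<Longrightarrow> \<phi> p \<in> Z \<Longrightarrow> k (t, p) = \<phi> p"
    and z: "z \<in> open_simplex \<tau>" "\<And>p. p \<in> closed_simplex \<sigma> \<Longrightarrow> k (1, p) \<noteq> \<kappa> z"
    using miss_point[OF \<sigma> \<phi> im] by blast
  define \<phi>1 where "\<phi>1 = (\<lambda>p. k (1, p))"
  have "continuous_map ?X T (\<lambda>p. k ((\<lambda>_. 1) p, p))"
    by (rule continuous_map_comp2[OF k(1)]) auto
  then have c1: "continuous_map ?X T \<phi>1" by (simp add: \<phi>1_def)
  have h1: "homotopic_with ?P ?X T \<phi> \<phi>1"
    by (subst homotopic_with) (use k in \<open>auto simp: \<phi>1_def\<close>)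
  have "compact_space ?X" using compact_closed_simplex[OF \<sigma>(1)] by (simp add: compact_space_subtopology)
  then obtain k' where k': "continuous_map (prod_topology unit_interval ?X) T k'"
    "\<And>p. p \<in> topspace ?X \<Longrightarrow> k' (0, p) = \<phi>1 p" "\<And>p. p \<in> topspace ?X \<Longrightarrow> k' (1, p) \<in> Z"
    "\<And>t p. t \<in> {0..1} \<Longrightarrow> p \<in> topspace ?X \<Longrightarrow> \<phi>1 p \<in> Z \<Longrightarrow> k' (t, p) = \<phi>1 p"
    by (rule push_off[OF _ c1 _ z(1)]) (use k(3) z(2) in \<open>auto simp: \<phi>1_def\<close>)
  have "homotopic_with ?P ?X T \<phi>1 (\<lambda>p. k' (1, p))"
    by (subst homotopic_with) (use k k' in \<open>auto simp: \<phi>1_def\<close>)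
  then have "homotopic_with ?P ?X T \<phi> (\<lambda>p. k' (1, p))" using h1 homotopic_with_trans by blast
  then show ?thesis using that k'(3) by auto
qed

end

section \<open>Cellular approximation\<close>

definition cell_structure ::
  "'b topology \<Rightarrow> 'j set \<Rightarrow> ('j \<Rightarrow> 'a set) \<Rightarrow> ('j \<Rightarrow> ('a \<Rightarrow> real) \<Rightarrow> 'b) \<Rightarrow> bool"
where
  "cell_structure T J \<tau> \<kappa> \<longleftrightarrow> Hausdorff_space T \<and> finite J \<and>
     (\<forall>j\<in>J. finite (\<tau> j) \<and> \<tau> j \<noteq> {} \<and> continuous_map (top_of_set (closed_simplex (\<tau> j))) T (\<kappa> j) \<and>
        inj_on (\<kappa> j) (open_simplex (\<tau> j)) \<and>
        \<kappa> j ` (closed_simplex (\<tau> j) - open_simplex (\<tau> j)) \<subseteq>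
          (\<Union>i\<in>{i\<in>J. card (\<tau> i) < card (\<tau> j)}. \<kappa> i ` open_simplex (\<tau> i))) \<and>
     disjoint_family_on (\<lambda>j. \<kappa> j ` open_simplex (\<tau> j)) J \<and>
     topspace T = (\<Union>j\<in>J. \<kappa> j ` open_simplex (\<tau> j))"

text \<open>Simplices are measured by their number of vertices: the cells in \<open>skeleton J \<tau> \<kappa> n\<close> are those of
  dimension less than \<open>n\<close>.\<close>

definition skeleton ::
  "'j set \<Rightarrow> ('j \<Rightarrow> 'a set) \<Rightarrow> ('j \<Rightarrow> ('a \<Rightarrow> real) \<Rightarrow> 'b) \<Rightarrow> nat \<Rightarrow> 'b set"
where
  "skeleton J \<tau> \<kappa> n = (\<Union>j\<in>{j\<in>J. card (\<tau> j) \<le> n}. \<kappa> j ` open_simplex (\<tau> j))"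

lemma skeleton_mono: "m \<le> n \<Longrightarrow> skeleton J \<tau> \<kappa> m \<subseteq> skeleton J \<tau> \<kappa> n"
  by (auto simp: skeleton_def)

lemma finite_max_attained:
  fixes f :: "'i \<Rightarrow> nat"
  assumes "finite S" "S \<noteq> {}"
  obtains x where "x \<in> S" "\<And>y. y \<in> S \<Longrightarrow> f y \<le> f x"
proof -
  have "Max (f ` S) \<in> f ` S" using assms by simp
  then obtain x where "x \<in> S" "f x = Max (f ` S)" by force
  then show ?thesis using that assms by simp
qed

lemma continuous_map_paste:
  assumes Z: "Hausdorff_space Z" "compact_space Z"
    and P: "P = Q \<union> R" "closedin (top_of_set P) Q" "compact R"
    and f: "continuous_map (prod_topology Z (top_of_set Q)) W f"
    and g: "continuous_map (prod_topology Z (top_of_set R)) W g"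
    and fg: "\<And>z w. z \<in> topspace Z \<Longrightarrow> w \<in> Q \<Longrightarrow> w \<in> R \<Longrightarrow> f (z, w) = g (z, w)"
  shows "continuous_map (prod_topology Z (top_of_set (P :: ('a \<Rightarrow> real) set))) W
    (\<lambda>p. if snd p \<in> Q then f p else g p)"
proof (rule continuous_map_from_charts[where I = "{()}" and S = "topspace Z \<times> Q"
      and P = "\<lambda>_. prod_topology Z (top_of_set R)" and \<gamma> = "\<lambda>_ p. p"])
  show "Hausdorff_space (prod_topology Z (top_of_set P))"
    unfolding Hausdorff_space_prod_topology using Z Hausdorff_space_subtopology[OF Hausdorff_space_fun] by blast
  show "closedin (prod_topology Z (top_of_set P)) (topspace Z \<times> Q)"
    using P(2) by (simp add: closedin_prod_Times_iff)
  have QP: "Q \<subseteq> P" "R \<subseteq> P" using P(1) by auto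
  have "subtopology (prod_topology Z (top_of_set P)) (topspace Z \<times> Q) = prod_topology Z (top_of_set Q)"
    by (metis QP(1) inf.absorb2 subtopology_Times subtopology_subtopology subtopology_topspace)
  then show "continuous_map (subtopology (prod_topology Z (top_of_set P)) (topspace Z \<times> Q)) W (\<lambda>p. if snd p \<in> Q then f p else g p)"
    by (simp only:) (rule continuous_map_eq[OF f], auto)
  show "compact_space (prod_topology Z (top_of_set R))"
    unfolding compact_space_prod_topology using Z P(3) by (simp add: compact_space_subtopology)
  have "continuous_map (top_of_set R) (top_of_set P) (\<lambda>w. w)"
    using QP by (simp add: continuous_on_id image_subset_iff subset_iff)
  then have "continuous_map (prod_topology Z (top_of_set R)) (prod_topology Z (top_of_set P)) (\<lambda>p. (fst p, snd p))"
    by (intro continuous_map_pairedI continuous_map_fst continuous_map_comp1[OF _ continuous_map_snd])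
  then show "continuous_map (prod_topology Z (top_of_set R)) (prod_topology Z (top_of_set P)) (\<lambda>p. p)" by simp
  show "continuous_map (prod_topology Z (top_of_set R)) W (\<lambda>p. if snd p \<in> Q then f p else g p)"
    by (rule continuous_map_eq[OF g]) (use fg in auto)
qed (use P(1) in auto)

lemma continuous_map_time_slice:
  assumes "continuous_map (prod_topology unit_interval X) T k" "t \<in> {0..1}"
  shows "continuous_map X T (\<lambda>p. k (t, p))"
proof -
  have "continuous_map X T (\<lambda>p. k ((\<lambda>_. t) p, p))"
    by (rule continuous_map_comp2[OF assms(1)]) (use assms(2) in auto)
  then show ?thesis by simp
qed

locale cell_complex =
  fixes T :: "'b topology" and J :: "'j set" and \<tau> :: "'j \<Rightarrow> 'a set" and \<kappa> :: "'j \<Rightarrow> ('a \<Rightarrow> real) \<Rightarrow> 'b"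
  assumes is_structure: "cell_structure T J \<tau> \<kappa>"
begin

abbreviation "cell j \<equiv> \<kappa> j ` open_simplex (\<tau> j)"

lemma
  shows hausdorff: "Hausdorff_space T" and finite_J: "finite J"
    and finite_cell: "j \<in> J \<Longrightarrow> finite (\<tau> j)" and cell_nonempty: "j \<in> J \<Longrightarrow> \<tau> j \<noteq> {}"
    and char_cont: "j \<in> J \<Longrightarrow> continuous_map (top_of_set (closed_simplex (\<tau> j))) T (\<kappa> j)"
    and char_inj: "j \<in> J \<Longrightarrow> inj_on (\<kappa> j) (open_simplex (\<tau> j))"
    and char_boundary: "j \<in> J \<Longrightarrow> w \<in> closed_simplex (\<tau> j) - open_simplex (\<tau> j) \<Longrightarrow>
      \<exists>i\<in>J. card (\<tau> i) < card (\<tau> j) \<and> \<kappa> j w \<in> cell i"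
    and disj: "disjoint_family_on cell J"
    and top: "topspace T = (\<Union>j\<in>J. cell j)"
proof -
  note s = is_structure[unfolded cell_structure_def]
  show "Hausdorff_space T" "finite J" "disjoint_family_on cell J" "topspace T = (\<Union>j\<in>J. cell j)"
    "j \<in> J \<Longrightarrow> finite (\<tau> j)" "j \<in> J \<Longrightarrow> \<tau> j \<noteq> {}"
    "j \<in> J \<Longrightarrow> continuous_map (top_of_set (closed_simplex (\<tau> j))) T (\<kappa> j)"
    "j \<in> J \<Longrightarrow> inj_on (\<kappa> j) (open_simplex (\<tau> j))"
    using s by simp_all
  assume j: "j \<in> J" and w: "w \<in> closed_simplex (\<tau> j) - open_simplex (\<tau> j)"
  have "\<kappa> j ` (closed_simplex (\<tau> j) - open_simplex (\<tau> j)) \<subseteq>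
          (\<Union>i\<in>{i\<in>J. card (\<tau> i) < card (\<tau> j)}. cell i)" using s j by simp
  then have "\<kappa> j w \<in> (\<Union>i\<in>{i\<in>J. card (\<tau> i) < card (\<tau> j)}. cell i)" using w by blast
  then show "\<exists>i\<in>J. card (\<tau> i) < card (\<tau> j) \<and> \<kappa> j w \<in> cell i" by blast
qed

lemma attached_cell_lower:
  assumes I: "I \<subseteq> J" and lower: "\<And>i j. i \<in> I \<Longrightarrow> j \<in> J \<Longrightarrow> card (\<tau> j) < card (\<tau> i) \<Longrightarrow> j \<in> I"
    and i: "i \<in> I" "\<And>j. j \<in> I \<Longrightarrow> card (\<tau> j) \<le> card (\<tau> i)"
  shows "attached_cell T (\<Union>j\<in>I-{i}. cell j) (\<tau> i) (\<kappa> i)"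
proof
  have iJ: "i \<in> J" using I i by blast
  show "Hausdorff_space T" "finite (\<tau> i)" "\<tau> i \<noteq> {}" "continuous_map (top_of_set (closed_simplex (\<tau> i))) T (\<kappa> i)"
    "inj_on (\<kappa> i) (open_simplex (\<tau> i))"
    using hausdorff finite_cell cell_nonempty char_cont char_inj iJ by auto
  have sub: "\<kappa> j ` closed_simplex (\<tau> j) \<subseteq> (\<Union>j\<in>I-{i}. cell j)" if j: "j \<in> I - {i}" for j
  proof
    fix y assume "y \<in> \<kappa> j ` closed_simplex (\<tau> j)"
    then obtain w where w: "w \<in> closed_simplex (\<tau> j)" "y = \<kappa> j w" by blast
    show "y \<in> (\<Union>j\<in>I-{i}. cell j)"
    proof (cases "w \<in> open_simplex (\<tau> j)")
      case True then show ?thesis using w j by blast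
    next
      case False
      then obtain l where l: "l \<in> J" "card (\<tau> l) < card (\<tau> j)" "y \<in> cell l"
        using char_boundary[of j w] w j I by blast
      have "l \<in> I" using lower[of j l] j l by blast
      moreover have "l \<noteq> i" using l(2) i(2)[of j] j by auto
      ultimately show ?thesis using l(3) by blast
    qed
  qed
  have "cell j \<subseteq> \<kappa> j ` closed_simplex (\<tau> j)" for j by (auto simp: open_simplex_def)
  then have eq: "(\<Union>j\<in>I-{i}. cell j) = (\<Union>j\<in>I-{i}. \<kappa> j ` closed_simplex (\<tau> j))"
    by (intro equalityI UN_mono UN_least order_refl sub)
  have "closedin T (\<kappa> j ` closed_simplex (\<tau> j))" if "j \<in> J" for j
  proof -
    have "compact_space (top_of_set (closed_simplex (\<tau> j)))"
      using compact_closed_simplex[OF finite_cell[OF that]] by (simp add: compact_space_subtopology)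
    then show ?thesis
      using image_compactin[OF _ char_cont[OF that]] compactin_imp_closedin[OF hausdorff]
      by (metis compact_space_def topspace_euclidean_subtopology)
  qed
  then show "closedin T (\<Union>j\<in>I-{i}. cell j)"
    unfolding eq using I finite_subset[OF I finite_J] by (intro closedin_Union) auto
  fix w
  {
    assume "w \<in> open_simplex (\<tau> i)"
    then have w: "\<kappa> i w \<in> cell i" by blast
    show "\<kappa> i w \<notin> (\<Union>j\<in>I-{i}. cell j)"
    proof
      assume "\<kappa> i w \<in> (\<Union>j\<in>I-{i}. cell j)"
      then obtain j where j: "j \<in> I - {i}" "\<kappa> i w \<in> cell j" by blast
      then have "cell i \<inter> cell j = {}" using disj iJ I unfolding disjoint_family_on_def by blast
      then show False using w j by blast
    qed
  next
    assume "w \<in> closed_simplex (\<tau> i) - open_simplex (\<tau> i)"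
    then obtain l where l: "l \<in> J" "card (\<tau> l) < card (\<tau> i)" "\<kappa> i w \<in> cell l"
      using char_boundary[OF iJ] by blast
    then show "\<kappa> i w \<in> (\<Union>j\<in>I-{i}. cell j)" using lower[OF i(1) l(1,2)] by blast
  }
qed

lemma compress_to_skeleton_aux:
  assumes \<sigma>: "finite \<sigma>" "card \<sigma> = n"
    and I: "I \<subseteq> J" "\<And>i j. i \<in> I \<Longrightarrow> j \<in> J \<Longrightarrow> card (\<tau> j) < card (\<tau> i) \<Longrightarrow> j \<in> I"
      "\<And>j. j \<in> J \<Longrightarrow> card (\<tau> j) \<le> n \<Longrightarrow> j \<in> I"
    and \<phi>: "continuous_map (top_of_set (closed_simplex \<sigma>)) T \<phi>"
      "\<And>p. p \<in> closed_simplex \<sigma> \<Longrightarrow> \<phi> p \<in> (\<Union>i\<in>I. cell i)"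
  shows "\<exists>\<psi>. homotopic_with (\<lambda>h. \<forall>p\<in>closed_simplex \<sigma>. \<phi> p \<in> skeleton J \<tau> \<kappa> n \<longrightarrow> h p = \<phi> p)
      (top_of_set (closed_simplex \<sigma>)) T \<phi> \<psi> \<and> (\<forall>p\<in>closed_simplex \<sigma>. \<psi> p \<in> skeleton J \<tau> \<kappa> n)"
  using I \<phi>
proof (induction "card {i\<in>I. n < card (\<tau> i)}" arbitrary: I \<phi>)
  case 0
  have "finite I" using 0(2) finite_J finite_subset by blast
  then have "{i\<in>I. n < card (\<tau> i)} = {}" using 0(1) by simp
  then have "\<forall>p\<in>closed_simplex \<sigma>. \<phi> p \<in> skeleton J \<tau> \<kappa> n"
    using 0(2,6) unfolding skeleton_def by (fastforce simp: not_less)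
  then show ?case using 0(5) by (intro exI[of _ \<phi>]) simp
next
  case (Suc m)
  let ?H = "{i\<in>I. n < card (\<tau> i)}"
  have fI: "finite I" using Suc(3) finite_J finite_subset by blast
  then have fH: "finite ?H" by simp
  have neH: "?H \<noteq> {}" using Suc(2) by (metis (no_types) card.empty nat.distinct(1))
  obtain i where i: "i \<in> ?H" "\<And>j. j \<in> ?H \<Longrightarrow> card (\<tau> j) \<le> card (\<tau> i)"
    using finite_max_attained[OF fH neH, of "\<lambda>j. card (\<tau> j)"] by blast
  have imax: "card (\<tau> j) \<le> card (\<tau> i)" if "j \<in> I" for j
    using i that by (cases "n < card (\<tau> j)") auto
  let ?I = "I - {i}"
  let ?Z = "\<Union>j\<in>?I. cell j"
  interpret a: attached_cell T ?Z "\<tau> i" "\<kappa> i"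
    using attached_cell_lower[OF Suc(3,4) _ imax] i(1) by simp
  have im: "\<phi> p \<in> ?Z \<union> \<kappa> i ` closed_simplex (\<tau> i)" if "p \<in> closed_simplex \<sigma>" for p
    using Suc(7)[OF that] by (auto simp: open_simplex_def)
  have "card \<sigma> < card (\<tau> i)" using i \<sigma> by simp
  from a.compress[OF \<sigma>(1) this Suc(6) im]
  obtain \<phi>1 where \<phi>1: "homotopic_with (\<lambda>h. \<forall>p\<in>closed_simplex \<sigma>. \<phi> p \<in> ?Z \<longrightarrow> h p = \<phi> p) (top_of_set (closed_simplex \<sigma>)) T \<phi> \<phi>1"
    "\<And>p. p \<in> closed_simplex \<sigma> \<Longrightarrow> \<phi>1 p \<in> ?Z" by blast
  have "{j\<in>?I. n < card (\<tau> j)} = ?H - {i}" by auto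
  then have "m = card {j\<in>?I. n < card (\<tau> j)}" using Suc(2) i(1) fH by simp
  moreover have "?I \<subseteq> J" using Suc(3) by blast
  moreover have "l \<in> ?I" if "j \<in> ?I" "l \<in> J" "card (\<tau> l) < card (\<tau> j)" for j l
    using Suc(4)[of j l] that imax[of j] by auto
  moreover have low: "j \<in> ?I" if "j \<in> J" "card (\<tau> j) \<le> n" for j
    using Suc(5)[OF that] that i by auto
  moreover have "continuous_map (top_of_set (closed_simplex \<sigma>)) T \<phi>1"
    using \<phi>1(1) homotopic_with_imp_continuous_maps by blast
  ultimately have "\<exists>\<psi>. homotopic_with (\<lambda>h. \<forall>p\<in>closed_simplex \<sigma>. \<phi>1 p \<in> skeleton J \<tau> \<kappa> n \<longrightarrow> h p = \<phi>1 p)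
      (top_of_set (closed_simplex \<sigma>)) T \<phi>1 \<psi> \<and> (\<forall>p\<in>closed_simplex \<sigma>. \<psi> p \<in> skeleton J \<tau> \<kappa> n)"
    using Suc(1)[of ?I \<phi>1] \<phi>1(2) by blast
  then obtain \<psi> where \<psi>: "homotopic_with (\<lambda>h. \<forall>p\<in>closed_simplex \<sigma>. \<phi>1 p \<in> skeleton J \<tau> \<kappa> n \<longrightarrow> h p = \<phi>1 p)
      (top_of_set (closed_simplex \<sigma>)) T \<phi>1 \<psi>" "\<forall>p\<in>closed_simplex \<sigma>. \<psi> p \<in> skeleton J \<tau> \<kappa> n" by blast
  have sZ: "skeleton J \<tau> \<kappa> n \<subseteq> ?Z" unfolding skeleton_def using low by blast
  have \<phi>1p: "\<phi>1 p = \<phi> p" if "p \<in> closed_simplex \<sigma>" "\<phi> p \<in> skeleton J \<tau> \<kappa> n" for p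
    by (rule conjunct2[OF homotopic_with_imp_property[OF \<phi>1(1)], rule_format, OF that(1) subsetD[OF sZ that(2)]])
  let ?R = "\<lambda>h. \<forall>p\<in>closed_simplex \<sigma>. \<phi> p \<in> skeleton J \<tau> \<kappa> n \<longrightarrow> h p = \<phi> p"
  have "homotopic_with ?R (top_of_set (closed_simplex \<sigma>)) T \<phi> \<phi>1"
  proof (rule homotopic_with_mono[OF \<phi>1(1)], intro ballI impI)
    fix h p assume "\<forall>p\<in>closed_simplex \<sigma>. \<phi> p \<in> ?Z \<longrightarrow> h p = \<phi> p" "p \<in> closed_simplex \<sigma>" "\<phi> p \<in> skeleton J \<tau> \<kappa> n"
    then show "h p = \<phi> p" using subsetD[OF sZ] by metis
  qed
  moreover have "homotopic_with ?R (top_of_set (closed_simplex \<sigma>)) T \<phi>1 \<psi>"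
    by (rule homotopic_with_mono[OF \<psi>(1)]) (use \<phi>1p in simp)
  ultimately have "homotopic_with ?R (top_of_set (closed_simplex \<sigma>)) T \<phi> \<psi>" by (rule homotopic_with_trans)
  then show ?case using \<psi>(2) by (intro exI[of _ \<psi>] conjI)
qed

lemma compress_to_skeleton:
  assumes "finite \<sigma>" "continuous_map (top_of_set (closed_simplex \<sigma>)) T \<phi>"
  obtains \<psi> where "homotopic_with (\<lambda>h. \<forall>p\<in>closed_simplex \<sigma>. \<phi> p \<in> skeleton J \<tau> \<kappa> (card \<sigma>) \<longrightarrow> h p = \<phi> p)
      (top_of_set (closed_simplex \<sigma>)) T \<phi> \<psi>" "\<And>p. p \<in> closed_simplex \<sigma> \<Longrightarrow> \<psi> p \<in> skeleton J \<tau> \<kappa> (card \<sigma>)"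
proof -
  have im: "\<phi> p \<in> (\<Union>i\<in>J. cell i)" if "p \<in> closed_simplex \<sigma>" for p
    using assms(2) that unfolding top[symmetric] by (auto simp: continuous_map_def)
  have "\<exists>\<psi>. homotopic_with (\<lambda>h. \<forall>p\<in>closed_simplex \<sigma>. \<phi> p \<in> skeleton J \<tau> \<kappa> (card \<sigma>) \<longrightarrow> h p = \<phi> p)
      (top_of_set (closed_simplex \<sigma>)) T \<phi> \<psi> \<and> (\<forall>p\<in>closed_simplex \<sigma>. \<psi> p \<in> skeleton J \<tau> \<kappa> (card \<sigma>))"
    by (rule compress_to_skeleton_aux[OF assms(1) refl subset_refl _ _ assms(2)]) (assumption | erule im)+
  then obtain \<psi> where \<psi>: "homotopic_with (\<lambda>h. \<forall>p\<in>closed_simplex \<sigma>. \<phi> p \<in> skeleton J \<tau> \<kappa> (card \<sigma>) \<longrightarrow> h p = \<phi> p)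
      (top_of_set (closed_simplex \<sigma>)) T \<phi> \<psi>" "\<forall>p\<in>closed_simplex \<sigma>. \<psi> p \<in> skeleton J \<tau> \<kappa> (card \<sigma>)"
    by (elim exE conjE)
  show ?thesis by (rule that[OF \<psi>(1)]) (rule bspec[OF \<psi>(2)])
qed

theorem cellular_approximation:
  assumes L: "finite_complex L" and \<phi>: "continuous_map (top_of_set (realization L)) T \<phi>"
  shows "\<exists>\<psi>. homotopic_with (\<lambda>_. True) (top_of_set (realization L)) T \<phi> \<psi> \<and>
    (\<forall>w\<in>realization L. \<psi> w \<in> skeleton J \<tau> \<kappa> (card (supp w)))"
proof -
  have "\<exists>\<psi>. homotopic_with (\<lambda>_. True) (top_of_set (realization K)) T \<phi> \<psi> \<and>
    (\<forall>w\<in>realization K. \<psi> w \<in> skeleton J \<tau> \<kappa> (card (supp w)))" if "finite_complex K" "K \<subseteq> L" for K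
    using that
  proof (induction "card K" arbitrary: K)
    case 0
    then have "K = {}" by (simp add: finite_complex_def)
    then have "realization K = {}" by (auto simp: realization_def)
    then show ?case by (intro exI[of _ \<phi>]) simp
  next
    case (Suc m)
    have fK: "finite K" using Suc by (simp add: finite_complex_def)
    have "K \<noteq> {}" using Suc(2) by auto
    then obtain \<sigma> where \<sigma>: "\<sigma> \<in> K" "\<And>\<rho>. \<rho> \<in> K \<Longrightarrow> card \<rho> \<le> card \<sigma>"
      using finite_max_attained[OF fK, of card] by blast
    define K' where "K' = K - {\<sigma>}"
    have f\<sigma>: "finite \<sigma>" "\<sigma> \<noteq> {}" using finite_complexD[OF Suc(3) \<sigma>(1)] by auto
    have faces: "\<rho> \<in> K'" if "\<rho> \<subset> \<sigma>" "\<rho> \<noteq> {}" for \<rho>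
      using finite_complexD(3)[OF Suc(3) \<sigma>(1)] that by (auto simp: K'_def)
    have K': "finite_complex K'" "m = card K'" "K' \<subseteq> L"
    proof -
      have "\<rho> \<in> K'" if "\<tau> \<in> K'" "\<rho> \<subseteq> \<tau>" "\<rho> \<noteq> {}" for \<rho> \<tau>
      proof -
        have "\<tau> \<in> K" "\<tau> \<noteq> \<sigma>" using that by (auto simp: K'_def)
        moreover have "\<rho> \<noteq> \<sigma>"
          using calculation \<sigma>(2)[of \<tau>] psubset_card_mono[of \<tau> \<sigma>] that finite_complexD(1)[OF Suc(3), of \<tau>] by auto
        ultimately show ?thesis using finite_complexD(3)[OF Suc(3), of \<tau> \<rho>] that by (simp add: K'_def)
      qed
      moreover have "finite \<rho> \<and> \<rho> \<noteq> {}" if "\<rho> \<in> K'" for \<rho>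
        using that finite_complexD(1,2)[OF Suc(3)] by (auto simp: K'_def)
      moreover have "finite K'" using fK by (simp add: K'_def)
      ultimately show "finite_complex K'" unfolding finite_complex_def by blast
      show "m = card K'" using Suc(2) \<sigma>(1) fK by (simp add: K'_def)
      show "K' \<subseteq> L" using Suc(4) by (auto simp: K'_def)
    qed
    let ?D = "closed_simplex \<sigma>" and ?Q = "realization K'" and ?P = "realization K"
    have P: "?P = ?Q \<union> ?D"
    proof -
      have "K = insert \<sigma> K'" using \<sigma>(1) by (auto simp: K'_def)
      then have "(\<Union>\<rho>\<in>K. closed_simplex \<rho>) = (\<Union>\<rho>\<in>K'. closed_simplex \<rho>) \<union> ?D" by auto
      then show ?thesis unfolding realization_eq_Union[OF Suc(3)] realization_eq_Union[OF K'(1)] .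
    qed
    have QD: "w \<in> ?Q \<longleftrightarrow> w \<notin> open_simplex \<sigma>" if w: "w \<in> ?D" for w
    proof -
      have s: "\<forall>v. 0 \<le> w v" "supp w \<subseteq> \<sigma>" "sum w (supp w) = 1" using w closed_simplex_iff_supp[OF f\<sigma>(1)] by auto
      have "w \<in> ?Q \<longleftrightarrow> supp w \<in> K'" using s by (simp add: mem_realization_iff)
      also have "\<dots> \<longleftrightarrow> supp w \<noteq> \<sigma>" using faces[of "supp w"] supp_nonempty[OF s(3)] s(2) by (auto simp: K'_def)
      also have "\<dots> \<longleftrightarrow> w \<notin> open_simplex \<sigma>" using s open_simplex_iff_supp[OF f\<sigma>(1)] by simp
      finally show ?thesis .
    qed
    have cQ: "compact ?Q" by (rule compact_realization[OF K'(1)])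
    have clQ: "closedin (top_of_set ?P) ?Q"
    proof -
      have "compactin (top_of_set ?P) ?Q" using cQ P by (auto simp: compactin_subtopology)
      then show ?thesis using compactin_imp_closedin Hausdorff_space_subtopology[OF Hausdorff_space_fun] by blast
    qed
    have cD: "compact ?D" by (rule compact_closed_simplex[OF f\<sigma>(1)])
    note paste = continuous_map_paste[OF Hausdorff_unit_interval compact_unit_interval P clQ cD]
    have DL: "?D \<subseteq> realization L" using \<sigma>(1) Suc(4) unfolding realization_eq_Union[OF L] by blast
    obtain \<psi>' where \<psi>': "homotopic_with (\<lambda>_. True) (top_of_set ?Q) T \<phi> \<psi>'"
      "\<And>w. w \<in> ?Q \<Longrightarrow> \<psi>' w \<in> skeleton J \<tau> \<kappa> (card (supp w))"
      using Suc(1)[OF K'(2,1,3)] by blast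
    then obtain H where H: "continuous_map (prod_topology unit_interval (top_of_set ?Q)) T H"
      "\<And>w. H (0, w) = \<phi> w" "\<And>w. H (1, w) = \<psi>' w"
      unfolding homotopic_with_def by auto
    interpret s: pointed_simplex \<sigma> "barycenter \<sigma>"
      by unfold_locales (simp_all add: f\<sigma> barycenter_mem)
    have bQ: "?D - open_simplex \<sigma> \<subseteq> ?Q" using QD by blast
    have "continuous_map (prod_topology unit_interval (top_of_set (?D - open_simplex \<sigma>))) T (\<lambda>p. H (fst p, snd p))"
    proof (rule continuous_map_comp2[OF H(1) continuous_map_fst])
      show "continuous_map (prod_topology unit_interval (top_of_set (?D - open_simplex \<sigma>))) (top_of_set ?Q) snd"
        by (rule continuous_map_into_subtopology[OF continuous_map_into_fulltopology[OF continuous_map_snd]]) (use bQ in auto)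
    qed
    then have Hb: "continuous_map (prod_topology unit_interval (top_of_set (?D - open_simplex \<sigma>))) T H" by simp
    obtain G where G: "continuous_map (prod_topology unit_interval (top_of_set ?D)) T G"
      "\<And>w. w \<in> ?D \<Longrightarrow> G (0, w) = \<phi> w"
      "\<And>t w. t \<in> {0..1} \<Longrightarrow> w \<in> ?D - open_simplex \<sigma> \<Longrightarrow> G (t, w) = H (t, w)"
      using s.homotopy_extension_simplex[OF continuous_map_from_subtopology_mono[OF \<phi> DL] Hb] H(2) by blast
    define H1 where "H1 p = (if snd p \<in> ?Q then H p else G p)" for p
    have "continuous_map (prod_topology unit_interval (top_of_set ?P)) T H1"
      unfolding H1_def
    proof (rule paste[OF H(1) G(1)])
      fix t w assume "t \<in> topspace unit_interval" "w \<in> ?Q" "w \<in> ?D"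
      then show "H (t, w) = G (t, w)" using G(3)[of t w] QD[of w] by auto
    qed
    note cH1 = this
    define \<phi>1 where "\<phi>1 = (\<lambda>w. H1 (1, w))"
    have c\<phi>1: "continuous_map (top_of_set ?P) T \<phi>1"
      unfolding \<phi>1_def by (rule continuous_map_time_slice[OF cH1]) simp
    have h1: "homotopic_with (\<lambda>_. True) (top_of_set ?P) T \<phi> \<phi>1"
      by (rule homotopic_withI[OF cH1]) (use P H(2) G(2) in \<open>auto simp: H1_def \<phi>1_def\<close>)
    have \<phi>1Q: "\<phi>1 w = \<psi>' w" if "w \<in> ?Q" for w using that H(3) by (simp add: \<phi>1_def H1_def)
    have \<phi>1b: "\<phi>1 w \<in> skeleton J \<tau> \<kappa> (card \<sigma>)" if w: "w \<in> ?D" "w \<in> ?Q" for w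
    proof -
      have "card (supp w) \<le> card \<sigma>" using closed_simplexD(4)[OF w(1)] f\<sigma>(1) by (rule card_mono[rotated])
      then show ?thesis using \<psi>'(2)[OF w(2)] \<phi>1Q[OF w(2)] skeleton_mono by (metis subsetD)
    qed
    have DP: "?D \<subseteq> ?P" "?Q \<subseteq> ?P" using P by auto
    obtain \<psi>1 where \<psi>1: "homotopic_with (\<lambda>h. \<forall>p\<in>?D. \<phi>1 p \<in> skeleton J \<tau> \<kappa> (card \<sigma>) \<longrightarrow> h p = \<phi>1 p) (top_of_set ?D) T \<phi>1 \<psi>1"
      "\<And>p. p \<in> ?D \<Longrightarrow> \<psi>1 p \<in> skeleton J \<tau> \<kappa> (card \<sigma>)"
      using compress_to_skeleton[OF f\<sigma>(1) continuous_map_from_subtopology_mono[OF c\<phi>1 DP(1)]] by blast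
    then obtain k where k: "continuous_map (prod_topology unit_interval (top_of_set ?D)) T k"
      "\<And>w. k (0, w) = \<phi>1 w" "\<And>w. k (1, w) = \<psi>1 w"
      "\<And>t w. t \<in> {0..1} \<Longrightarrow> w \<in> ?D \<Longrightarrow> \<phi>1 w \<in> skeleton J \<tau> \<kappa> (card \<sigma>) \<Longrightarrow> k (t, w) = \<phi>1 w"
      unfolding homotopic_with_def by auto
    define H2 where "H2 p = (if snd p \<in> ?Q then \<phi>1 (snd p) else k p)" for p
    have cH2: "continuous_map (prod_topology unit_interval (top_of_set ?P)) T H2"
      unfolding H2_def
    proof (rule paste[OF _ k(1)])
      show "continuous_map (prod_topology unit_interval (top_of_set ?Q)) T (\<lambda>p. \<phi>1 (snd p))"
        by (rule continuous_map_comp1[OF continuous_map_from_subtopology_mono[OF c\<phi>1 DP(2)] continuous_map_snd])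
      show "\<phi>1 (snd (t, w)) = k (t, w)" if "t \<in> topspace unit_interval" "w \<in> ?Q" "w \<in> ?D" for t w
        using k(4)[of t w] that \<phi>1b[of w] by simp
    qed
    have h2: "homotopic_with (\<lambda>_. True) (top_of_set ?P) T \<phi>1 (\<lambda>w. H2 (1, w))"
      by (rule homotopic_withI[OF cH2]) (use k(2) in \<open>auto simp: H2_def\<close>)
    have "H2 (1, w) \<in> skeleton J \<tau> \<kappa> (card (supp w))" if w: "w \<in> ?P" for w
    proof (cases "w \<in> ?Q")
      case True then show ?thesis using \<psi>'(2) \<phi>1Q by (simp add: H2_def)
    next
      case False
      then have wD: "w \<in> ?D" using w P by blast
      then have "supp w = \<sigma>" using False QD open_simplex_iff_supp[OF f\<sigma>(1)] by blast
      then show ?thesis using \<psi>1(2)[OF wD] k(3) False by (simp add: H2_def)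
    qed
    then show ?case using homotopic_with_trans[OF h1 h2] by blast
  qed
  then show ?thesis using L by blast
qed

end

section \<open>Finite CW-complexes from cell structures\<close>

lemma Euclidean_space_eq: "Euclidean_space n = top_of_set {x :: nat \<Rightarrow> real. \<forall>i\<ge>n. x i = 0}"
  by (simp add: Euclidean_space_def euclidean_product_topology)

lemma disc_topology: "subtopology (Euclidean_space n) (disc n) = top_of_set (disc n)"
proof -
  have "{x :: nat \<Rightarrow> real. \<forall>i\<ge>n. x i = 0} \<inter> disc n = disc n"
    by (auto simp: disc_def Euclidean_space_eq)
  then show ?thesis by (simp add: Euclidean_space_eq subtopology_subtopology)
qed

lemma mem_disc: "x \<in> disc n \<longleftrightarrow> (\<forall>i\<ge>n. x i = 0) \<and> L2_set x {..<n} \<le> 1"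
  by (simp add: disc_def Euclidean_space_eq L2_set_def)

lemma mem_open_disc: "x \<in> open_disc n \<longleftrightarrow> (\<forall>i\<ge>n. x i = 0) \<and> L2_set x {..<n} < 1"
  by (simp add: open_disc_def Euclidean_space_eq L2_set_def)

text \<open>The disc is mapped to the simplex by an affine map followed by the radial rescaling that turns
  the Euclidean norm into the Minkowski functional of the simplex with respect to the barycenter.\<close>

lemma disc_simplex:
  assumes \<tau>: "finite \<tau>" "card \<tau> = Suc n"
  obtains e where "continuous_map (subtopology (Euclidean_space n) (disc n)) (top_of_set (closed_simplex \<tau>)) e"
    "inj_on e (open_disc n)" "e ` open_disc n = open_simplex \<tau>"
    "e ` (disc n - open_disc n) \<subseteq> closed_simplex \<tau> - open_simplex \<tau>"
proof -
  define b where "b = barycenter \<tau>"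
  have "\<tau> \<noteq> {}" using \<tau> by auto
  then interpret pointed_simplex \<tau> b
    by unfold_locales (simp_all add: \<tau> barycenter_mem b_def)
  let ?g = "simplex_gauge \<tau> b"
  obtain g where g: "bij_betw g {0..<Suc n} \<tau>"
    using ex_bij_betw_nat_finite[OF \<tau>(1)] \<tau>(2) by metis
  define ix where "ix = inv_into {0..<Suc n} g"
  have ix: "ix v < Suc n" "g (ix v) = v" if "v \<in> \<tau>" for v
    using bij_betw_inv_into_right[OF g that] bij_betw_apply[OF bij_betw_inv_into[OF g] that] by (auto simp: ix_def)
  have gi: "g i \<in> \<tau>" "ix (g i) = i" if "i < Suc n" for i
    using bij_betw_inv_into_left[OF g, of i] bij_betw_apply[OF g, of i] that by (auto simp: ix_def)
  define l where "l x v = (if v \<notin> \<tau> then 0 else if ix v < n then x (ix v) else - (\<Sum>i<n. x i))" for x :: "nat \<Rightarrow> real" and v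
  define r where "r = (\<lambda>x :: nat \<Rightarrow> real. L2_set x {..<n})"
  define a where "a x v = b v + l x v" for x v
  have l_sum: "sum (l x) \<tau> = 0" for x
  proof -
    have "sum (l x) \<tau> = (\<Sum>i\<in>{0..<Suc n}. l x (g i))"
      using sum.reindex_bij_betw[OF g, of "l x"] by simp
    also have "\<dots> = (\<Sum>i\<in>{0..<Suc n}. if i < n then x i else - (\<Sum>i<n. x i))"
      by (intro sum.cong) (auto simp: l_def gi)
    also have "\<dots> = 0" by (simp add: atLeast0LessThan)
    finally show ?thesis .
  qed
  have a_aff: "a x \<in> affine_simplex \<tau>" for x
  proof -
    have "sum (a x) \<tau> = sum b \<tau> + sum (l x) \<tau>" by (simp add: a_def sum.distrib)
    then show ?thesis using l_sum center_affine by (auto simp: affine_simplex_def a_def l_def)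
  qed
  have l_scale: "l (\<lambda>i. c * x i) v = c * l x v" for c x v
    by (simp add: l_def sum_distrib_left)
  define m where "m = (\<lambda>x. ?g (a x))"
  have m0: "0 \<le> m x" for x using gauge_nonneg a_aff by (simp add: m_def)
  have l_bound: "\<bar>l x v\<bar> \<le> m x" for x v
  proof (cases "v \<in> \<tau>")
    case True
    have b1: "0 \<le> b u" for u using closed_simplexD(1)[OF center_closed] .
    have low: "- (m x * b u) \<le> l x u" if "u \<in> \<tau>" for u
    proof -
      have "?g (a x) \<le> m x" by (simp add: m_def)
      then have "(1 - m x) * b u \<le> a x u" unfolding gauge_le_iff using that by blast
      then show ?thesis by (simp add: a_def algebra_simps)
    qed
    have "m x * b v \<le> m x * 1" using m0 closed_simplex_le_1[OF \<tau>(1) center_closed] by (intro mult_left_mono)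
    then have 1: "- m x \<le> l x v" using low[OF True] by simp
    have "l x v = - sum (l x) (\<tau> - {v})" using l_sum[of x] sum.remove[OF \<tau>(1) True, of "l x"] by simp
    also have "\<dots> \<le> - (\<Sum>u\<in>\<tau>-{v}. - (m x * b u))" using low by (intro le_imp_neg_le sum_mono) auto
    also have "\<dots> = m x * sum b (\<tau> - {v})" by (simp add: sum_negf sum_distrib_left)
    also have "\<dots> \<le> m x * 1"
    proof (rule mult_left_mono[OF _ m0])
      have "sum b (\<tau> - {v}) \<le> sum b \<tau>" using \<tau>(1) b1 by (intro sum_mono2) auto
      then show "sum b (\<tau> - {v}) \<le> 1" using closed_simplexD(3)[OF center_closed] by simp
    qed
    finally show ?thesis using 1 by simp
  qed (use m0 in \<open>simp add: l_def\<close>)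
  have l_zero: "x i = 0" if "\<And>v. l x v = 0" "i < n" for x i
    using that(1)[of "g i"] that(2) gi[of i] by (simp add: l_def)
  have m_pos: "0 < m x" if "r x \<noteq> 0" for x
  proof (rule ccontr)
    assume "\<not> 0 < m x"
    then have "l x v = 0" for v using l_bound[of x v] m0[of x] by simp
    then have "x i = 0" if "i < n" for i using l_zero that by blast
    then have "r x = 0" by (simp add: r_def L2_set_def)
    then show False using that by simp
  qed
  have r0: "0 \<le> r x" for x by (simp add: r_def)
  have r_scale: "r (\<lambda>i. c * x i) = c * r x" if "0 \<le> c" for c x
    using that by (simp add: r_def L2_set_right_distrib)
  define e where "e x = ray b (r x / m x) (a x)" for x
  have e_eq: "e x v = b v + r x / m x * l x v" for x v by (simp add: e_def ray_def a_def)
  have e_aff: "e x \<in> affine_simplex \<tau>" for x unfolding e_def by (rule ray_affine[OF a_aff])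
  have e_gauge: "?g (e x) = r x" for x
  proof -
    have "?g (e x) = r x / m x * m x"
      unfolding e_def using gauge_ray[of "r x / m x" "a x"] r0[of x] m0[of x] by (simp add: m_def)
    then show ?thesis using m_pos[of x] by (cases "r x = 0") auto
  qed
  have "continuous_on (disc n) e"
  proof (rule continuous_on_coordinatewise_then_product)
    fix v
    have cx: "continuous_on (disc n) (\<lambda>x. x i)" for i by (rule continuous_on_eval)
    have cl: "continuous_on (disc n) (\<lambda>x. l x u)" for u
    proof -
      consider "u \<notin> \<tau>" | "u \<in> \<tau>" "ix u < n" | "u \<in> \<tau>" "\<not> ix u < n" by blast
      then show ?thesis
      proof cases
        case 1
        then have "(\<lambda>x. l x u) = (\<lambda>x. 0)" by (simp add: l_def)
        then show ?thesis by (simp only: continuous_on_const)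
      next
        case 2
        then have "(\<lambda>x. l x u) = (\<lambda>x. x (ix u))" by (simp add: l_def)
        then show ?thesis by (simp only: cx)
      next
        case 3
        then have "(\<lambda>x. l x u) = (\<lambda>x. - (\<Sum>i<n. x i))" by (simp add: l_def)
        then show ?thesis by (simp only:) (rule continuous_on_minus[OF continuous_on_sum[OF cx]])
      qed
    qed
    have cr: "continuous_on (disc n) r"
      unfolding r_def L2_set_def by (rule continuous_on_real_sqrt[OF continuous_on_sum[OF continuous_on_power[OF cx]]])
    have "continuous_on (disc n) a"
    proof (rule continuous_on_coordinatewise_then_product)
      show "continuous_on (disc n) (\<lambda>x. a x u)" for u
        unfolding a_def by (rule continuous_on_add[OF continuous_on_const cl])
    qed
    then have cm: "continuous_on (disc n) m"
      unfolding m_def by (rule continuous_on_gauge)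
    have "continuous_on (disc n) (\<lambda>x. r x / m x * l x v)"
      unfolding continuous_on_def
    proof
      fix x assume x: "x \<in> disc n"
      have tr: "(r \<longlongrightarrow> r x) (at x within disc n)" using cr x by (simp add: continuous_on_def)
      show "((\<lambda>x. r x / m x * l x v) \<longlongrightarrow> r x / m x * l x v) (at x within disc n)"
      proof (cases "r x = 0")
        case True
        have le: "norm (r y / m y * l y v) \<le> r y" for y
        proof (cases "r y = 0")
          case False
          have "r y * \<bar>l y v\<bar> \<le> r y * m y" using l_bound r0 by (intro mult_left_mono)
          then show ?thesis using m_pos[OF False] r0[of y] by (simp add: abs_mult field_simps)
        qed simp
        have "((\<lambda>x. r x / m x * l x v) \<longlongrightarrow> 0) (at x within disc n)"
        proof (rule Lim_null_comparison)
          show "\<forall>\<^sub>F y in at x within disc n. norm (r y / m y * l y v) \<le> r y"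
            by (rule always_eventually) (blast intro: le)
          show "(r \<longlongrightarrow> 0) (at x within disc n)" using tr unfolding True .
        qed
        then show ?thesis using True by simp
      next
        case False
        have "(m \<longlongrightarrow> m x) (at x within disc n)" "((\<lambda>x. l x v) \<longlongrightarrow> l x v) (at x within disc n)"
          using cm cl[of v] x by (auto simp: continuous_on_def)
        then show ?thesis using m_pos[OF False] by (intro tendsto_mult[OF tendsto_divide[OF tr]]) simp_all
      qed
    qed
    then show "continuous_on (disc n) (\<lambda>x. e x v)"
      unfolding e_eq by (rule continuous_on_add[OF continuous_on_const])
  qed
  moreover have "e ` disc n \<subseteq> closed_simplex \<tau>"
    using e_aff e_gauge gauge_closed by (auto simp: mem_disc r_def)
  ultimately have "continuous_map (subtopology (Euclidean_space n) (disc n)) (top_of_set (closed_simplex \<tau>)) e"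
    unfolding disc_topology by auto
  moreover have "e ` (disc n - open_disc n) \<subseteq> closed_simplex \<tau> - open_simplex \<tau>"
  proof -
    have "e x \<in> closed_simplex \<tau> - open_simplex \<tau>" if "x \<in> disc n - open_disc n" for x
    proof -
      have "r x = 1" using that by (auto simp: mem_disc mem_open_disc r_def)
      then show ?thesis unfolding gauge_boundary using e_aff e_gauge by simp
    qed
    then show ?thesis by blast
  qed
  moreover have "inj_on e (open_disc n)"
  proof (rule inj_onI)
    fix x y assume x: "x \<in> open_disc n" and y: "y \<in> open_disc n" and eq: "e x = e y"
    have rr: "r x = r y" using e_gauge eq by metis
    show "x = y"
    proof (cases "r x = 0")
      case True
      have "z i = 0" if "r z = 0" "z \<in> open_disc n" for z i
        using that by (cases "i < n") (auto simp: r_def mem_open_disc L2_set_eq_0_iff)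
      then show ?thesis using True rr x y by (metis ext)
    next
      case False
      define c where "c = m x / m y"
      have mm: "0 < m x" "0 < m y" using m_pos False rr by auto
      then have c: "0 < c" by (simp add: c_def)
      have "x i = c * y i" for i
      proof (cases "i < n")
        case True
        have "l z (g i) = z i" for z using gi[of i] True by (simp add: l_def)
        moreover have "r x / m x * l x (g i) = r y / m y * l y (g i)" using fun_cong[OF eq, of "g i"] by (simp add: e_eq)
        ultimately have "r x * (x i / m x) = r x * (y i / m y)" using rr by simp
        then have "x i / m x = y i / m y" unfolding mult_left_cancel[OF False] .
        then show ?thesis using mm by (simp add: c_def field_simps)
      qed (use x y in \<open>auto simp: mem_open_disc\<close>)
      then have xy: "x = (\<lambda>i. c * y i)" by blast
      then have "r x = c * r y" using r_scale[of c y] c by simp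
      then have "c = 1" using rr False by simp
      then show ?thesis using xy by simp
    qed
  qed
  moreover have "e ` open_disc n = open_simplex \<tau>"
  proof
    show "e ` open_disc n \<subseteq> open_simplex \<tau>"
      using e_aff e_gauge gauge_open by (auto simp: mem_open_disc r_def)
    show "open_simplex \<tau> \<subseteq> e ` open_disc n"
    proof
      fix w assume w: "w \<in> open_simplex \<tau>"
      then have wa: "w \<in> affine_simplex \<tau>" "?g w < 1" using gauge_open by auto
      define y where "y i = (if i < n then w (g i) - b (g i) else 0)" for i
      have ly: "l y v = w v - b v" for v
      proof (cases "v \<in> \<tau>")
        case v: True
        show ?thesis
        proof (cases "ix v < n")
          case True then show ?thesis using ix[OF v] v by (simp add: l_def y_def)
        next
          case False
          then have ixn: "ix v = n" using ix[OF v] by simp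
          have "0 = (\<Sum>u\<in>\<tau>. w u - b u)" using wa center_affine by (simp add: sum_subtractf affine_simplex_def)
          also have "\<dots> = (\<Sum>i\<in>{0..<Suc n}. w (g i) - b (g i))" using sum.reindex_bij_betw[OF g, of "\<lambda>u. w u - b u"] by simp
          also have "\<dots> = (\<Sum>i<n. y i) + (w (g n) - b (g n))" by (simp add: atLeast0LessThan y_def)
          finally show ?thesis using v False ix(2)[OF v] ixn by (simp add: l_def)
        qed
      qed (use wa center_affine in \<open>auto simp: l_def affine_simplex_def\<close>)
      have ay: "a y = w" by (simp add: a_def ly fun_eq_iff)
      then have my: "m y = ?g w" by (simp add: m_def)
      show "w \<in> e ` open_disc n"
      proof (cases "r y = 0")
        case True
        then have "y i = 0" for i by (cases "i < n") (auto simp: r_def L2_set_eq_0_iff y_def)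
        then have "l y v = 0" for v by (simp add: l_def)
        then have "w = e y" using ly True by (simp add: e_eq fun_eq_iff)
        moreover have "y \<in> open_disc n" using True by (simp add: mem_open_disc r_def y_def)
        ultimately show ?thesis by blast
      next
        case False
        define c where "c = m y / r y"
        define x where "x = (\<lambda>i. c * y i)"
        have ry: "0 < r y" using False r0[of y] by simp
        then have c: "0 < c" using m_pos[OF False] by (simp add: c_def)
        have rx: "r x = m y" using r_scale[of c y] c ry by (simp add: x_def c_def)
        have lx: "l x v = c * l y v" for v using l_scale by (simp add: x_def)
        have "a x = ray b c (a y)" by (simp add: a_def ray_def lx fun_eq_iff)
        then have mx: "m x = c * m y" using gauge_ray[of c "a y"] c by (simp add: m_def)
        have "r x / m x * l x v = l y v" for v
          unfolding rx mx lx using c m_pos[OF False] by simp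
        then have "w = e x" using ly by (simp add: e_eq fun_eq_iff)
        moreover have "x \<in> open_disc n"
        proof -
          have "L2_set x {..<n} < 1" using rx my wa(2) by (simp add: r_def)
          then show ?thesis by (simp add: mem_open_disc) (simp add: x_def y_def)
        qed
        ultimately show ?thesis by blast
      qed
    qed
  qed
  ultimately show ?thesis using that by blast
qed

lemma (in cell_complex) finite_CW_complex: "finite_CW_complex T"
proof -
  have card\<tau>: "card (\<tau> j) = Suc (card (\<tau> j) - 1)" if "j \<in> J" for j
    using finite_cell[OF that] cell_nonempty[OF that] by (simp add: card_gt_0_iff)
  let ?n = "\<lambda>j. card (\<tau> j) - 1"
  let ?Q = "\<lambda>j e. continuous_map (subtopology (Euclidean_space (?n j)) (disc (?n j))) (top_of_set (closed_simplex (\<tau> j))) e \<and>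
    inj_on e (open_disc (?n j)) \<and> e ` open_disc (?n j) = open_simplex (\<tau> j) \<and>
    e ` (disc (?n j) - open_disc (?n j)) \<subseteq> closed_simplex (\<tau> j) - open_simplex (\<tau> j)"
  have "\<forall>j. \<exists>e. j \<in> J \<longrightarrow> ?Q j e"
  proof
    fix j
    show "\<exists>e. j \<in> J \<longrightarrow> ?Q j e"
    proof (cases "j \<in> J")
      case True
      show ?thesis
      proof (rule disc_simplex[OF finite_cell[OF True] card\<tau>[OF True]])
        fix e assume "continuous_map (subtopology (Euclidean_space (?n j)) (disc (?n j))) (top_of_set (closed_simplex (\<tau> j))) e"
          "inj_on e (open_disc (?n j))" "e ` open_disc (?n j) = open_simplex (\<tau> j)"
          "e ` (disc (?n j) - open_disc (?n j)) \<subseteq> closed_simplex (\<tau> j) - open_simplex (\<tau> j)"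
        then show ?thesis by (intro exI[of _ e] impI conjI)
      qed
    qed simp
  qed
  from choice[OF this] obtain e where E: "\<forall>j. j \<in> J \<longrightarrow> ?Q j (e j)" by (rule exE)
  have e: "continuous_map (subtopology (Euclidean_space (?n j)) (disc (?n j))) (top_of_set (closed_simplex (\<tau> j))) (e j)"
    "inj_on (e j) (open_disc (?n j))" "e j ` open_disc (?n j) = open_simplex (\<tau> j)"
    "e j ` (disc (?n j) - open_disc (?n j)) \<subseteq> closed_simplex (\<tau> j) - open_simplex (\<tau> j)" if "j \<in> J" for j
    using E[rule_format, OF that, THEN conjunct1] E[rule_format, OF that, THEN conjunct2, THEN conjunct1]
      E[rule_format, OF that, THEN conjunct2, THEN conjunct2, THEN conjunct1]
      E[rule_format, OF that, THEN conjunct2, THEN conjunct2, THEN conjunct2] .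
  obtain g where g: "bij_betw g {0..<card J} J" using ex_bij_betw_nat_finite[OF finite_J] by blast
  have gJ: "g k \<in> J" if "k < card J" for k using bij_betw_apply[OF g] that by simp
  define d where "d k = card (\<tau> (g k)) - 1" for k
  define \<Phi> where "\<Phi> k = \<kappa> (g k) \<circ> e (g k)" for k
  have im: "\<Phi> k ` open_disc (d k) = cell (g k)" if "k < card J" for k
    unfolding \<Phi>_def d_def image_comp[symmetric] e(3)[OF gJ[OF that]] ..
  have 1: "continuous_map (subtopology (Euclidean_space (d k)) (disc (d k))) T (\<Phi> k)" if "k < card J" for k
    unfolding \<Phi>_def d_def by (rule continuous_map_compose[OF e(1)[OF gJ[OF that]] char_cont[OF gJ[OF that]]])
  have 2: "inj_on (\<Phi> k) (open_disc (d k))" if "k < card J" for k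
    unfolding \<Phi>_def d_def
    by (rule comp_inj_on[OF e(2)[OF gJ[OF that]]]) (unfold e(3)[OF gJ[OF that]], rule char_inj[OF gJ[OF that]])
  have 3: "\<Phi> k ` (disc (d k) - open_disc (d k)) \<subseteq> (\<Union>j\<in>{j. j < card J \<and> d j < d k}. \<Phi> j ` open_disc (d j))"
    if k: "k < card J" for k
  proof
    fix y assume "y \<in> \<Phi> k ` (disc (d k) - open_disc (d k))"
    then obtain p where p: "p \<in> disc (d k) - open_disc (d k)" "y = \<kappa> (g k) (e (g k) p)" by (auto simp: \<Phi>_def)
    then have "e (g k) p \<in> closed_simplex (\<tau> (g k)) - open_simplex (\<tau> (g k))"
      using e(4)[OF gJ[OF k]] unfolding d_def by blast
    then obtain i where i: "i \<in> J" "card (\<tau> i) < card (\<tau> (g k))" "y \<in> cell i"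
      using char_boundary[OF gJ[OF k]] p(2) by blast
    then obtain j where j: "j < card J" "g j = i"
      using g unfolding bij_betw_def by (metis atLeastLessThan_iff imageE)
    have "d j < d k" using i(2) card\<tau>[OF i(1)] card\<tau>[OF gJ[OF k]] j(2) by (simp add: d_def)
    then show "y \<in> (\<Union>j\<in>{j. j < card J \<and> d j < d k}. \<Phi> j ` open_disc (d j))"
      using im[OF j(1)] j i(3) by (intro UN_I[of j]) auto
  qed
  have 4: "disjoint_family_on (\<lambda>k. \<Phi> k ` open_disc (d k)) {..<card J}"
    unfolding disjoint_family_on_def
  proof (intro ballI impI)
    fix k l assume kl: "k \<in> {..<card J}" "l \<in> {..<card J}" "k \<noteq> l"
    then have "g k \<noteq> g l" using g by (auto simp: bij_betw_def inj_on_def)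
    then have "cell (g k) \<inter> cell (g l) = {}" using disj gJ kl unfolding disjoint_family_on_def by blast
    then show "\<Phi> k ` open_disc (d k) \<inter> \<Phi> l ` open_disc (d l) = {}" using im kl by simp
  qed
  have 5: "(\<Union>k<card J. \<Phi> k ` open_disc (d k)) = topspace T"
  proof -
    have "(\<Union>k<card J. \<Phi> k ` open_disc (d k)) = (\<Union>k<card J. cell (g k))" using im by simp
    also have "\<dots> = (\<Union>j\<in>g ` {..<card J}. cell j)" by (simp only: image_image)
    also have "g ` {..<card J} = J" using g by (simp add: bij_betw_def atLeast0LessThan)
    finally show ?thesis by (simp only: top)
  qed
  show ?thesis unfolding finite_CW_complex_def
    by (intro conjI hausdorff exI[of _ "card J"] exI[of _ d] exI[of _ \<Phi>] allI impI 1 2 3 4 5)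
qed

lemma cell_structure_glued:
  fixes J :: "('a \<times> 'a set) set" and S T :: "'b topology" and \<gamma> \<Gamma> :: "'a \<Rightarrow> ('a \<Rightarrow> real) \<Rightarrow> 'b"
  assumes S: "cell_structure S J snd (\<lambda>j. \<Gamma> (fst j))" and T: "glued S C L \<gamma> T"
    and cellular: "\<And>x w. x \<in> C \<Longrightarrow> w \<in> realization (L x) \<Longrightarrow> \<gamma> x w \<in> skeleton J snd (\<lambda>j. \<Gamma> (fst j)) (card (supp w))"
    and new: "fst ` J \<inter> C = {}"
  shows "cell_structure T (J \<union> (SIGMA x:C. {\<tau> \<in> simplicial_cone x (L x). x \<in> \<tau>})) snd
    (\<lambda>j. (if fst j \<in> C then \<gamma> else \<Gamma>) (fst j))"
proof -
  interpret S: cell_complex S J snd "\<lambda>j. \<Gamma> (fst j)" by unfold_locales (rule S)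
  interpret T: gluing S C L \<gamma> T by unfold_locales (rule T)
  define N where "N = (SIGMA x:C. {\<tau> \<in> simplicial_cone x (L x). x \<in> \<tau>})"
  define \<kappa> where "\<kappa> = (\<lambda>j :: 'a \<times> 'a set. (if fst j \<in> C then \<gamma> else \<Gamma>) (fst j))"
  have old: "\<kappa> j = \<Gamma> (fst j)" if "j \<in> J" for j
  proof -
    have "fst j \<notin> C" using imageI[OF that, of fst] new by blast
    then show ?thesis by (simp add: \<kappa>_def)
  qed
  have fc: "finite_complex (simplicial_cone x (L x))" if "x \<in> C" for x
    by (rule finite_complex_simplicial_cone[OF pointed_cone.fin[OF T.cone[OF that]]])
  have N: "fst j \<in> C" "snd j \<in> simplicial_cone (fst j) (L (fst j))" "fst j \<in> snd j" "\<kappa> j = \<gamma> (fst j)" "finite (snd j)"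
    if "j \<in> N" for j
  proof -
    show 1: "fst j \<in> C" "snd j \<in> simplicial_cone (fst j) (L (fst j))" "fst j \<in> snd j"
      using that by (auto simp: N_def)
    show "\<kappa> j = \<gamma> (fst j)" using 1 by (simp add: \<kappa>_def)
    show "finite (snd j)" by (rule finite_complexD(1)[OF fc[OF 1(1)] 1(2)])
  qed
  have NI: "(x, \<tau>) \<in> N" if "x \<in> C" "\<tau> \<in> simplicial_cone x (L x)" "x \<in> \<tau>" for x \<tau>
    using that by (auto simp: N_def)
  have closed_con: "closed_simplex (snd j) \<subseteq> T.con (fst j)" if "j \<in> N" for j
    unfolding realization_eq_Union[OF fc[OF N(1)[OF that]]] by (rule UN_upper[OF N(2)[OF that]])
  have open_con: "open_simplex (snd j) \<subseteq> T.con (fst j) - T.base (fst j)" if "j \<in> N" for j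
  proof
    fix w assume w: "w \<in> open_simplex (snd j)"
    then have "w \<in> T.con (fst j)" using closed_con[OF that] open_simplex_closed by blast
    moreover have "w (fst j) \<noteq> 0" using w N(3)[OF that] by (auto simp: open_simplex_def)
    ultimately show "w \<in> T.con (fst j) - T.base (fst j)"
      using pointed_cone.base_iff[OF T.cone[OF N(1)[OF that]]] by blast
  qed
  have con_cell: "(x, supp w) \<in> N \<and> w \<in> open_simplex (supp w)" if x: "x \<in> C" and w: "w \<in> T.con x - T.base x" for x w
  proof -
    have s: "supp w \<in> simplicial_cone x (L x)" "\<forall>v. 0 \<le> w v" "sum w (supp w) = 1"
      using w by (auto simp: mem_realization_iff)
    have "x \<in> supp w" using w pointed_cone.base_iff[OF T.cone[OF x]] by (auto simp: supp_def)
    moreover have "w \<in> open_simplex (supp w)" using s open_simplex_iff_supp finite_complexD(1)[OF fc[OF x]] by blast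
    ultimately show ?thesis using NI x s by blast
  qed
  have oldcell: "\<kappa> j ` open_simplex (snd j) \<subseteq> topspace S" if "j \<in> J" for j
    using old[OF that] S.top that by auto
  have newcell: "\<kappa> j ` open_simplex (snd j) \<inter> topspace S = {}" if "j \<in> N" for j
    using open_con[OF that] T.off[OF N(1)[OF that]] N(4)[OF that] by fastforce
  have finN: "finite N" unfolding N_def
    using T.finite_C fc by (intro finite_SigmaI) (auto simp: finite_complex_def)
  have "cell_structure T (J \<union> N) snd \<kappa>"
    unfolding cell_structure_def
  proof (intro conjI ballI)
    show "Hausdorff_space T" by (rule T.haus)
    show "finite (J \<union> N)" using S.finite_J finN by simp
    fix j assume j: "j \<in> J \<union> N"
    show "finite (snd j)" using j S.finite_cell N(5) by blast
    show "snd j \<noteq> {}" using j S.cell_nonempty N(3) by blast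
    show "continuous_map (top_of_set (closed_simplex (snd j))) T (\<kappa> j)"
    proof (cases "j \<in> J")
      case True
      have "continuous_map (top_of_set (closed_simplex (snd j))) (subtopology T (topspace S)) (\<kappa> j)"
        using S.char_cont[OF True] old[OF True] T.subtop by simp
      then show ?thesis by (rule continuous_map_into_fulltopology)
    next
      case False
      then have j: "j \<in> N" using j by blast
      show ?thesis unfolding N(4)[OF j]
        by (rule continuous_map_from_subtopology_mono[OF T.cont[OF N(1)[OF j]] closed_con[OF j]])
    qed
    show "inj_on (\<kappa> j) (open_simplex (snd j))"
    proof (cases "j \<in> J")
      case True then show ?thesis using S.char_inj old by simp
    next
      case False
      then have j: "j \<in> N" using j by blast
      show ?thesis unfolding N(4)[OF j] by (rule inj_on_subset[OF T.inj[OF N(1)[OF j]] open_con[OF j]])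
    qed
    show "\<kappa> j ` (closed_simplex (snd j) - open_simplex (snd j)) \<subseteq>
      (\<Union>i\<in>{i \<in> J \<union> N. card (snd i) < card (snd j)}. \<kappa> i ` open_simplex (snd i))"
    proof (rule image_subsetI)
      fix w assume w: "w \<in> closed_simplex (snd j) - open_simplex (snd j)"
      show "\<kappa> j w \<in> (\<Union>i\<in>{i \<in> J \<union> N. card (snd i) < card (snd j)}. \<kappa> i ` open_simplex (snd i))"
      proof (cases "j \<in> J")
        case True
        then obtain i where "i \<in> J" "card (snd i) < card (snd j)" "\<Gamma> (fst j) w \<in> \<Gamma> (fst i) ` open_simplex (snd i)"
          using S.char_boundary[OF True w] by blast
        then show ?thesis using old True by (intro UN_I[of i]) auto
      next
        case False
        then have jN: "j \<in> N" using j by blast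
        have ss: "supp w \<subseteq> snd j" "supp w \<noteq> snd j"
          using w closed_simplex_iff_supp[OF N(5)[OF jN]] open_simplex_iff_supp[OF N(5)[OF jN]] by blast+
        then have less: "card (supp w) < card (snd j)" using N(5)[OF jN] by (simp add: psubset_card_mono psubset_eq)
        have wc: "w \<in> T.con (fst j)" using w closed_con[OF jN] by blast
        show ?thesis
        proof (cases "w \<in> T.base (fst j)")
          case True
          then have "\<gamma> (fst j) w \<in> skeleton J snd (\<lambda>j. \<Gamma> (fst j)) (card (supp w))" using cellular N(1)[OF jN] by blast
          then obtain i where "i \<in> J" "card (snd i) \<le> card (supp w)" "\<kappa> j w \<in> \<Gamma> (fst i) ` open_simplex (snd i)"
            unfolding skeleton_def N(4)[OF jN] by blast
          then show ?thesis using old less by (intro UN_I[of i]) auto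
        next
          case False
          then have \<tau>: "(fst j, supp w) \<in> N" "w \<in> open_simplex (supp w)"
            using con_cell[OF N(1)[OF jN]] wc by blast+
          then show ?thesis using less N(4)[OF jN] N(4)[OF \<tau>(1)] by (intro UN_I[of "(fst j, supp w)"]) auto
        qed
      qed
    qed
  next
    show "disjoint_family_on (\<lambda>j. \<kappa> j ` open_simplex (snd j)) (J \<union> N)"
      unfolding disjoint_family_on_def
    proof (intro ballI impI)
      fix i j assume ij: "i \<in> J \<union> N" "j \<in> J \<union> N" "i \<noteq> j"
      consider "i \<in> J" "j \<in> J" | "i \<in> J" "j \<in> N" | "i \<in> N" "j \<in> J" | "i \<in> N" "j \<in> N" using ij by blast
      then show "\<kappa> i ` open_simplex (snd i) \<inter> \<kappa> j ` open_simplex (snd j) = {}"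
      proof cases
        case 1
        then show ?thesis using S.disj ij(3) old unfolding disjoint_family_on_def by simp
      next
        case 2 then show ?thesis using oldcell[of i] newcell[of j] by blast
      next
        case 3 then show ?thesis using oldcell[of j] newcell[of i] by blast
      next
        case 4
        show ?thesis
        proof (cases "fst i = fst j")
          case True
          then have "snd i \<noteq> snd j" using ij(3) by (simp add: prod_eq_iff)
          then have "open_simplex (snd i) \<inter> open_simplex (snd j) = {}"
            using open_simplex_iff_supp[OF N(5)[OF 4(1)]] open_simplex_iff_supp[OF N(5)[OF 4(2)]] by blast
          moreover have "\<gamma> (fst i) ` (open_simplex (snd i) \<inter> open_simplex (snd j)) =
            \<gamma> (fst i) ` open_simplex (snd i) \<inter> \<gamma> (fst i) ` open_simplex (snd j)"
            using open_con[OF 4(2)] True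
            by (intro inj_on_image_Int[OF T.inj[OF N(1)[OF 4(1)]] open_con[OF 4(1)]]) simp
          ultimately show ?thesis unfolding N(4)[OF 4(1)] N(4)[OF 4(2)] using True by simp
        next
          case False
          then have d: "\<gamma> (fst i) ` (T.con (fst i) - T.base (fst i)) \<inter> \<gamma> (fst j) ` (T.con (fst j) - T.base (fst j)) = {}"
            using T.disj N(1) 4 unfolding disjoint_family_on_def by blast
          have s: "\<kappa> k ` open_simplex (snd k) \<subseteq> \<gamma> (fst k) ` (T.con (fst k) - T.base (fst k))" if "k \<in> N" for k
            unfolding N(4)[OF that] by (rule image_mono[OF open_con[OF that]])
          show ?thesis using Int_mono[OF s[OF 4(1)] s[OF 4(2)]] unfolding d by (rule subset_empty[THEN iffD1])
        qed
      qed
    qed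
    have "\<gamma> x ` (T.con x - T.base x) \<subseteq> (\<Union>j\<in>N. \<kappa> j ` open_simplex (snd j))" if x: "x \<in> C" for x
    proof (rule image_subsetI)
      fix w assume "w \<in> T.con x - T.base x"
      then have \<tau>: "(x, supp w) \<in> N" "w \<in> open_simplex (supp w)" using con_cell[OF x] by blast+
      then show "\<gamma> x w \<in> (\<Union>j\<in>N. \<kappa> j ` open_simplex (snd j))" using N(4)[OF \<tau>(1)] by (intro UN_I[of "(x, supp w)"]) auto
    qed
    moreover have "\<kappa> j ` open_simplex (snd j) \<subseteq> (\<Union>x\<in>C. \<gamma> x ` (T.con x - T.base x))" if "j \<in> N" for j
      unfolding N(4)[OF that]
      by (rule subset_trans[OF image_mono[OF open_con[OF that]] UN_upper[OF N(1)[OF that], of "\<lambda>x. \<gamma> x ` (T.con x - T.base x)"]])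
    ultimately have "(\<Union>j\<in>N. \<kappa> j ` open_simplex (snd j)) = (\<Union>x\<in>C. \<gamma> x ` (T.con x - T.base x))"
      by (intro equalityI UN_least)
    moreover have "(\<Union>j\<in>J. \<kappa> j ` open_simplex (snd j)) = topspace S" using S.top old by simp
    ultimately show "topspace T = (\<Union>j\<in>J \<union> N. \<kappa> j ` open_simplex (snd j))"
      unfolding T.top by (simp only: UN_Un)
  qed
  then show ?thesis by (simp add: N_def \<kappa>_def)
qed

section \<open>Gluing subcomplexes\<close>

lemma glued_complexes:
  assumes L': "finite_complex L'" and L0: "finite_complex L0" and C: "finite C"
    and cone: "\<And>x. x \<in> C \<Longrightarrow> pointed_cone x (L x)"
    and union: "L' = L0 \<union> (\<Union>x\<in>C. simplicial_cone x (L x))"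
    and base: "\<And>x. x \<in> C \<Longrightarrow> simplicial_cone x (L x) \<inter> L0 = L x"
    and disj: "\<And>x y. x \<in> C \<Longrightarrow> y \<in> C \<Longrightarrow> x \<noteq> y \<Longrightarrow> simplicial_cone x (L x) \<inter> simplicial_cone y (L y) \<subseteq> L0"
  shows "glued (top_of_set (realization L0)) C L (\<lambda>x w. w) (top_of_set (realization L'))"
proof -
  have mono: "realization A \<subseteq> realization B" if "A \<subseteq> B" for A B :: "'a set set"
    using that by (auto simp: mem_realization_iff)
  have con: "realization (simplicial_cone x (L x)) \<subseteq> realization L'" if "x \<in> C" for x
    using union that by (intro mono) blast
  have sub0: "realization L0 \<subseteq> realization L'" using union by (intro mono) blast
  have bas: "realization (L x) \<subseteq> realization L0" if "x \<in> C" for x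
    using base[OF that] by (intro mono) blast
  have off: "w \<notin> realization L0" if "x \<in> C" "w \<in> realization (simplicial_cone x (L x)) - realization (L x)" for x w
    using base[OF that(1)] that(2) by (auto simp: mem_realization_iff)
  have dj: "(realization (simplicial_cone x (L x)) - realization (L x)) \<inter> (realization (simplicial_cone y (L y)) - realization (L y)) = {}"
    if xy: "x \<in> C" "y \<in> C" "x \<noteq> y" for x y
  proof -
    have False if w: "w \<in> realization (simplicial_cone x (L x)) - realization (L x)" "w \<in> realization (simplicial_cone y (L y))" for w
    proof -
      have "supp w \<in> L0" using disj[OF xy] w by (auto simp: mem_realization_iff)
      then have "w \<in> realization L0" using w by (auto simp: mem_realization_iff)
      then show False using off[OF xy(1) w(1)] by blast
    qed
    then show ?thesis by blast
  qed
  have cov: "realization L' = realization L0 \<union> (\<Union>x\<in>C. realization (simplicial_cone x (L x)) - realization (L x))"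
  proof
    show "realization L' \<subseteq> realization L0 \<union> (\<Union>x\<in>C. realization (simplicial_cone x (L x)) - realization (L x))"
    proof
      fix w assume w: "w \<in> realization L'"
      show "w \<in> realization L0 \<union> (\<Union>x\<in>C. realization (simplicial_cone x (L x)) - realization (L x))"
      proof (cases "supp w \<in> L0")
        case True then show ?thesis using w by (simp add: mem_realization_iff)
      next
        case False
        then obtain x where x: "x \<in> C" "supp w \<in> simplicial_cone x (L x)" using w union by (auto simp: mem_realization_iff)
        then have "w \<in> realization (simplicial_cone x (L x)) - realization (L x)"
          using w False base[OF x(1)] by (auto simp: mem_realization_iff)
        then show ?thesis using x(1) by blast
      qed
    qed
    show "realization L0 \<union> (\<Union>x\<in>C. realization (simplicial_cone x (L x)) - realization (L x)) \<subseteq> realization L'"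
      using sub0 con by blast
  qed
  show ?thesis
    unfolding glued_def
  proof (intro conjI ballI)
    show "compact_space (top_of_set (realization L0))"
      using compact_realization[OF L0] by (simp add: compact_space_subtopology)
    show "Hausdorff_space (top_of_set (realization L'))" by (rule Hausdorff_space_subtopology[OF Hausdorff_space_fun])
    show "subtopology (top_of_set (realization L')) (topspace (top_of_set (realization L0))) = top_of_set (realization L0)"
      using sub0 by (simp add: subtopology_subtopology Int_absorb1)
    show "disjoint_family_on (\<lambda>x. (\<lambda>w. w) ` (realization (simplicial_cone x (L x)) - realization (L x))) C"
      using dj by (simp add: disjoint_family_on_def)
    show "topspace (top_of_set (realization L')) = topspace (top_of_set (realization L0)) \<union>
      (\<Union>x\<in>C. (\<lambda>w. w) ` (realization (simplicial_cone x (L x)) - realization (L x)))"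
      using cov by simp
    fix x assume x: "x \<in> C"
    show "continuous_map (top_of_set (realization (simplicial_cone x (L x)))) (top_of_set (realization L')) (\<lambda>w. w)"
      using con[OF x] by (simp add: continuous_on_id image_subset_iff subset_iff)
    show "(\<lambda>w. w) ` (realization (simplicial_cone x (L x)) - realization (L x)) \<inter> topspace (top_of_set (realization L0)) = {}"
      using off[OF x] by auto
  qed (use C cone sub0 bas in \<open>auto\<close>)
qed

section \<open>Strong deformation retracts\<close>

lemma strong_deformation_retractI:
  assumes F: "continuous_map (prod_topology unit_interval T) T F" and A: "A \<subseteq> topspace T"
    and F0: "\<And>w. w \<in> topspace T \<Longrightarrow> F (0, w) = w" and F1: "\<And>w. w \<in> topspace T \<Longrightarrow> F (1, w) \<in> A"
    and FA: "\<And>t w. t \<in> {0..1} \<Longrightarrow> w \<in> A \<Longrightarrow> F (t, w) = w"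
  shows "A strong_deformation_retract_of T"
  unfolding strong_deformation_retract_of_def
proof (intro conjI exI[of _ "\<lambda>w. F (1, w)"] A)
  show "continuous_map T (subtopology T A) (\<lambda>w. F (1, w))"
    using continuous_map_time_slice[OF F, of 1] F1 by (auto simp: continuous_map_in_subtopology)
  show "homotopic_with (\<lambda>h. \<forall>a\<in>A. h a = a) T T id (\<lambda>w. F (1, w))"
  proof (subst homotopic_with)
    show "(\<forall>a\<in>A. h a = a) = (\<forall>a\<in>A. k a = a)" if "\<And>x. x \<in> topspace T \<Longrightarrow> h x = k x" for h k
      using that A by (metis subsetD)
  qed (use F F0 FA in \<open>auto intro!: exI[of _ F]\<close>)
qed

lemma strong_deformation_retract_refl: "topspace T strong_deformation_retract_of T"
  by (rule strong_deformation_retractI[of _ snd]) (auto intro: continuous_map_snd)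

lemma strong_deformation_retract_trans:
  assumes AB: "A strong_deformation_retract_of top_of_set B" and BD: "B strong_deformation_retract_of top_of_set D"
  shows "A strong_deformation_retract_of top_of_set D"
proof -
  obtain r where r: "continuous_map (top_of_set B) (subtopology (top_of_set B) A) r"
    "homotopic_with (\<lambda>h. \<forall>a\<in>A. h a = a) (top_of_set B) (top_of_set B) id r" and AsubB: "A \<subseteq> B"
    using AB unfolding strong_deformation_retract_of_def by auto
  obtain s where s: "continuous_map (top_of_set D) (subtopology (top_of_set D) B) s"
    "homotopic_with (\<lambda>h. \<forall>a\<in>B. h a = a) (top_of_set D) (top_of_set D) id s" and BsubD: "B \<subseteq> D"
    using BD unfolding strong_deformation_retract_of_def by auto
  have sub: "subtopology (top_of_set D) B = top_of_set B" "subtopology (top_of_set B) A = top_of_set A"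
    "subtopology (top_of_set D) A = top_of_set A"
    using AsubB BsubD by (simp_all add: subtopology_subtopology Int_absorb1)
  have sD: "continuous_map (top_of_set D) (top_of_set B) s" using s(1) by (simp only: sub)
  have rA: "continuous_map (top_of_set B) (top_of_set A) r" using r(1) by (simp only: sub)
  have sB: "\<forall>a\<in>B. s a = a" using homotopic_with_imp_property[OF s(2)] by blast
  have 1: "homotopic_with (\<lambda>h. \<forall>a\<in>A. h a = a) (top_of_set D) (top_of_set D) id s"
    by (rule homotopic_with_mono[OF s(2)]) (use AsubB in blast)
  have "homotopic_with (\<lambda>h. \<forall>a\<in>A. h a = a) (top_of_set D) (top_of_set B) (id \<circ> s) (r \<circ> s)"
    by (rule homotopic_with_compose_continuous_map_right[OF r(2) sD]) (use sB AsubB in \<open>auto simp: subset_iff\<close>)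
  then have "homotopic_with (\<lambda>h. \<forall>a\<in>A. h a = a) (top_of_set D) (top_of_set D) (id \<circ> s) (r \<circ> s)"
    using BsubD by (rule homotopic_with_subset_right)
  then have "homotopic_with (\<lambda>h. \<forall>a\<in>A. h a = a) (top_of_set D) (top_of_set D) id (r \<circ> s)"
    using 1 homotopic_with_trans by fastforce
  moreover have "continuous_map (top_of_set D) (subtopology (top_of_set D) A) (r \<circ> s)"
    unfolding sub by (rule continuous_map_compose[OF sD rA])
  ultimately show ?thesis
    unfolding strong_deformation_retract_of_def using AsubB BsubD by auto
qed

lemma strong_deformation_retract_homotopy_equivalent:
  assumes "A strong_deformation_retract_of top_of_set B"
  shows "top_of_set A homotopy_equivalent_space top_of_set B"
proof -
  obtain r where r: "continuous_map (top_of_set B) (subtopology (top_of_set B) A) r"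
    "homotopic_with (\<lambda>h. \<forall>a\<in>A. h a = a) (top_of_set B) (top_of_set B) id r" and AB: "A \<subseteq> B"
    using assms unfolding strong_deformation_retract_of_def by auto
  have sub: "subtopology (top_of_set B) A = top_of_set A"
    using AB by (simp add: subtopology_subtopology Int_absorb1)
  have "homotopic_with (\<lambda>_. True) (top_of_set B) (top_of_set B) (id \<circ> r) id"
    using homotopic_with_mono[OF r(2), of "\<lambda>_. True"] by (simp add: homotopic_with_symD)
  moreover have "homotopic_with (\<lambda>_. True) (top_of_set A) (top_of_set A) (r \<circ> id) id"
    using homotopic_with_imp_property[OF r(2)]
    by (intro homotopic_with_equal) (use r(1) continuous_map_from_subtopology_mono[OF r(1) AB] sub in auto)
  moreover have "continuous_map (top_of_set A) (top_of_set B) id" using AB by auto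
  ultimately show ?thesis
    unfolding homotopy_equivalent_space_def using r(1) unfolding sub by blast
qed

text \<open>If \<open>h\<close> contracts the base to a point, then the homotopy sends the point of the cone with height
  \<open>s\<close> above \<open>a\<close> at time \<open>u\<close> to the point of height \<open>min s (2 s (1 - u))\<close> above \<open>h (min 1 (2 u s)) a\<close>. At
  \<open>s = 1\<close> this does not depend on \<open>a\<close>: either the new height is \<open>1\<close>, or \<open>h\<close> has reached its endpoint.\<close>

lemma (in pointed_cone) cone_retracts_to_contractible_base:
  assumes contr: "contractible_space (top_of_set B)" and ne: "B \<noteq> {}"
  obtains k where "continuous_map (prod_topology unit_interval (top_of_set K)) (top_of_set K) k"
    "\<And>w. w \<in> K \<Longrightarrow> k (0, w) = w" "\<And>w. w \<in> K \<Longrightarrow> k (1, w) \<in> B"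
    "\<And>u w. u \<in> {0..1} \<Longrightarrow> w \<in> B \<Longrightarrow> k (u, w) = w"
proof -
  obtain p where "homotopic_with (\<lambda>_. True) (top_of_set B) (top_of_set B) id (\<lambda>_. p)"
    using contr unfolding contractible_space_def by blast
  then obtain h where h: "continuous_map (prod_topology unit_interval (top_of_set B)) (top_of_set B) h"
    "\<And>a. h (0, a) = a" "\<And>a. h (1, a) = p"
    unfolding homotopic_with_def by auto
  have hB: "h (t, a) \<in> B" if "t \<in> {0..1}" "a \<in> B" for t a
    using h(1) that by (force simp: continuous_map_def Pi_iff)
  obtain a0 where a0: "a0 \<in> B" using ne by blast
  define ba where "ba w = (if w x = 1 then a0 else cone_base x w)" for w
  define ht where "ht u s = min s (2 * s * (1 - u))" for u s :: real
  define tm where "tm u s = min 1 (2 * u * s)" for u s :: real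
  define F where "F = (\<lambda>(u, s, a). cone_join x (ht u s) (h (tm u s, a)))"
  define k where "k = (\<lambda>(u, w). F (u, w x, ba w))"
  have ht: "ht u s \<in> {0..1}" "tm u s \<in> {0..1}" if "u \<in> {0..1}" "s \<in> {0..1}" for u s
    using that by (auto simp: ht_def tm_def min_def)
  have ba: "ba w \<in> B" if "w \<in> K" for w
    using a0 cone_base_mem[OF that] cone_height[OF that] by (auto simp: ba_def)
  have F1: "F (u, 1, a) = F (u, 1, a')" if "u \<in> {0..1}" for u a a'
  proof (cases "u \<le> 1/2")
    case True
    then have "ht u 1 = 1" by (simp add: ht_def min_def)
    then show ?thesis by (simp add: F_def cone_join_def)
  next
    case False
    then have "tm u 1 = 1" by (simp add: tm_def min_def)
    then show ?thesis by (simp add: F_def h)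
  qed
  have k_join: "k (u, cone_join x s a) = F (u, s, a)" if "u \<in> {0..1}" "s \<in> {0..1}" "a \<in> B" for u s a
  proof (cases "s = 1")
    case True
    have "cone_join x s a x = s" using cone_join_mem(2)[OF that(3)] that(2) by auto
    then show ?thesis using F1[OF that(1)] True by (simp add: k_def)
  next
    case False
    then show ?thesis using cone_join_mem(2,3)[OF that(3), of s] that(2) by (simp add: k_def ba_def)
  qed
  let ?P = "prod_topology unit_interval (prod_topology unit_interval (top_of_set B))"
  have cK: "compact K" by (rule compact_realization[OF finite_complex_simplicial_cone[OF fin]])
  have "continuous_map (prod_topology unit_interval (top_of_set K)) (top_of_set K) k"
  proof (rule continuous_map_from_charts[where I = "{()}" and S = "{}" and P = "\<lambda>_. ?P"
        and \<gamma> = "\<lambda>_ q. (fst q, cone_join x (fst (snd q)) (snd (snd q)))"])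
    show "Hausdorff_space (prod_topology unit_interval (top_of_set K))"
      unfolding Hausdorff_space_prod_topology
      using Hausdorff_unit_interval Hausdorff_space_subtopology[OF Hausdorff_space_fun] by blast
    have cov: "(u, w) \<in> (\<lambda>q. (fst q, cone_join x (fst (snd q)) (snd (snd q)))) ` ({0..1} \<times> {0..1} \<times> B)"
      if u: "u \<in> {0..1}" and w: "w \<in> K" for u w
    proof (rule image_eqI)
      have "w = cone_join x (w x) (ba w)"
      proof (cases "w x = 1")
        case True then show ?thesis using cone_apex_unique[OF w True] by (simp add: cone_join_def)
      next
        case False then show ?thesis using cone_join_base[OF w] cone_height[OF w] by (simp add: ba_def)
      qed
      then show "(u, w) = (fst (u, w x, ba w), cone_join x (fst (snd (u, w x, ba w))) (snd (snd (u, w x, ba w))))" by simp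
      show "(u, w x, ba w) \<in> {0..1} \<times> {0..1} \<times> B" using u cone_height[OF w] ba[OF w] by auto
    qed
    show "topspace (prod_topology unit_interval (top_of_set K)) \<subseteq>
      {} \<union> (\<Union>i\<in>{()}. (\<lambda>q. (fst q, cone_join x (fst (snd q)) (snd (snd q)))) ` topspace ?P)"
    proof
      fix q assume "q \<in> topspace (prod_topology unit_interval (top_of_set K))"
      then have "(fst q, snd q) \<in> (\<lambda>q. (fst q, cone_join x (fst (snd q)) (snd (snd q)))) ` ({0..1} \<times> {0..1} \<times> B)"
        by (intro cov) auto
      then show "q \<in> {} \<union> (\<Union>i\<in>{()}. (\<lambda>q. (fst q, cone_join x (fst (snd q)) (snd (snd q)))) ` topspace ?P)"
        by simp
    qed
    show "compact_space ?P"
      unfolding compact_space_prod_topology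
      using compact_unit_interval compact_realization[OF fin] by (simp add: compact_space_subtopology)
    have "continuous_on ({0..1} \<times> {0..1} \<times> B) (\<lambda>q. cone_join x (fst (snd q)) (snd (snd q)))"
      by (intro continuous_on_cone_join continuous_on_fst continuous_on_snd continuous_on_id)
    then have "continuous_map ?P (top_of_set K) (\<lambda>q. cone_join x (fst (snd q)) (snd (snd q)))"
      using cone_join_mem(1) by auto
    then show "continuous_map ?P (prod_topology unit_interval (top_of_set K)) (\<lambda>q. (fst q, cone_join x (fst (snd q)) (snd (snd q))))"
      by (intro continuous_map_pairedI continuous_map_fst)
    have cht: "continuous_on ({0..1} \<times> {0..1} \<times> B) (\<lambda>q. ht (fst q) (fst (snd q)))"
      unfolding ht_def by (intro continuous_on_min continuous_on_mult continuous_on_diff continuous_on_const continuous_on_fst continuous_on_snd continuous_on_id)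
    have "continuous_on ({0..1} \<times> {0..1} \<times> B) (\<lambda>q. tm (fst q) (fst (snd q)))"
      unfolding tm_def by (intro continuous_on_min continuous_on_mult continuous_on_const continuous_on_fst continuous_on_snd continuous_on_id)
    then have "continuous_map ?P unit_interval (\<lambda>q. tm (fst q) (fst (snd q)))" using ht(2) by auto
    then have "continuous_map ?P (top_of_set B) (\<lambda>q. h (tm (fst q) (fst (snd q)), snd (snd q)))"
      by (rule continuous_map_comp2[OF h(1)]) (rule continuous_map_compose[OF continuous_map_snd continuous_map_snd, unfolded o_def])
    then have "continuous_on ({0..1} \<times> {0..1} \<times> B) (\<lambda>q. h (tm (fst q) (fst (snd q)), snd (snd q)))" by simp
    then have "continuous_on ({0..1} \<times> {0..1} \<times> B) (\<lambda>q. cone_join x (ht (fst q) (fst (snd q))) (h (tm (fst q) (fst (snd q)), snd (snd q))))"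
      by (rule continuous_on_cone_join[OF cht])
    then have "continuous_map ?P (top_of_set K) (\<lambda>q. cone_join x (ht (fst q) (fst (snd q))) (h (tm (fst q) (fst (snd q)), snd (snd q))))"
      using cone_join_mem(1)[OF hB] ht by auto
    then show "continuous_map ?P (top_of_set K) (\<lambda>q. k (fst q, cone_join x (fst (snd q)) (snd (snd q))))"
      by (rule continuous_map_eq) (auto simp: k_join F_def)
  qed auto
  moreover have "k (0, w) = w" if w: "w \<in> K" for w
  proof -
    have "k (0, w) = cone_join x (w x) (ba w)"
      using cone_height[OF w] by (simp add: k_def F_def ht_def tm_def h min_def)
    then show ?thesis
      using cone_join_base[OF w] cone_height[OF w] cone_apex_unique[OF w]
      by (cases "w x = 1") (auto simp: ba_def cone_join_def)
  qed
  moreover have j0: "cone_join x 0 a = a" for a by (simp add: cone_join_def fun_eq_iff)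
  moreover have "k (1, w) \<in> B" if w: "w \<in> K" for w
  proof -
    have "ht 1 (w x) = 0" using cone_height[OF w] by (simp add: ht_def)
    then have "k (1, w) = h (tm 1 (w x), ba w)" by (simp add: k_def F_def j0)
    then show ?thesis using hB ht(2)[of 1 "w x"] cone_height[OF w] ba[OF w] by simp
  qed
  moreover have "k (u, w) = w" if "u \<in> {0..1}" "w \<in> B" for u w
    using k_join[of u 0 w] that by (simp add: j0 F_def ht_def tm_def h)
  ultimately show ?thesis using that by blast
qed

lemma cone_over_contractible_retracts:
  assumes G: "glued (top_of_set (realization L0)) {y} L (\<lambda>_ w. w) (top_of_set (realization L'))"
    and contr: "contractible_space (top_of_set (realization (L y)))" "realization (L y) \<noteq> {}"
  shows "realization L0 strong_deformation_retract_of top_of_set (realization L')"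
proof -
  interpret G: gluing "top_of_set (realization L0)" "{y}" L "\<lambda>_ w. w" "top_of_set (realization L')"
    by unfold_locales (rule G)
  interpret c: pointed_cone y "L y" using G.cone by simp
  obtain k where k: "continuous_map (prod_topology unit_interval (top_of_set c.K)) (top_of_set c.K) k"
    "\<And>w. w \<in> c.K \<Longrightarrow> k (0, w) = w" "\<And>w. w \<in> c.K \<Longrightarrow> k (1, w) \<in> c.B"
    "\<And>u w. u \<in> {0..1} \<Longrightarrow> w \<in> c.B \<Longrightarrow> k (u, w) = w"
    using c.cone_retracts_to_contractible_base[OF contr] by blast
  have sub0: "realization L0 \<subseteq> realization L'" using G.sub by simp
  obtain F where F: "continuous_map (prod_topology unit_interval (top_of_set (realization L'))) (top_of_set (realization L')) F"
    "\<And>z w. z \<in> topspace unit_interval \<Longrightarrow> w \<in> topspace (top_of_set (realization L0)) \<Longrightarrow> F (z, w) = snd (z, w)"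
    "\<And>x z w. x \<in> {y} \<Longrightarrow> z \<in> topspace unit_interval \<Longrightarrow> w \<in> realization (simplicial_cone x (L x)) \<Longrightarrow> F (z, w) = (\<lambda>_. k) x (z, w)"
  proof (rule G.extend_parametric[OF Hausdorff_unit_interval compact_unit_interval, of "top_of_set (realization L')" snd "\<lambda>_. k"])
    show "continuous_map (prod_topology unit_interval (top_of_set (realization L0))) (top_of_set (realization L')) snd"
      by (rule continuous_map_into_subtopology[OF continuous_map_into_fulltopology[OF continuous_map_snd]]) (use sub0 in auto)
    fix x assume "x \<in> {y}"
    then have x: "x = y" by simp
    show "continuous_map (prod_topology unit_interval (realization_top (simplicial_cone x (L x)))) (top_of_set (realization L')) k"
      using continuous_map_compose[OF k(1) G.cont[of y]] unfolding x by (simp add: o_def)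
    fix z w assume "z \<in> topspace unit_interval" "w \<in> realization (L x)"
    then show "k (z, w) = snd (z, w)" using k(4) x by simp
  qed blast
  have cov: "w \<in> realization L0 \<or> w \<in> c.K" if "w \<in> realization L'" for w
    using G.cover that by auto
  have bas: "c.B \<subseteq> realization L0" using G.base[of y] by auto
  show ?thesis
  proof (rule strong_deformation_retractI[OF F(1)])
    fix w assume "w \<in> topspace (top_of_set (realization L'))"
    then consider "w \<in> realization L0" | "w \<in> c.K" using cov by auto
    then show "F (0, w) = w"
    proof cases
      case 1 then show ?thesis using F(2)[of 0 w] by simp
    next
      case 2 then show ?thesis using F(3)[of y 0 w] k(2) by simp
    qed
  next
    fix w assume "w \<in> topspace (top_of_set (realization L'))"
    then consider "w \<in> realization L0" | "w \<in> c.K" using cov by auto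
    then show "F (1, w) \<in> realization L0"
    proof cases
      case 1 then show ?thesis using F(2)[of 1 w] by simp
    next
      case 2
      then have "F (1, w) \<in> c.B" using F(3)[of y 1 w] k(3) by simp
      then show ?thesis using bas by blast
    qed
  qed (use sub0 F(2) in auto)
qed

lemma order_complex_mono: "P \<subseteq> Q \<Longrightarrow> order_complex P \<subseteq> order_complex Q"
  by (auto simp: order_complex_def)

text \<open>Moving the weight at \<open>x\<close> to \<open>y\<close> stays inside the order complex, because every point
  comparable to \<open>x\<close> is comparable to \<open>y\<close>.\<close>

lemma weight_shift_retract:
  fixes x y :: "'a::order"
  assumes P: "finite P" and xy: "x < y" and xP: "x \<notin> P" and above: "\<And>z. z \<in> P \<Longrightarrow> \<not> x < z"
  shows "realization (order_complex (insert y P)) strong_deformation_retract_of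
    top_of_set (realization (order_complex (insert x (insert y P))))"
proof -
  let ?X1 = "insert x (insert y P)" and ?X0 = "insert y P"
  let ?K1 = "realization (order_complex ?X1)" and ?K0 = "realization (order_complex ?X0)"
  define F where "F = (\<lambda>(t :: real, w :: 'a \<Rightarrow> real). \<lambda>v. if v = x then (1 - t) * w x else if v = y then w y + t * w x else w v)"
  have fc: "finite_complex (order_complex ?X1)" using P by (intro finite_complex_order_complex) simp
  have id: "F (t, w) = w" if "w x = 0" for t w using that by (auto simp: F_def fun_eq_iff)
  have mem: "F (t, w) \<in> ?K1" if t: "t \<in> {0..1}" and w: "w \<in> ?K1" for t w
  proof (cases "w x = 0")
    case True then show ?thesis using id w by simp
  next
    case False
    define c where "c = supp w"
    have c: "c \<subseteq> ?X1" "finite c" "Complete_Partial_Order.chain (\<le>) c" and nn: "\<And>v. 0 \<le> w v" and s1: "sum w c = 1"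
      using w by (auto simp: mem_realization_iff order_complex_def c_def)
    have xc: "x \<in> c" using False by (simp add: c_def supp_def)
    have le: "z \<le> y" if z: "z \<in> c" for z
    proof -
      have "z \<le> x \<or> x \<le> z" using chainD[OF c(3) z xc] .
      then consider "z \<le> x" | "x < z" by (auto simp: order.order_iff_strict)
      then show ?thesis
      proof cases
        case 1 then show ?thesis using xy by (meson less_imp_le order_trans)
      next
        case 2
        then have "z \<notin> P" "z \<noteq> x" using above by auto
        then show ?thesis using z c(1) by auto
      qed
    qed
    have "Complete_Partial_Order.chain (\<le>) (insert y c)"
    proof (rule chainI)
      fix a b assume "a \<in> insert y c" "b \<in> insert y c"
      then show "a \<le> b \<or> b \<le> a" using chainD[OF c(3), of a b] le[of a] le[of b] by auto
    qed
    then have c': "insert y c \<in> order_complex ?X1" using c by (simp add: order_complex_def)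
    have "F (t, w) \<in> closed_simplex (insert y c)"
      unfolding closed_simplex_def
    proof (intro CollectI conjI allI impI)
      show "0 \<le> F (t, w) v" for v using nn[of v] nn[of x] t by (auto simp: F_def)
      show "F (t, w) v = 0" if "v \<notin> insert y c" for v
        using that xc by (auto simp: F_def c_def supp_def)
      have fin: "finite (insert y c)" "x \<in> insert y c" "y \<in> insert y c - {x}" using c xc xy by auto
      have split: "sum g (insert y c) = g x + (g y + sum g (insert y c - {x} - {y}))" for g :: "'a \<Rightarrow> real"
        using sum.remove[OF fin(1,2), of g] sum.remove[OF _ fin(3), of g] fin(1) by simp
      have "sum (F (t, w)) (insert y c - {x} - {y}) = sum w (insert y c - {x} - {y})"
        by (intro sum.cong) (auto simp: F_def)
      moreover have "F (t, w) x + F (t, w) y = w x + w y" using xy by (simp add: F_def algebra_simps)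
      ultimately have "sum (F (t, w)) (insert y c) = sum w (insert y c)" unfolding split[of "F (t, w)"] split[of w] by linarith
      also have "\<dots> = 1" using sum_supp[of "insert y c" w] c(2) s1 by (simp add: c_def subset_insertI)
      finally show "sum (F (t, w)) (insert y c) = 1" .
    qed
    then show ?thesis unfolding realization_eq_Union[OF fc] using c' by blast
  qed
  have sub: "?K0 \<subseteq> ?K1" using order_complex_mono[of ?X0 ?X1, OF subset_insertI] by (auto simp: mem_realization_iff)
  have x0: "w x = 0" if "w \<in> ?K0" for w
    using that xP xy by (auto simp: mem_realization_iff order_complex_def supp_def)
  show ?thesis
  proof (rule strong_deformation_retractI)
    have "continuous_on ({0..1} \<times> ?K1) F"
    proof (rule continuous_on_coordinatewise_then_product)
      fix v
      have e: "continuous_on ({0..1::real} \<times> ?K1) (\<lambda>p. snd p u)" for u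
        by (rule continuous_on_coordinate[OF continuous_on_snd[OF continuous_on_id]])
      have f: "continuous_on ({0..1} \<times> ?K1) (\<lambda>p. fst p)" by (rule continuous_on_fst[OF continuous_on_id])
      consider "v = x" | "v \<noteq> x" "v = y" | "v \<noteq> x" "v \<noteq> y" by blast
      then show "continuous_on ({0..1} \<times> ?K1) (\<lambda>p. F p v)"
      proof cases
        case 1
        then have "(\<lambda>p. F p v) = (\<lambda>p. (1 - fst p) * snd p x)" by (auto simp: F_def)
        then show ?thesis by (simp only:) (rule continuous_on_mult[OF continuous_on_diff[OF continuous_on_const f] e])
      next
        case 2
        then have "(\<lambda>p. F p v) = (\<lambda>p. snd p y + fst p * snd p x)" by (auto simp: F_def)
        then show ?thesis by (simp only:) (rule continuous_on_add[OF e continuous_on_mult[OF f e]])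
      next
        case 3
        then have "(\<lambda>p. F p v) = (\<lambda>p. snd p v)" by (auto simp: F_def)
        then show ?thesis by (simp only:) (rule e)
      qed
    qed
    then show "continuous_map (prod_topology unit_interval (top_of_set ?K1)) (top_of_set ?K1) F"
      using mem by auto
    show "?K0 \<subseteq> topspace (top_of_set ?K1)" using sub by simp
    show "F (0, w) = w" for w by (auto simp: F_def fun_eq_iff)
    show "F (t, w) = w" if "w \<in> ?K0" for t w by (rule id[of w t, OF x0[OF that]])
    fix w assume "w \<in> topspace (top_of_set ?K1)"
    then have "F (1, w) \<in> ?K1" using mem[of 1 w] by simp
    moreover have "x \<notin> supp (F (1, w))" by (simp add: supp_def F_def)
    ultimately show "F (1, w) \<in> ?K0"
      by (auto simp: mem_realization_iff order_complex_def)
  qed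
qed

lemma pointed_cone_order_complex:
  assumes "finite P" "x \<notin> P"
  shows "pointed_cone x (order_complex P)"
proof
  show "finite_complex (order_complex P)" by (rule finite_complex_order_complex[OF assms(1)])
  show "x \<notin> \<Union> (order_complex P)" using assms(2) by (auto simp: order_complex_def)
qed

lemma order_complex_insert:
  assumes "c \<in> order_complex {z\<in>P. z < x}"
  shows "insert x c \<in> order_complex (insert x P)"
proof -
  have c: "c \<subseteq> P" "\<And>z. z \<in> c \<Longrightarrow> z < x" "finite c" "Complete_Partial_Order.chain (\<le>) c"
    using assms by (auto simp: order_complex_def)
  have "Complete_Partial_Order.chain (\<le>) (insert x c)"
  proof (rule chainI)
    fix a b assume "a \<in> insert x c" "b \<in> insert x c"
    then show "a \<le> b \<or> b \<le> a" using chainD[OF c(4), of a b] c(2)[of a] c(2)[of b] by auto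
  qed
  then show ?thesis using c by (auto simp: order_complex_def)
qed

context
  fixes P C :: "'a::order set"
  assumes disjoint: "C \<inter> P = {}" and maximal: "\<And>x z. x \<in> C \<Longrightarrow> z \<in> P \<Longrightarrow> \<not> x < z"
    and antichain: "\<And>x y. x \<in> C \<Longrightarrow> y \<in> C \<Longrightarrow> \<not> x < y"
begin

lemma order_complex_add_antichain:
  "order_complex (P \<union> C) = order_complex P \<union> (\<Union>x\<in>C. simplicial_cone x (order_complex {z\<in>P. z < x}))"
proof (intro equalityI subsetI)
  fix c assume c: "c \<in> order_complex (P \<union> C)"
  then have c': "c \<subseteq> P \<union> C" "finite c" "c \<noteq> {}" "Complete_Partial_Order.chain (\<le>) c" by (auto simp: order_complex_def)
  show "c \<in> order_complex P \<union> (\<Union>x\<in>C. simplicial_cone x (order_complex {z\<in>P. z < x}))"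
  proof (cases "c \<inter> C = {}")
    case True
    then have "c \<subseteq> P" using c'(1) by blast
    then have "c \<in> order_complex P" using c by (simp add: order_complex_def)
    then show ?thesis by simp
  next
    case False
    then obtain x where x: "x \<in> c" "x \<in> C" by blast
    have below: "z \<in> {z\<in>P. z < x}" if z: "z \<in> c - {x}" for z
    proof -
      have "z \<le> x \<or> x \<le> z" using chainD[OF c'(4), of z x] z x by blast
      then have "z < x \<or> x < z" using z by (auto simp: order.order_iff_strict)
      moreover have "z \<in> P \<or> z \<in> C" using z c'(1) by blast
      ultimately show ?thesis using maximal[OF x(2), of z] antichain[OF x(2), of z] antichain[of z x] x(2) by blast
    qed
    have "c \<in> simplicial_cone x (order_complex {z\<in>P. z < x})"
    proof (cases "c = {x}")
      case True then show ?thesis by (simp add: simplicial_cone_def)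
    next
      case False
      then have "c - {x} \<noteq> {}" using x(1) by blast
      moreover have "Complete_Partial_Order.chain (\<le>) (c - {x})" using chain_subset[OF c'(4)] by blast
      ultimately have "c - {x} \<in> order_complex {z\<in>P. z < x}"
        using below c'(2) by (simp add: order_complex_def subset_iff)
      moreover have "c = insert x (c - {x})" using x(1) by blast
      ultimately show ?thesis unfolding simplicial_cone_def by blast
    qed
    then show ?thesis using x(2) by blast
  qed
next
  fix c assume "c \<in> order_complex P \<union> (\<Union>x\<in>C. simplicial_cone x (order_complex {z\<in>P. z < x}))"
  then consider "c \<in> order_complex P" | x where "x \<in> C" "c \<in> simplicial_cone x (order_complex {z\<in>P. z < x})" by blast
  then show "c \<in> order_complex (P \<union> C)"
  proof cases
    case 1 then show ?thesis using order_complex_mono[of P "P \<union> C"] by blast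
  next
    case 2
    then consider "c = {x}" | "c \<in> order_complex {z\<in>P. z < x}" | c' where "c' \<in> order_complex {z\<in>P. z < x}" "c = insert x c'"
      by (auto simp: simplicial_cone_def)
    then show ?thesis
    proof cases
      case 1 then show ?thesis using \<open>x \<in> C\<close> by (simp add: order_complex_def chain_def)
    next
      case 2
      then show ?thesis using order_complex_mono[of "{z\<in>P. z < x}" "P \<union> C"] by blast
    next
      case 3
      then have "c \<in> order_complex (insert x P)" using order_complex_insert by blast
      then show ?thesis using order_complex_mono[of "insert x P" "P \<union> C"] \<open>x \<in> C\<close> by blast
    qed
  qed
qed

lemma cone_Int_order_complex:
  assumes "x \<in> C"
  shows "simplicial_cone x (order_complex {z\<in>P. z < x}) \<inter> order_complex P = order_complex {z\<in>P. z < x}"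
proof -
  have "x \<notin> P" using assms disjoint by blast
  then have "x \<notin> c" if "c \<in> order_complex P" for c using that by (auto simp: order_complex_def)
  moreover have "order_complex {z\<in>P. z < x} \<subseteq> order_complex P" by (rule order_complex_mono) blast
  ultimately show ?thesis by (auto simp: simplicial_cone_def)
qed

lemma cone_Int_cone:
  assumes "x \<in> C" "y \<in> C" "x \<noteq> y"
  shows "simplicial_cone x (order_complex {z\<in>P. z < x}) \<inter> simplicial_cone y (order_complex {z\<in>P. z < y}) \<subseteq> order_complex P"
proof
  fix c assume c: "c \<in> simplicial_cone x (order_complex {z\<in>P. z < x}) \<inter> simplicial_cone y (order_complex {z\<in>P. z < y})"
  have "c \<subseteq> insert y P" using c by (auto simp: simplicial_cone_def order_complex_def)
  moreover have "x \<notin> P" using assms disjoint by blast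
  ultimately have "x \<notin> c" using assms(3) by blast
  then have "c \<in> order_complex {z\<in>P. z < x}" using c by (auto simp: simplicial_cone_def)
  then show "c \<in> order_complex P" using order_complex_mono[of "{z\<in>P. z < x}" P] by blast
qed

lemma glued_order_complex:
  assumes "finite P" "finite C" and L: "\<And>x. x \<in> C \<Longrightarrow> L x = order_complex {z\<in>P. z < x}"
  shows "glued (top_of_set (realization (order_complex P))) C L (\<lambda>x w. w)
    (top_of_set (realization (order_complex (P \<union> C))))"
proof (rule glued_complexes[OF finite_complex_order_complex finite_complex_order_complex assms(2)])
  have "(\<Union>x\<in>C. simplicial_cone x (L x)) = (\<Union>x\<in>C. simplicial_cone x (order_complex {z\<in>P. z < x}))"
    by (rule SUP_cong[OF refl]) (simp add: L)
  then show "order_complex (P \<union> C) = order_complex P \<union> (\<Union>x\<in>C. simplicial_cone x (L x))"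
    by (simp only: order_complex_add_antichain)
qed (simp_all add: assms(1,2) L pointed_cone_order_complex cone_Int_order_complex cone_Int_cone)

end

lemma pair_collapse:
  fixes x y :: "'a::order"
  assumes P: "finite P" and xy: "x < y" and notin: "x \<notin> P" "y \<notin> P"
    and above: "\<And>z. z \<in> P \<Longrightarrow> \<not> x < z" "\<And>z. z \<in> P \<Longrightarrow> \<not> y < z"
    and triv: "homotopically_trivial {z\<in>P. z < y}"
  shows "realization (order_complex P) strong_deformation_retract_of
    top_of_set (realization (order_complex (insert x (insert y P))))"
proof (rule strong_deformation_retract_trans)
  have G: "glued (top_of_set (realization (order_complex P))) {y} (\<lambda>x. order_complex {z\<in>P. z < x}) (\<lambda>x w. w)
    (top_of_set (realization (order_complex (P \<union> {y}))))"
    by (rule glued_order_complex) (use assms in auto)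
  obtain z where z: "z \<in> {z\<in>P. z < y}" using triv by (auto simp: homotopically_trivial_def)
  have "{z} \<in> order_complex {z\<in>P. z < y}" using z by (simp add: order_complex_def chain_def)
  then have "barycenter {z} \<in> realization (order_complex {z\<in>P. z < y})"
    unfolding mem_realization_iff
    using open_simplex_iff_supp[of "{z}" "barycenter {z}", THEN iffD1, OF _ barycenter_mem] by auto
  then show "realization (order_complex P) strong_deformation_retract_of top_of_set (realization (order_complex (insert y P)))"
    using triv by (intro cone_over_contractible_retracts[OF G[simplified Un_insert_right Un_empty_right]]) (auto simp: homotopically_trivial_def)
  show "realization (order_complex (insert y P)) strong_deformation_retract_of
    top_of_set (realization (order_complex (insert x (insert y P))))"
    by (rule weight_shift_retract[OF P xy notin(1) above(1)])
qed

section \<open>The filtration\<close>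

lemma morse_function_strict_mono:
  assumes X: "finite X" and f: "morse_function X f" and xy: "x \<in> X" "y \<in> X" "x < y"
  shows "f x < f y"
  using xy
proof (induction "card {z\<in>X. x < z \<and> z < y}" arbitrary: x y rule: less_induct)
  case less
  show ?case
  proof (cases "\<exists>z\<in>X. x < z \<and> z < y")
    case False
    then have "(x, y) \<in> hasse X" using less.prems by (simp add: hasse_def)
    then show ?thesis using f by (auto simp: morse_function_def)
  next
    case True
    then obtain z where z: "z \<in> X" "x < z" "z < y" by blast
    have fin: "finite {u\<in>X. x < u \<and> u < y}" using X by simp
    have "{u\<in>X. x < u \<and> u < z} \<subset> {u\<in>X. x < u \<and> u < y}" using z by (auto intro: less_trans)
    moreover have "{u\<in>X. z < u \<and> u < y} \<subset> {u\<in>X. x < u \<and> u < y}" using z by (auto intro: less_trans)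
    ultimately have "f x < f z" "f z < f y"
      using less.hyps[of x z] less.hyps[of z y] less.prems z psubset_card_mono[OF fin] by auto
    then show ?thesis by simp
  qed
qed

locale morse_filtration =
  fixes X :: "'a::order set" and f :: "'a \<Rightarrow> real" and M :: "('a \<times> 'a) set"
    and t :: "nat \<Rightarrow> real" and r :: nat and C :: "nat \<Rightarrow> 'a set"
  assumes fin: "finite X" and morse: "morse_function X f" and morse_matching: "morse_matching X M"
    and admissible: "admissible_matching X f M" and t_mono: "strict_mono_on {..r} t" and t_range: "t ` {..r} = f ` X"
    and C: "\<And>i. C i = {x \<in> critical_points X M. f x = t i}"
begin

definition Xs :: "nat \<Rightarrow> 'a set" where
  "Xs i = {x \<in> X. f x \<le> t i \<and> \<not> (f x = t i \<and> (\<exists>y. (x, y) \<in> M))}"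

definition level_pairs :: "nat \<Rightarrow> ('a \<times> 'a) set" where
  "level_pairs i = {e \<in> M. f (fst e) = t i}"

definition Xt :: "int \<Rightarrow> 'a set" where
  "Xt n = (if n < 0 then {} else Xs (nat n) \<union> fst ` level_pairs (nat n) \<union> snd ` level_pairs (nat n))"

lemma f_mono: "x \<in> X \<Longrightarrow> y \<in> X \<Longrightarrow> x < y \<Longrightarrow> f x < f y"
  by (rule morse_function_strict_mono[OF fin morse])

lemma t_less: "i \<le> r \<Longrightarrow> j \<le> r \<Longrightarrow> t i < t j \<longleftrightarrow> i < j"
  using t_mono by (simp add: strict_mono_on_less)

lemma t_eq: "i \<le> r \<Longrightarrow> j \<le> r \<Longrightarrow> t i = t j \<longleftrightarrow> i = j"
  using t_mono by (simp add: strict_mono_on_eq)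

lemma level: "x \<in> X \<Longrightarrow> \<exists>i\<le>r. f x = t i"
  using t_range by (metis atMost_iff image_iff)

lemma attained: "i \<le> r \<Longrightarrow> \<exists>x\<in>X. f x = t i"
  using t_range by (metis atMost_iff image_iff)

lemma M_hasse: "M \<subseteq> hasse X"
  using morse_matching by (simp add: morse_matching_def matching_def)

lemma finite_M: "finite M"
proof (rule finite_subset)
  show "M \<subseteq> X \<times> X" using M_hasse by (auto simp: hasse_def)
qed (use fin in simp)

lemma M_unique:
  assumes "e \<in> M" "e' \<in> M" "fst e = fst e' \<or> fst e = snd e' \<or> snd e = fst e' \<or> snd e = snd e'"
  shows "e = e'"
proof -
  have m: "\<And>x e e'. x \<in> X \<Longrightarrow> e \<in> M \<Longrightarrow> e' \<in> M \<Longrightarrow> incident x e \<Longrightarrow> incident x e' \<Longrightarrow> e = e'"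
    using morse_matching by (auto simp: morse_matching_def matching_def)
  have "fst e \<in> X" "snd e \<in> X" using assms(1) M_hasse by (auto simp: hasse_def)
  then show ?thesis using m[of "fst e" e e'] m[of "snd e" e e'] assms by (auto simp: incident_def)
qed

lemma M_levels:
  assumes "(x, y) \<in> M"
  shows "x \<in> X" "y \<in> X" "x < y" "\<exists>i<r. f x = t i \<and> f y = t (Suc i)"
proof -
  show X: "x \<in> X" "y \<in> X" "x < y" using assms M_hasse by (auto simp: hasse_def)
  obtain i j where ij: "i \<le> r" "f x = t i" "j \<le> r" "f y = t j" using level X by metis
  have "i < j" using f_mono[OF X] ij t_less by simp
  have "j = Suc i"
  proof (rule ccontr)
    assume "j \<noteq> Suc i"
    then have s: "Suc i < j" using \<open>i < j\<close> by simp
    then obtain z where z: "z \<in> X" "f z = t (Suc i)" using attained[of "Suc i"] ij by auto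
    then have "f x < f z \<and> f z < f y" using s ij t_less by simp
    moreover have "admissible_edge X f (x, y)" using admissible assms by (simp add: admissible_matching_def)
    ultimately show False using z(1) by (auto simp: admissible_edge_def)
  qed
  then show "\<exists>i<r. f x = t i \<and> f y = t (Suc i)" using ij by (intro exI[of _ i]) auto
qed

lemma level_pair:
  assumes "i \<le> r" "e \<in> level_pairs i"
  shows "e \<in> M" "fst e \<in> X" "snd e \<in> X" "fst e < snd e" "i < r" "f (fst e) = t i" "f (snd e) = t (Suc i)"
proof -
  have e: "(fst e, snd e) \<in> M" "f (fst e) = t i" using assms by (auto simp: level_pairs_def)
  obtain j where j: "j < r" "f (fst e) = t j" "f (snd e) = t (Suc j)" using M_levels(4)[OF e(1)] by blast
  then have "j = i" using e(2) t_eq[of i j] assms(1) by simp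
  then show "i < r" "f (snd e) = t (Suc i)" using j by auto
  show "e \<in> M" "fst e \<in> X" "snd e \<in> X" "fst e < snd e" "f (fst e) = t i" using e M_levels(1-3)[OF e(1)] by auto
qed

lemma below_in_Xt:
  assumes "i \<le> r" "x \<in> X" "f x < t i"
  shows "x \<in> Xt (int i - 1)"
proof -
  obtain j where j: "j \<le> r" "f x = t j" using level assms by blast
  then have ji: "j < i" using assms t_less by simp
  have "i - 1 \<le> r" using assms(1) by simp
  then have "f x \<le> t (i - 1)"
    using j(2) t_less[OF j(1), of "i - 1"] ji by (cases "j = i - 1") auto
  then have "x \<in> Xs (i - 1) \<or> (f x = t (i - 1) \<and> (\<exists>y. (x, y) \<in> M))" using assms(2) by (auto simp: Xs_def)
  then have "x \<in> Xs (i - 1) \<union> fst ` level_pairs (i - 1)"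
    by (auto simp: level_pairs_def image_iff)
  moreover have "nat (int i - 1) = i - 1" "\<not> int i - 1 < 0" using ji by auto
  ultimately show ?thesis by (simp add: Xt_def)
qed

lemma Xt_level:
  assumes "i \<le> r" "x \<in> Xt (int i - 1)"
  shows "x \<in> X" "f x \<le> t i" "f x = t i \<Longrightarrow> \<exists>z. (z, x) \<in> M"
proof -
  have i: "0 < i" using assms(2) by (auto simp: Xt_def split: if_splits)
  then have n: "nat (int i - 1) = i - 1" "i - 1 \<le> r" "Suc (i - 1) = i" using assms(1) by auto
  have tt: "t (i - 1) < t i" using t_less[of "i - 1" i] i assms(1) by simp
  consider "x \<in> Xs (i - 1)" | e where "e \<in> level_pairs (i - 1)" "x = fst e" | e where "e \<in> level_pairs (i - 1)" "x = snd e"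
    using assms(2) i by (auto simp: Xt_def n)
  then have "x \<in> X \<and> f x \<le> t i \<and> (f x = t i \<longrightarrow> (\<exists>z. (z, x) \<in> M))"
  proof cases
    case 1 then show ?thesis using tt by (auto simp: Xs_def)
  next
    case 2 then show ?thesis using tt level_pair[OF n(2) 2(1)] by auto
  next
    case 3
    then have "(fst e, x) \<in> M" using level_pair(1)[OF n(2) 3(1)] by simp
    moreover have "f x = t i" "x \<in> X" using 3(2) level_pair[OF n(2) 3(1)] n(3) by auto
    ultimately show ?thesis by auto
  qed
  then show "x \<in> X" "f x \<le> t i" "f x = t i \<Longrightarrow> \<exists>z. (z, x) \<in> M" by auto
qed

lemma C_mem: "x \<in> C i \<longleftrightarrow> x \<in> X \<and> f x = t i \<and> (\<forall>y. (x, y) \<notin> M) \<and> (\<forall>z. (z, x) \<notin> M)"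
  by (auto simp: C critical_points_def incident_def)

lemma Xs_eq:
  assumes i: "i \<le> r"
  shows "Xs i = Xt (int i - 1) \<union> C i"
proof (intro equalityI subsetI)
  fix x assume x: "x \<in> Xs i"
  show "x \<in> Xt (int i - 1) \<union> C i"
  proof (cases "f x = t i")
    case False
    then have "f x < t i" "x \<in> X" using x by (auto simp: Xs_def)
    then show ?thesis using below_in_Xt[OF i] by blast
  next
    case True
    then have xX: "x \<in> X" and ns: "\<forall>y. (x, y) \<notin> M" using x by (auto simp: Xs_def)
    show ?thesis
    proof (cases "\<exists>z. (z, x) \<in> M")
      case False then show ?thesis using True xX ns C_mem by simp
    next
      case T: True
      then obtain z where z: "(z, x) \<in> M" by blast
      obtain j where j: "j < r" "f z = t j" "f x = t (Suc j)" using M_levels(4)[OF z] by blast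
      then have "Suc j = i" using True t_eq[of "Suc j" i] i by simp
      then have "x \<in> snd ` level_pairs (i - 1)" using z j(2) by (force simp: level_pairs_def)
      moreover have "nat (int i - 1) = i - 1" "\<not> int i - 1 < 0" using \<open>Suc j = i\<close> by auto
      ultimately show ?thesis by (simp add: Xt_def)
    qed
  qed
next
  fix x assume "x \<in> Xt (int i - 1) \<union> C i"
  then show "x \<in> Xs i"
  proof
    assume x: "x \<in> C i" then show ?thesis by (simp add: C_mem Xs_def)
  next
    assume x: "x \<in> Xt (int i - 1)"
    have "\<not> (f x = t i \<and> (\<exists>y. (x, y) \<in> M))"
    proof
      assume a: "f x = t i \<and> (\<exists>y. (x, y) \<in> M)"
      then obtain y z where "(x, y) \<in> M" "(z, x) \<in> M" using Xt_level(3)[OF i x] by blast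
      then show False using M_unique[of "(x, y)" "(z, x)"] M_levels(3)[of x y] by auto
    qed
    then show ?thesis using Xt_level(1,2)[OF i x] by (simp add: Xs_def)
  qed
qed

lemma Xt_int: "Xt (int i) = Xs i \<union> (fst ` level_pairs i \<union> snd ` level_pairs i)"
  by (simp add: Xt_def Un_assoc)

lemma Xs_r: "Xs r = X"
proof -
  have "f x \<le> t r \<and> \<not> (f x = t r \<and> (\<exists>y. (x, y) \<in> M))" if x: "x \<in> X" for x
  proof
    obtain j where j: "j \<le> r" "f x = t j" using level[OF x] by blast
    then show "f x \<le> t r" using t_less[of j r] by (cases "j = r") auto
    show "\<not> (f x = t r \<and> (\<exists>y. (x, y) \<in> M))"
    proof
      assume a: "f x = t r \<and> (\<exists>y. (x, y) \<in> M)"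
      then obtain y j where "j < r" "f x = t j" using M_levels(4) by blast
      then show False using a t_eq[of r j] by simp
    qed
  qed
  then show ?thesis by (auto simp: Xs_def)
qed

lemma descending_link_eq:
  assumes "i \<le> r" "x \<in> C i"
  shows "descending_link X x = {z \<in> Xt (int i - 1). z < x}"
proof (intro equalityI subsetI)
  fix z assume "z \<in> descending_link X x"
  then have z: "z \<in> X" "z < x" by (auto simp: descending_link_def)
  then have "f z < t i" using f_mono[of z x] assms(2) by (simp add: C_mem)
  then show "z \<in> {z \<in> Xt (int i - 1). z < x}" using below_in_Xt[OF assms(1) z(1)] z(2) by simp
next
  fix z assume "z \<in> {z \<in> Xt (int i - 1). z < x}"
  then show "z \<in> descending_link X x" using Xt_level(1)[OF assms(1)] by (simp add: descending_link_def)
qed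

lemma attach_facts:
  assumes i: "i \<le> r"
  shows "C i \<inter> Xt (int i - 1) = {}" "x \<in> C i \<Longrightarrow> z \<in> Xt (int i - 1) \<Longrightarrow> \<not> x < z"
    "x \<in> C i \<Longrightarrow> y \<in> C i \<Longrightarrow> \<not> x < y" "finite (Xt (int i - 1))" "finite (C i)"
proof -
  show "C i \<inter> Xt (int i - 1) = {}" using Xt_level(3)[OF i] C_mem by blast
  show "\<not> x < z" if "x \<in> C i" "z \<in> Xt (int i - 1)"
    using f_mono[of x z] that Xt_level(1,2)[OF i that(2)] by (auto simp: C_mem)
  show "\<not> x < y" if "x \<in> C i" "y \<in> C i" using f_mono[of x y] that by (auto simp: C_mem)
  have "Xt (int i - 1) \<subseteq> X" using Xt_level(1)[OF i] by blast
  then show "finite (Xt (int i - 1))" using fin by (rule finite_subset)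
  have "C i \<subseteq> X" by (auto simp: C_mem)
  then show "finite (C i)" using fin by (rule finite_subset)
qed

text \<open>If \<open>x < y'\<close> for two pairs \<open>(x, y)\<close>, \<open>(x', y')\<close> of the same level, then \<open>y', x, y\<close> is a path in the
  Hasse diagram modified by \<open>M\<close>. Acyclicity therefore provides a pair that can be removed first.\<close>

lemma level_pairs_extremal:
  assumes i: "i \<le> r" and Q: "Q \<subseteq> level_pairs i" "Q \<noteq> {}"
  obtains e where "e \<in> Q" "\<And>e'. e' \<in> Q \<Longrightarrow> e' \<noteq> e \<Longrightarrow> \<not> fst e < snd e'"
proof -
  define R where "R = {(e, e'). e \<in> Q \<and> e' \<in> Q \<and> e \<noteq> e' \<and> fst e < snd e'}"
  have acyc: "acyclic (hasse_rev X M)" using morse_matching by (simp add: morse_matching_def)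
  have step: "(snd e', snd e) \<in> (hasse_rev X M)\<^sup>+" if "(e, e') \<in> R" for e e'
  proof -
    have e: "e \<in> level_pairs i" "e' \<in> level_pairs i" "e \<noteq> e'" "fst e < snd e'" using that Q by (auto simp: R_def)
    note l = level_pair[OF i e(1)] and l' = level_pair[OF i e(2)]
    have "\<not> (\<exists>z\<in>X. fst e < z \<and> z < snd e')"
    proof
      assume "\<exists>z\<in>X. fst e < z \<and> z < snd e'"
      then obtain z where z: "z \<in> X" "fst e < z" "z < snd e'" by blast
      then have "f (fst e) < f z" "f z < f (snd e')" using f_mono l(2) l'(3) by blast+
      moreover have "admissible_edge X f e" using admissible l(1) by (simp add: admissible_matching_def)
      ultimately show False using z(1) l(6,7) l'(6,7) by (auto simp: admissible_edge_def split_beta)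
    qed
    then have "(fst e, snd e') \<in> hasse X" using l(2) l'(3) e(4) by (simp add: hasse_def)
    moreover have "(fst e, snd e') \<notin> M"
      using M_unique[of "(fst e, snd e')" e] M_unique[of "(fst e, snd e')" e'] l(1) l'(1) e(3) by auto
    ultimately have "(snd e', fst e) \<in> hasse_rev X M" by (simp add: hasse_rev_def)
    moreover have "(fst e, snd e) \<in> hasse_rev X M" using l(1) by (simp add: hasse_rev_def)
    ultimately show ?thesis by (meson r_into_trancl trancl_into_trancl)
  qed
  have "(snd e', snd e) \<in> (hasse_rev X M)\<^sup>+" if "(e, e') \<in> R\<^sup>+" for e e'
    using that by (induction rule: trancl_induct) (auto intro: step trancl_trans)
  then have "acyclic R" using acyc unfolding acyclic_def by blast
  moreover have "finite R"
  proof (rule finite_subset)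
    show "R \<subseteq> Q \<times> Q" by (auto simp: R_def)
    have "finite Q" using Q(1) finite_M by (auto intro: finite_subset simp: level_pairs_def)
    then show "finite (Q \<times> Q)" by simp
  qed
  ultimately have "wf (R\<inverse>)" by (simp add: finite_acyclic_wf_converse)
  then show ?thesis
  proof (rule wfE_min'[OF _ Q(2)])
    fix e assume e: "e \<in> Q" "\<And>e'. (e', e) \<in> R\<inverse> \<Longrightarrow> e' \<notin> Q"
    have "\<not> fst e < snd e'" if "e' \<in> Q" "e' \<noteq> e" for e'
    proof
      assume "fst e < snd e'"
      then have "(e', e) \<in> R\<inverse>" using that e(1) by (simp add: R_def)
      then show False using e(2) that(1) by simp
    qed
    then show ?thesis by (rule that[OF e(1)])
  qed
qed

lemma level_pairs_collapse:
  assumes i: "i \<le> r" and Q: "Q \<subseteq> level_pairs i"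
    and closed: "\<And>e e'. e \<in> Q \<Longrightarrow> e' \<in> level_pairs i \<Longrightarrow> fst e' < snd e \<Longrightarrow> e' \<in> Q"
  shows "realization (order_complex (Xs i)) strong_deformation_retract_of
    top_of_set (realization (order_complex (Xs i \<union> (fst ` Q \<union> snd ` Q))))"
  using Q closed
proof (induction "card Q" arbitrary: Q)
  case 0
  have "finite Q" using 0(2) finite_M by (auto intro: finite_subset simp: level_pairs_def)
  then have "Q = {}" using 0(1) by simp
  then show ?case using strong_deformation_retract_refl[of "top_of_set (realization (order_complex (Xs i)))"] by simp
next
  case (Suc n)
  have fQ: "finite Q" using Suc(3) finite_M by (auto intro: finite_subset simp: level_pairs_def)
  have "Q \<noteq> {}" using Suc(2) by auto
  then obtain e where e: "e \<in> Q" "\<And>e'. e' \<in> Q \<Longrightarrow> e' \<noteq> e \<Longrightarrow> \<not> fst e < snd e'"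
    using level_pairs_extremal[OF i Suc(3)] by metis
  define x y where "x = fst e" and "y = snd e"
  have el: "e \<in> level_pairs i" using e(1) Suc(3) by blast
  note l = level_pair[OF i el, folded x_def y_def]
  let ?Q = "Q - {e}"
  let ?P = "Xs i \<union> (fst ` ?Q \<union> snd ` ?Q)"
  have tt: "t i < t (Suc i)" using t_less[of i "Suc i"] l(5) by simp
  have P: "z \<in> X" "f z \<le> t (Suc i)" "f z = t (Suc i) \<Longrightarrow> \<exists>e'\<in>?Q. z = snd e'" if z: "z \<in> ?P" for z
  proof -
    consider "z \<in> Xs i" | e' where "e' \<in> ?Q" "z = fst e'" | e' where "e' \<in> ?Q" "z = snd e'" using z by blast
    then have "z \<in> X \<and> f z \<le> t (Suc i) \<and> (f z = t (Suc i) \<longrightarrow> (\<exists>e'\<in>?Q. z = snd e'))"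
    proof cases
      case 1 then show ?thesis using tt by (auto simp: Xs_def)
    next
      case 2
      then show ?thesis using level_pair[OF i, of e'] Suc(3) tt by auto
    next
      case 3
      then show ?thesis using level_pair[OF i, of e'] Suc(3) by auto
    qed
    then show "z \<in> X" "f z \<le> t (Suc i)" "f z = t (Suc i) \<Longrightarrow> \<exists>e'\<in>?Q. z = snd e'" by auto
  qed
  have QM: "e' \<in> M" "e' \<noteq> e" if "e' \<in> ?Q" for e' using that Suc(3) by (auto simp: level_pairs_def)
  have xP: "x \<notin> ?P"
  proof
    assume "x \<in> ?P"
    then consider "x \<in> Xs i" | e' where "e' \<in> ?Q" "x = fst e' \<or> x = snd e'" by blast
    then show False
    proof cases
      case 1
      have "(x, y) \<in> M" using l(1) by (simp add: x_def y_def)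
      then show False using 1 l(6) by (auto simp: Xs_def)
    next
      case 2 then show False using M_unique[of e e'] QM l(1) by (auto simp: x_def)
    qed
  qed
  have yP: "y \<notin> ?P"
  proof
    assume "y \<in> ?P"
    then obtain e' where "e' \<in> ?Q" "y = snd e'" using P(3)[of y] l(7) by blast
    then show False using M_unique[of e e'] QM l(1) by (auto simp: y_def)
  qed
  have closed': "e'' \<in> ?Q" if "e' \<in> ?Q" "e'' \<in> level_pairs i" "fst e'' < snd e'" for e' e''
    using Suc(4)[of e' e''] e(2)[of e'] that by auto
  have link: "{z \<in> ?P. z < y} = descending_link X y - {x}"
  proof (intro equalityI subsetI)
    fix z assume "z \<in> {z \<in> ?P. z < y}"
    then show "z \<in> descending_link X y - {x}" using P(1)[of z] xP by (auto simp: descending_link_def)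
  next
    fix z assume "z \<in> descending_link X y - {x}"
    then have z: "z \<in> X" "z < y" "z \<noteq> x" by (auto simp: descending_link_def)
    then have "f z < t (Suc i)" using f_mono[of z y] l(3,7) by simp
    moreover obtain j where j: "j \<le> r" "f z = t j" using level[OF z(1)] by blast
    ultimately have "j \<le> i" using t_less[of j "Suc i"] l(5) by simp
    then have fz: "f z \<le> t i" using j t_less[of j i] i by (cases "j = i") auto
    have "z \<in> ?P"
    proof (cases "f z = t i \<and> (\<exists>y'. (z, y') \<in> M)")
      case False then show ?thesis using z(1) fz by (auto simp: Xs_def)
    next
      case True
      then obtain y' where y': "(z, y') \<in> M" "f z = t i" by blast
      then have "(z, y') \<in> level_pairs i" by (simp add: level_pairs_def)
      then have "(z, y') \<in> Q" using Suc(4)[OF e(1)] z(2) by (simp add: y_def)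
      moreover have "(z, y') \<noteq> e" using z(3) by (auto simp: x_def)
      ultimately have "(z, y') \<in> ?Q" by blast
      then show ?thesis by force
    qed
    then show "z \<in> {z \<in> ?P. z < y}" using z(2) by simp
  qed
  have "admissible_edge X f e" using admissible l(1) by (simp add: admissible_matching_def)
  then have triv: "homotopically_trivial {z \<in> ?P. z < y}"
    unfolding link by (auto simp: admissible_edge_def x_def y_def split_beta)
  have "?P \<subseteq> X" using P(1) by blast
  then have finP: "finite ?P" using fin by (rule finite_subset)
  have "realization (order_complex ?P) strong_deformation_retract_of
    top_of_set (realization (order_complex (insert x (insert y ?P))))"
  proof (rule pair_collapse[OF finP l(4) xP yP _ _ triv])
    fix z assume z: "z \<in> ?P"
    show "\<not> y < z" using f_mono[OF l(3) P(1)[OF z]] P(2)[OF z] l(7) by auto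
    show "\<not> x < z"
    proof
      assume xz: "x < z"
      then have "t i < f z" using f_mono[OF l(2) P(1)[OF z]] l(6) by simp
      moreover obtain j where j: "j \<le> r" "f z = t j" using level[OF P(1)[OF z]] by blast
      ultimately have "Suc i \<le> j" using t_less[of i j] i by simp
      then have "f z = t (Suc i)" using P(2)[OF z] j t_less[of "Suc i" j] l(5) by (cases "j = Suc i") auto
      then obtain e' where "e' \<in> ?Q" "z = snd e'" using P(3)[OF z] by blast
      then show False using e(2)[of e'] xz by (auto simp: x_def)
    qed
  qed
  moreover have "insert x (insert y ?P) = Xs i \<union> (fst ` Q \<union> snd ` Q)"
  proof -
    have "fst ` Q = insert x (fst ` ?Q)" "snd ` Q = insert y (snd ` ?Q)" using e(1) by (auto simp: x_def y_def)
    then show ?thesis by blast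
  qed
  moreover have "realization (order_complex (Xs i)) strong_deformation_retract_of top_of_set (realization (order_complex ?P))"
  proof (rule Suc(1))
    show "n = card ?Q" using Suc(2) e(1) fQ by simp
    show "?Q \<subseteq> level_pairs i" using Suc(3) by blast
  qed (rule closed')
  ultimately show ?case by (metis strong_deformation_retract_trans)
qed

lemma Xs_retract:
  assumes "i \<le> r"
  shows "realization (order_complex (Xs i)) strong_deformation_retract_of top_of_set (realization (order_complex (Xt (int i))))"
  unfolding Xt_int by (rule level_pairs_collapse[OF assms subset_refl])

end

context morse_filtration
begin

abbreviation link_complex :: "'a \<Rightarrow> 'a set set" where
  "link_complex x \<equiv> order_complex (descending_link X x)"

definition stage :: "nat \<Rightarrow> ('a \<times> ('a \<Rightarrow> real)) topology \<Rightarrow> bool" where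
  "stage i Y \<longleftrightarrow> compact_space Y \<and> fst ` topspace Y \<subseteq> (\<Union>k<i. C k) \<and>
     (\<exists>(J :: ('a \<times> 'a set) set) \<Gamma>. cell_structure Y J snd (\<lambda>j. \<Gamma> (fst j)) \<and> fst ` J \<subseteq> (\<Union>k<i. C k)) \<and>
     (case i of 0 \<Rightarrow> topspace Y = {}
      | Suc k \<Rightarrow> realization_top (order_complex (Xs k)) homotopy_equivalent_space Y)"

lemma stage_0: "stage 0 (discrete_topology {})"
proof -
  have "cell_structure (discrete_topology {} :: ('a \<times> ('a \<Rightarrow> real)) topology) {} snd (\<lambda>j. \<Gamma> (fst j))"
    for \<Gamma> :: "'a \<Rightarrow> ('a \<Rightarrow> real) \<Rightarrow> 'a \<times> ('a \<Rightarrow> real)"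
    by (simp add: cell_structure_def disjoint_family_on_def Hausdorff_space_def)
  then show ?thesis unfolding stage_def
    by (auto simp: compact_space_def intro!: exI[of _ "{}"])
qed

lemma stage_finite_CW: "stage i Y \<Longrightarrow> finite_CW_complex Y"
  unfolding stage_def using cell_complex.finite_CW_complex[OF cell_complex.intro] by blast

lemma stage_homotopy_equivalent:
  assumes i: "i \<le> r" and Y: "stage i Y"
  shows "realization_top (order_complex (Xt (int i - 1))) homotopy_equivalent_space Y"
proof (cases i)
  case 0
  then have "Xt (int i - 1) = {}" by (simp add: Xt_def)
  moreover have "order_complex ({} :: 'a set) = {}" by (auto simp: order_complex_def)
  ultimately have "realization (order_complex (Xt (int i - 1))) = {}" by (simp add: realization_def)
  moreover have "topspace Y = {}" using Y 0 by (simp add: stage_def)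
  ultimately show ?thesis
    unfolding homotopy_equivalent_space_def
    by (auto simp: continuous_map_on_empty intro!: exI[of _ undefined] homotopic_with_equal)
next
  case (Suc k)
  have "realization_top (order_complex (Xs k)) homotopy_equivalent_space realization_top (order_complex (Xt (int i - 1)))"
    using strong_deformation_retract_homotopy_equivalent[OF Xs_retract[of k]] i Suc by simp
  moreover have "realization_top (order_complex (Xs k)) homotopy_equivalent_space Y"
    using Y Suc by (simp add: stage_def)
  ultimately show ?thesis
    using homotopy_equivalent_space_sym homotopy_eqv_trans by blast
qed

lemma C_disjoint: "i \<le> r \<Longrightarrow> x \<in> C i \<Longrightarrow> x \<notin> (\<Union>k<i. C k)"
  using t_eq by (auto simp: C_mem)

lemma stage_step:
  assumes i: "i \<le> r" and Y: "stage i Y"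
  shows "\<exists>Y'. stage (Suc i) Y' \<and> (\<exists>\<gamma>. cones_glued Y (C i) link_complex \<gamma> Y')"
proof -
  let ?P = "Xt (int i - 1)"
  let ?K = "realization (order_complex ?P)"
  note att = attach_facts[OF i]
  have L: "link_complex x = order_complex {z\<in>?P. z < x}" if "x \<in> C i" for x
    using descending_link_eq[OF i that] by simp
  obtain J :: "('a \<times> 'a set) set" and \<Gamma> where J: "cell_structure Y J snd (\<lambda>j. \<Gamma> (fst j))" "fst ` J \<subseteq> (\<Union>k<i. C k)"
    using Y unfolding stage_def by blast
  have topY: "fst ` topspace Y \<subseteq> (\<Union>k<i. C k)" and cY: "compact_space Y" using Y unfolding stage_def by blast+
  interpret cell_complex Y J snd "\<lambda>j. \<Gamma> (fst j)" by unfold_locales (rule J(1))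
  obtain h g where h: "continuous_map (top_of_set ?K) Y h" and g: "continuous_map Y (top_of_set ?K) g"
    and gh: "homotopic_with (\<lambda>_. True) (top_of_set ?K) (top_of_set ?K) (g \<circ> h) id"
    and hg: "homotopic_with (\<lambda>_. True) Y Y (h \<circ> g) id"
    using stage_homotopy_equivalent[OF i Y] unfolding homotopy_equivalent_space_def by blast
  have A: "glued (top_of_set ?K) (C i) link_complex (\<lambda>x w. w) (top_of_set (realization (order_complex (?P \<union> C i))))"
    by (rule glued_order_complex[OF att(1,2,3,4,5) L])
  interpret A: gluing "top_of_set ?K" "C i" link_complex "\<lambda>x w. w" "top_of_set (realization (order_complex (?P \<union> C i)))"
    by unfold_locales (rule A)
  have "\<forall>x\<in>C i. \<exists>\<psi>. homotopic_with (\<lambda>_. True) (realization_top (link_complex x)) Y h \<psi> \<and>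
    (\<forall>w\<in>realization (link_complex x). \<psi> w \<in> skeleton J snd (\<lambda>j. \<Gamma> (fst j)) (card (supp w)))"
  proof
    fix x assume x: "x \<in> C i"
    have "continuous_map (realization_top (link_complex x)) Y (h \<circ> (\<lambda>w. w))"
      by (rule continuous_map_compose[OF A.cont_base[OF x] h])
    then show "\<exists>\<psi>. homotopic_with (\<lambda>_. True) (realization_top (link_complex x)) Y h \<psi> \<and>
      (\<forall>w\<in>realization (link_complex x). \<psi> w \<in> skeleton J snd (\<lambda>j. \<Gamma> (fst j)) (card (supp w)))"
      by (intro cellular_approximation pointed_cone.fin[OF A.cone[OF x]]) (simp add: o_def)
  qed
  from bchoice[OF this] obtain \<psi> where "\<forall>x\<in>C i. homotopic_with (\<lambda>_. True) (realization_top (link_complex x)) Y h (\<psi> x) \<and>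
    (\<forall>w\<in>realization (link_complex x). \<psi> x w \<in> skeleton J snd (\<lambda>j. \<Gamma> (fst j)) (card (supp w)))" by (rule exE)
  then have \<psi>: "homotopic_with (\<lambda>_. True) (realization_top (link_complex x)) Y h (\<psi> x)"
    "w \<in> realization (link_complex x) \<Longrightarrow> \<psi> x w \<in> skeleton J snd (\<lambda>j. \<Gamma> (fst j)) (card (supp w))" if "x \<in> C i" for x w
    using that by simp_all
  define \<gamma> where "\<gamma> = (\<lambda>x w. if w \<in> realization (link_complex x) then \<psi> x w else (x, w))"
  obtain T where "glued Y (C i) link_complex (\<lambda>x w. if w \<in> realization (link_complex x) then \<psi> x w else (x, w)) T"
  proof (rule glue_exists[OF att(5) A.cone cY hausdorff])
    show "(x, w) \<notin> topspace Y" if "x \<in> C i" for x w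
    proof
      assume "(x, w) \<in> topspace Y"
      then have "x \<in> fst ` topspace Y" by force
      then show False using topY C_disjoint[OF i that] by blast
    qed
    show "continuous_map (realization_top (link_complex x)) Y (\<psi> x)" if "x \<in> C i" for x
      using homotopic_with_imp_continuous_maps[OF \<psi>(1)[OF that]] by blast
  qed
  then have T: "glued Y (C i) link_complex \<gamma> T" by (simp only: \<gamma>_def)
  interpret T: gluing Y "C i" link_complex \<gamma> T by unfold_locales (rule T)
  have \<gamma>b: "\<gamma> x w = \<psi> x w" if "w \<in> realization (link_complex x)" for x w using that by (simp add: \<gamma>_def)
  have \<gamma>n: "fst (\<gamma> x w) = x" if "w \<notin> realization (link_complex x)" for x w using that by (simp add: \<gamma>_def)
  define \<Gamma>' where "\<Gamma>' x = (if x \<in> C i then \<gamma> else \<Gamma>) x" for x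
  define J' where "J' = J \<union> (SIGMA x:C i. {\<tau> \<in> simplicial_cone x (link_complex x). x \<in> \<tau>})"
  have "cell_structure T J' snd (\<lambda>j. \<Gamma>' (fst j))"
    unfolding \<Gamma>'_def J'_def
  proof (rule cell_structure_glued[OF J(1) T])
    show "\<gamma> x w \<in> skeleton J snd (\<lambda>j. \<Gamma> (fst j)) (card (supp w))" if "x \<in> C i" "w \<in> realization (link_complex x)" for x w
      using \<psi>(2)[OF that] \<gamma>b[OF that(2)] by simp
    show "fst ` J \<inter> C i = {}" using J(2) C_disjoint[OF i] by blast
  qed
  moreover have "fst ` J' \<subseteq> (\<Union>k<Suc i. C k)"
  proof -
    have "fst ` J' \<subseteq> fst ` J \<union> C i" by (auto simp: J'_def)
    also have "\<dots> \<subseteq> (\<Union>k<Suc i. C k)" using J(2) by (auto simp: lessThan_Suc)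
    finally show ?thesis .
  qed
  moreover have "fst ` topspace T \<subseteq> (\<Union>k<Suc i. C k)"
  proof -
    have "fst ` topspace T \<subseteq> fst ` topspace Y \<union> C i"
      unfolding T.top using \<gamma>n by auto
    also have "\<dots> \<subseteq> (\<Union>k<Suc i. C k)" using topY by (auto simp: lessThan_Suc)
    finally show ?thesis .
  qed
  moreover have "realization_top (order_complex (Xs i)) homotopy_equivalent_space T"
    unfolding Xs_eq[OF i]
  proof (rule homotopy_equivalent_glued[OF A T h g gh hg])
    fix x assume x: "x \<in> C i"
    show "homotopic_with (\<lambda>_. True) (realization_top (link_complex x)) Y (h \<circ> (\<lambda>w. w)) (\<gamma> x)"
      by (rule homotopic_with_eq[OF \<psi>(1)[OF x]]) (simp_all add: \<gamma>b)
  qed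
  ultimately have "stage (Suc i) T" using T.compact_T unfolding stage_def by auto
  then show ?thesis using T.cones_glued by blast
qed

lemma CW_model:
  "\<exists>(Y :: nat \<Rightarrow> ('a \<times> ('a \<Rightarrow> real)) topology) \<gamma>.
     topspace (Y 0) = {} \<and> (\<forall>i\<le>r. cones_glued (Y i) (C i) link_complex (\<gamma> i) (Y (Suc i))) \<and>
     (\<forall>i\<le>Suc r. finite_CW_complex (Y i)) \<and>
     realization_top (order_complex X) homotopy_equivalent_space Y (Suc r)"
proof -
  have "\<exists>Y. \<forall>i. (i \<le> Suc r \<longrightarrow> stage i (Y i)) \<and> (i \<le> r \<longrightarrow> (\<exists>\<gamma>. cones_glued (Y i) (C i) link_complex \<gamma> (Y (Suc i))))"
  proof (rule dependent_nat_choice)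
    show "\<exists>Y. 0 \<le> Suc r \<longrightarrow> stage 0 Y" using stage_0 by blast
    show "\<exists>Y'. (Suc i \<le> Suc r \<longrightarrow> stage (Suc i) Y') \<and> (i \<le> r \<longrightarrow> (\<exists>\<gamma>. cones_glued Y (C i) link_complex \<gamma> Y'))"
      if "i \<le> Suc r \<longrightarrow> stage i Y" for Y i
      using that stage_step[of i Y] by (cases "i \<le> r") auto
  qed
  then obtain Y where Y: "\<And>i. i \<le> Suc r \<Longrightarrow> stage i (Y i)"
    "\<And>i. i \<le> r \<Longrightarrow> \<exists>\<gamma>. cones_glued (Y i) (C i) link_complex \<gamma> (Y (Suc i))" by blast
  from Y(2) have "\<forall>i. \<exists>\<gamma>. i \<le> r \<longrightarrow> cones_glued (Y i) (C i) link_complex \<gamma> (Y (Suc i))" by blast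
  from choice[OF this] obtain \<gamma> where \<gamma>: "\<forall>i. i \<le> r \<longrightarrow> cones_glued (Y i) (C i) link_complex (\<gamma> i) (Y (Suc i))" by (rule exE)
  have "topspace (Y 0) = {}" using Y(1)[of 0] by (simp add: stage_def)
  moreover have "realization_top (order_complex X) homotopy_equivalent_space Y (Suc r)"
    using Y(1)[of "Suc r"] Xs_r by (simp add: stage_def)
  moreover have "\<forall>i\<le>Suc r. finite_CW_complex (Y i)" using stage_finite_CW[OF Y(1)] by blast
  ultimately show ?thesis using \<gamma> by (intro exI[of _ Y] exI[of _ \<gamma>] conjI)
qed

end

theorem theorem3p2:
  fixes X :: "'a::order set" and f :: "'a \<Rightarrow> real" and M :: "('a \<times> 'a) set"
    and t :: "nat \<Rightarrow> real" and r :: nat and C :: "nat \<Rightarrow> 'a set"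
  assumes "finite X" and "X \<noteq> {}"
    and "morse_function X f"
    and "morse_matching X M"
    and "admissible_matching X f M"
    and "strict_mono_on {..r} t" and "t ` {..r} = f ` X"
    and "\<And>i. C i = {x \<in> critical_points X M. f x = t i}"
  shows
    "(\<exists>(Y :: nat \<Rightarrow> ('a \<times> ('a \<Rightarrow> real)) topology) \<gamma>.
        topspace (Y 0) = {} \<and>
        (\<forall>i\<le>r. cones_glued (Y i) (C i) (\<lambda>x. order_complex (descending_link X x)) (\<gamma> i)
                  (Y (Suc i))) \<and>
        (\<forall>i\<le>Suc r. finite_CW_complex (Y i)) \<and>
        realization_top (order_complex X) homotopy_equivalent_space Y (Suc r))
     \<and>
     (\<exists>(Xs :: nat \<Rightarrow> 'a set) (Xt :: int \<Rightarrow> 'a set).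
        Xt (- 1) = {} \<and>
        (\<forall>i\<le>r. Xt (int i - 1) \<subseteq> Xs i) \<and>
        (\<forall>i<r. Xs i \<subseteq> Xt (int i)) \<and>
        Xs r = X \<and>
        (\<forall>i\<le>r.
           order_complex (Xs i) =
             order_complex (Xt (int i - 1)) \<union>
             (\<Union>x\<in>C i. simplicial_cone x (order_complex (descending_link X x))) \<and>
           (\<forall>x\<in>C i.
              simplicial_cone x (order_complex (descending_link X x)) \<inter> order_complex (Xt (int i - 1)) =
                order_complex (descending_link X x)) \<and>
           (\<forall>x\<in>C i. \<forall>y\<in>C i. x \<noteq> y \<longrightarrow>
              simplicial_cone x (order_complex (descending_link X x)) \<inter>
              simplicial_cone y (order_complex (descending_link X y)) \<subseteq> order_complex (Xt (int i - 1)))) \<and>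
        (\<forall>i<r. realization (order_complex (Xs i))
                 strong_deformation_retract_of realization_top (order_complex (Xt (int i)))))"
proof -
  interpret F: morse_filtration X f M t r C
    by unfold_locales (rule assms)+
  have complexes: "order_complex (F.Xs i) = order_complex (F.Xt (int i - 1)) \<union> (\<Union>x\<in>C i. simplicial_cone x (F.link_complex x))"
    "x \<in> C i \<Longrightarrow> simplicial_cone x (F.link_complex x) \<inter> order_complex (F.Xt (int i - 1)) = F.link_complex x"
    "x \<in> C i \<Longrightarrow> y \<in> C i \<Longrightarrow> x \<noteq> y \<Longrightarrow>
      simplicial_cone x (F.link_complex x) \<inter> simplicial_cone y (F.link_complex y) \<subseteq> order_complex (F.Xt (int i - 1))"
    if i: "i \<le> r" for i x y
  proof -
    note att = F.attach_facts(1-3)[OF i]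
    note L = F.descending_link_eq[OF i]
    have "(\<Union>x\<in>C i. simplicial_cone x (F.link_complex x)) =
      (\<Union>x\<in>C i. simplicial_cone x (order_complex {z \<in> F.Xt (int i - 1). z < x}))"
      by (rule SUP_cong[OF refl]) (simp add: L)
    then show "order_complex (F.Xs i) = order_complex (F.Xt (int i - 1)) \<union> (\<Union>x\<in>C i. simplicial_cone x (F.link_complex x))"
      using order_complex_add_antichain[OF att] by (simp only: F.Xs_eq[OF i])
    show "simplicial_cone x (F.link_complex x) \<inter> order_complex (F.Xt (int i - 1)) = F.link_complex x" if "x \<in> C i"
      using cone_Int_order_complex[OF att that] by (simp only: L[OF that])
    show "simplicial_cone x (F.link_complex x) \<inter> simplicial_cone y (F.link_complex y) \<subseteq> order_complex (F.Xt (int i - 1))"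
      if "x \<in> C i" "y \<in> C i" "x \<noteq> y"
      using cone_Int_cone[OF att that] by (simp only: L[OF that(1)] L[OF that(2)])
  qed
  have "F.Xt (- 1) = {}" by (simp add: F.Xt_def)
  moreover have "\<forall>i\<le>r. F.Xt (int i - 1) \<subseteq> F.Xs i" using F.Xs_eq by blast
  moreover have "\<forall>i<r. F.Xs i \<subseteq> F.Xt (int i)" using F.Xt_int by blast
  moreover have "\<forall>i<r. realization (order_complex (F.Xs i)) strong_deformation_retract_of realization_top (order_complex (F.Xt (int i)))"
    using F.Xs_retract by simp
  ultimately show ?thesis
    using F.Xs_r
    by (intro conjI F.CW_model exI[of _ F.Xs] exI[of _ F.Xt] F.Xs_r allI impI ballI complexes; simp)
qed

end
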